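(* Let $\Omega\subset\mathbb{R}^2$ be a convex open domain with compact closure containing the origin, and let $\sigma$ be arclength measure on $\partial\Omega$. Define $$\mathcal{M}f(x)=\sup_{k\in\mathbb{Z}}\Big|\int_{\partial\Omega} f(x-2^k y)\,d\sigma(y)\Big|.$$ For $\theta\in S^1$ let $\ell^+(\theta)$ be the unique affine line perpendicular to $\theta$ meeting $\partial\Omega$ such that $\Omega\subset\{y-t\theta: t>0,\ y\in\ell^+(\theta)\}$, and $\ell^-(\theta)$ the unique affine line perpendicular to $\theta$ meeting $\partial\Omega$ such that $\Omega\subset\{y+t\theta: t>0,\ y\in\ell^-(\theta)\}$. For $\delta>0$ let $\mathcal{C}^\pm(\theta,\delta)=\{y\in\partial\Omega:\mathrm{dist}(y,\ell^\pm(\theta))\le\delta\}$ and $\Lambda(\theta,\delta)=\max_\pm\sigma(\mathcal{C}^\pm(\theta,\delta))$. Let $\delta_0>0$ be such that for all $\theta\in S^1$ and all $\delta<\delta_0$ the arcs $\mathcal{C}^+(\theta,\delta)$ and $\mathcal{C}^-(\theta,\delta)$ are disjoint. Then $\mathcal{M}$ is bounded on $L^2(\mathbb{R}^2)$ if and only if $$\sup_{\theta\in S^1}\int_0^{\delta_0}\Lambda(\theta,\delta)^2\,\frac{d\delta}{\delta}<\infty.$$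
   Context: Such a $\delta_0>0$ always exists by compactness. *)

theory Defs
  imports "HOL-Analysis.Analysis"
begin

text \<open>One-dimensional Hausdorff (outer) measure, normalised so that it is
  arclength on rectifiable curves (covering by countably many bounded sets of
  diameter at most d, summing diameters, then letting d tend to 0).\<close>

definition H1_delta :: "real \<Rightarrow> ('a::metric_space) set \<Rightarrow> ennreal" where
  "H1_delta d A =
     (INF C \<in> {C :: nat \<Rightarrow> 'a set. A \<subseteq> (\<Union>i. C i) \<and>
                 (\<forall>i. bounded (C i) \<and> diameter (C i) \<le> d)}.
        (\<Sum>i. ennreal (diameter (C i))))"

definition H1 :: "('a::metric_space) set \<Rightarrow> ennreal" where
  "H1 A = (SUP d \<in> {0<..}. H1_delta d A)"

definition arclength :: "(real^2) set \<Rightarrow> (real^2) measure" where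
  "arclength \<Omega> = measure_of UNIV (sets borel) (\<lambda>A. H1 (A \<inter> frontier \<Omega>))"

definition maxop :: "(real^2) set \<Rightarrow> (real^2 \<Rightarrow> real) \<Rightarrow> real^2 \<Rightarrow> ennreal" where
  "maxop \<Omega> f x =
     (SUP k :: int. ennreal \<bar>integral\<^sup>L (arclength \<Omega>) (\<lambda>y. f (x - (2 powr real_of_int k) *\<^sub>R y))\<bar>)"

definition L2_bounded :: "(real^2) set \<Rightarrow> bool" where
  "L2_bounded \<Omega> \<longleftrightarrow> (\<exists>C::real. \<forall>f :: real^2 \<Rightarrow> real.
      f \<in> borel_measurable lborel \<longrightarrow> integrable lborel (\<lambda>x. (f x)\<^sup>2) \<longrightarrow>
      (\<integral>\<^sup>+ x. (maxop \<Omega> f x)\<^sup>2 \<partial>lborel) \<le> ennreal C * (\<integral>\<^sup>+ x. ennreal ((f x)\<^sup>2) \<partial>lborel))"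

definition ell_plus :: "(real^2) set \<Rightarrow> real^2 \<Rightarrow> (real^2) set" where
  "ell_plus \<Omega> \<theta> = (THE L. (\<exists>c. L = {y. y \<bullet> \<theta> = c}) \<and> L \<inter> frontier \<Omega> \<noteq> {} \<and>
      \<Omega> \<subseteq> {y - t *\<^sub>R \<theta> | y t. t > 0 \<and> y \<in> L})"

definition ell_minus :: "(real^2) set \<Rightarrow> real^2 \<Rightarrow> (real^2) set" where
  "ell_minus \<Omega> \<theta> = (THE L. (\<exists>c. L = {y. y \<bullet> \<theta> = c}) \<and> L \<inter> frontier \<Omega> \<noteq> {} \<and>
      \<Omega> \<subseteq> {y + t *\<^sub>R \<theta> | y t. t > 0 \<and> y \<in> L})"

definition cap_plus :: "(real^2) set \<Rightarrow> real^2 \<Rightarrow> real \<Rightarrow> (real^2) set" where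
  "cap_plus \<Omega> \<theta> \<delta> = {y \<in> frontier \<Omega>. infdist y (ell_plus \<Omega> \<theta>) \<le> \<delta>}"

definition cap_minus :: "(real^2) set \<Rightarrow> real^2 \<Rightarrow> real \<Rightarrow> (real^2) set" where
  "cap_minus \<Omega> \<theta> \<delta> = {y \<in> frontier \<Omega>. infdist y (ell_minus \<Omega> \<theta>) \<le> \<delta>}"

definition Lambda :: "(real^2) set \<Rightarrow> real^2 \<Rightarrow> real \<Rightarrow> real" where
  "Lambda \<Omega> \<theta> \<delta> = max (measure (arclength \<Omega>) (cap_plus \<Omega> \<theta> \<delta>))
                         (measure (arclength \<Omega>) (cap_minus \<Omega> \<theta> \<delta>))"

end

theory Submission
  imports Defs "HOL-Probability.Characteristic_Functions"
begin

text \<open>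
  Necessity. Test the maximal operator on the indicator of a strip of width \<open>\<epsilon>\<close> orthogonal to \<open>\<theta>\<close>. On the
  translate of the strip that touches the \<open>2^k\<close>-dilate of the supporting line, the average over the
  \<open>2^k\<close>-dilate of the boundary sees the whole cap of height \<open>2^(-k) \<epsilon>\<close>. These translates are disjoint, so the
  squares of the cap lengths at dyadic heights are summable uniformly in \<open>\<theta>\<close>.

  Sufficiency. Split the boundary into four arcs that are graphs of concave monotone functions of the height in
  direction \<open>\<theta>\<close>. Moving up by half a period \<open>s = pi / r\<close> is a contraction along such an arc, so the image of
  arclength under the height function is a decreasing measure, and its Fourier transform at \<open>r\<close> is at most the
  length of the part of the arc of height at most \<open>s\<close>. Hence the Fourier transform of arclength at \<open>r \<theta>\<close> is
  \<open>O(\<Lambda>(\<theta>, pi / r))\<close>. Subtract from arclength the multiple of the uniform measure on the unit disc with the same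
  total mass: the dyadic square function of the difference is bounded by Plancherel's theorem, and the maximal
  function of the disc averages is bounded by a \<open>T T*\<close> argument.
\<close>

section \<open>Arclength as a Borel measure\<close>

text \<open>The boundary need not be smooth, so neither a density of the projected measure nor a
  curvature is at hand. What replaces them is that arclength is a Hausdorff measure: a contraction
  between two pieces of the boundary compares their lengths, and concavity supplies the contraction.
  The segments at the two extremal heights need no oscillation, as each lies in a cap.

  Subtracting the disc makes the multiplier vanish at the origin, where it is then O(|\<xi>|); at
  infinity the disc adds only O(1 / |\<xi>|) to the term with \<Lambda>. Both bounds have summable
  squares over dyadic dilates.

  The T T* argument bounds the square of a norm by the norm and says nothing when the norm is
  infinite. It is therefore run for finitely many scales, with a resulting bound independent of
  their number.

  Arclength is singular, so convergence almost everywhere of approximations to f does not control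
  their averages over curves at a given point. The approximation error is kept as one more average
  and estimated in L2, for finitely many scales at a time.\<close>

lemma diameter_le_metric:
  fixes S :: "'a::metric_space set"
  assumes "0 \<le> d" "\<And>x y. x \<in> S \<Longrightarrow> y \<in> S \<Longrightarrow> dist x y \<le> d"
  shows "diameter S \<le> d"
  using assms by (auto simp: diameter_def intro!: cSUP_least)

lemma H1_delta_le:
  assumes "A \<subseteq> (\<Union>i. C i)" "\<And>i. bounded (C i)" "\<And>i. diameter (C i) \<le> d"
  shows "H1_delta d A \<le> (\<Sum>i. ennreal (diameter (C i)))"
  unfolding H1_delta_def using assms by (intro INF_lower) auto

lemma H1_delta_mono: "A \<subseteq> B \<Longrightarrow> H1_delta d A \<le> H1_delta d B"
  unfolding H1_delta_def by (intro INF_superset_mono) auto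

lemma H1_delta_antimono: "d \<le> e \<Longrightarrow> H1_delta e A \<le> H1_delta d A"
  unfolding H1_delta_def by (intro INF_superset_mono) (auto intro: order_trans)

lemma H1_delta_le_H1: "0 < d \<Longrightarrow> H1_delta d A \<le> H1 A"
  unfolding H1_def by (intro SUP_upper) auto

lemma H1_mono: "A \<subseteq> B \<Longrightarrow> H1 A \<le> H1 B"
  unfolding H1_def by (intro SUP_mono) (auto intro: H1_delta_mono)

lemma H1_empty [simp]: "H1 {} = 0"
proof -
  have "H1_delta d {} \<le> 0" if "0 < d" for d
    using H1_delta_le[of "{}" "\<lambda>_. {}" d] that by simp
  then show ?thesis
    unfolding H1_def by (metis (mono_tags, lifting) SUP_least greaterThan_iff le_zero_eq)
qed

text \<open>Near-optimal covers of the sets \<open>A i\<close>, with errors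
  \<open>e * (1/2) ^ Suc i\<close> that sum to \<open>e\<close>, are merged into one cover through
  \<open>prod_decode\<close>.\<close>

lemma H1_delta_UN:
  fixes A :: "nat \<Rightarrow> 'a::metric_space set"
  shows "H1_delta d (\<Union>i. A i) \<le> (\<Sum>i. H1_delta d (A i))"
proof (rule ennreal_le_epsilon)
  fix e :: real assume fin: "(\<Sum>i. H1_delta d (A i)) < top" and e: "0 < e"
  have "\<exists>C. A i \<subseteq> (\<Union>j. C j) \<and> (\<forall>j. bounded (C j) \<and> diameter (C j) \<le> d) \<and>
          (\<Sum>j. ennreal (diameter (C j))) \<le> H1_delta d (A i) + e * (1/2) ^ Suc i" for i
  proof -
    have "H1_delta d (A i) < top"
      using fin ennreal_suminf_lessD by blast
    then have "H1_delta d (A i) < H1_delta d (A i) + ennreal (e * (1/2) ^ Suc i)"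
      using e by (simp add: ennreal_less_iff less_top)
    then show ?thesis
      unfolding H1_delta_def INF_less_iff by (auto intro: less_imp_le)
  qed
  then obtain C where C: "\<And>i. A i \<subseteq> (\<Union>j. C i j)" "\<And>i j. bounded (C i j)"
      "\<And>i j. diameter (C i j) \<le> d"
      "\<And>i. (\<Sum>j. ennreal (diameter (C i j))) \<le> H1_delta d (A i) + e * (1/2) ^ Suc i"
    by metis
  define D where "D = case_prod C \<circ> prod_decode"
  have cov: "(\<Union>i. A i) \<subseteq> (\<Union>i. D i)"
  proof
    fix x assume "x \<in> (\<Union>i. A i)"
    then obtain i j where "x \<in> C i j" using C(1) by fast
    then have "x \<in> D (prod_encode (i, j))" by (simp add: D_def)
    then show "x \<in> (\<Union>i. D i)" by blast
  qed
  have "H1_delta d (\<Union>i. A i) \<le> (\<Sum>i. ennreal (diameter (D i)))"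
    using cov C by (intro H1_delta_le) (auto simp: D_def split: prod.split)
  also have "\<dots> = (\<Sum>i. ennreal (diameter (case_prod C (prod_decode i))))"
    by (simp add: D_def)
  also have "\<dots> = (\<Sum>n. \<Sum>i. ennreal (diameter (C n i)))"
    by (intro suminf_ennreal_2dimen[of _ "\<lambda>p. ennreal (diameter (case_prod C p))"]) auto
  also have "\<dots> \<le> (\<Sum>n. H1_delta d (A n) + e * (1/2) ^ Suc n)"
    by (intro suminf_le allI C summableI)
  also have "... = (\<Sum>n. H1_delta d (A n)) + (\<Sum>n. ennreal e * ennreal ((1/2) ^ Suc n))"
    using e by (subst suminf_add[symmetric])
       (auto simp del: ennreal_suminf_cmult simp add: ennreal_mult[symmetric])
  also have "\<dots> = (\<Sum>n. H1_delta d (A n)) + e"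
    unfolding ennreal_suminf_cmult
    by (subst suminf_ennreal_eq[OF zero_le_power power_half_series]) auto
  finally show "H1_delta d (\<Union>i. A i) \<le> (\<Sum>i. H1_delta d (A i)) + ennreal e" .
qed

lemma H1_UN:
  fixes A :: "nat \<Rightarrow> 'a::metric_space set"
  shows "H1 (\<Union>i. A i) \<le> (\<Sum>i. H1 (A i))"
  unfolding H1_def[of "\<Union>i. A i"]
proof (rule SUP_least)
  fix d :: real assume "d \<in> {0<..}"
  then have "(\<Sum>i. H1_delta d (A i)) \<le> (\<Sum>i. H1 (A i))"
    by (intro suminf_le summableI allI H1_delta_le_H1) auto
  then show "H1_delta d (\<Union>i. A i) \<le> (\<Sum>i. H1 (A i))"
    using H1_delta_UN order_trans by blast
qed

lemma H1_Un: "H1 (A \<union> B) \<le> H1 A + H1 B"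
proof -
  have "H1 (A \<union> B) \<le> (\<Sum>i. H1 (binaryset A B i))"
    using H1_UN[of "binaryset A B"] by (simp add: UN_binaryset_eq)
  then show ?thesis
    by (simp add: suminf_binaryset_eq)
qed

text \<open>At a scale \<open>d\<close> below the gap \<open>e\<close> no set of a cover can meet
  both \<open>A\<close> and \<open>B\<close>, so a cover of the union contains disjoint subfamilies
  that cover \<open>A\<close> and \<open>B\<close>.\<close>

lemma H1_delta_separated:
  assumes "0 < d" "d < e" and sep: "\<And>x y. x \<in> A \<Longrightarrow> y \<in> B \<Longrightarrow> e \<le> dist x y"
  shows "H1_delta d A + H1_delta d B \<le> H1_delta d (A \<union> B)"
  unfolding H1_delta_def[of d "A \<union> B"]
proof (rule INF_greatest)
  fix C :: "nat \<Rightarrow> 'a set"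
  assume "C \<in> {C. A \<union> B \<subseteq> \<Union> (range C) \<and> (\<forall>i. bounded (C i) \<and> diameter (C i) \<le> d)}"
  then have C: "A \<union> B \<subseteq> (\<Union>i. C i)" "\<And>i. bounded (C i)" "\<And>i. diameter (C i) \<le> d"
    by auto
  define CA where "CA = (\<lambda>i. if C i \<inter> A \<noteq> {} then C i else {})"
  define CB where "CB = (\<lambda>i. if C i \<inter> B \<noteq> {} then C i else {})"
  have one: "C i \<inter> A = {} \<or> C i \<inter> B = {}" for i
  proof (rule ccontr)
    assume "\<not> ?thesis"
    then obtain x y where "x \<in> C i" "x \<in> A" "y \<in> C i" "y \<in> B" by auto
    then have "e \<le> dist x y" "dist x y \<le> d"
      using sep diameter_bounded_bound[OF C(2)] C(3) order_trans by blast+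
    then show False using assms by simp
  qed
  have "H1_delta d A \<le> (\<Sum>i. ennreal (diameter (CA i)))"
    using C assms by (intro H1_delta_le) (auto simp: CA_def, blast)
  moreover have "H1_delta d B \<le> (\<Sum>i. ennreal (diameter (CB i)))"
    using C assms by (intro H1_delta_le) (auto simp: CB_def, blast)
  ultimately have "H1_delta d A + H1_delta d B
      \<le> (\<Sum>i. ennreal (diameter (CA i))) + (\<Sum>i. ennreal (diameter (CB i)))"
    by (rule add_mono)
  also have "\<dots> = (\<Sum>i. ennreal (diameter (CA i)) + ennreal (diameter (CB i)))"
    by (rule suminf_add) auto
  also have "\<dots> \<le> (\<Sum>i. ennreal (diameter (C i)))"
  proof (intro suminf_le summableI allI)
    fix i
    show "ennreal (diameter (CA i)) + ennreal (diameter (CB i)) \<le> ennreal (diameter (C i))"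
      using one[of i] by (auto simp: CA_def CB_def)
  qed
  finally show "H1_delta d A + H1_delta d B \<le> (\<Sum>i. ennreal (diameter (C i)))" .
qed

lemma H1_separated:
  assumes "0 < e" and sep: "\<And>x y. x \<in> A \<Longrightarrow> y \<in> B \<Longrightarrow> e \<le> dist x y"
  shows "H1 A + H1 B \<le> H1 (A \<union> B)"
proof -
  have "H1 A + H1 B = (SUP d\<in>{0<..}. H1_delta d A + H1_delta d B)"
    unfolding H1_def
  proof (rule SUP_add_directed_ennreal[symmetric])
    fix i j :: real assume "i \<in> {0<..}" "j \<in> {0<..}"
    then show "\<exists>k\<in>{0<..}. H1_delta i A + H1_delta j B \<le> H1_delta k A + H1_delta k B"
      by (intro bexI[of _ "min i j"] add_mono H1_delta_antimono) auto
  qed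
  also have "\<dots> \<le> H1 (A \<union> B)"
  proof (rule SUP_least)
    fix d :: real assume d: "d \<in> {0<..}"
    have "H1_delta d A + H1_delta d B \<le> H1_delta (min d (e/2)) A + H1_delta (min d (e/2)) B"
      by (intro add_mono H1_delta_antimono) auto
    also have "\<dots> \<le> H1_delta (min d (e/2)) (A \<union> B)"
      using d assms by (intro H1_delta_separated[of _ e]) auto
    also have "\<dots> \<le> H1 (A \<union> B)"
      using d assms by (intro H1_delta_le_H1) auto
    finally show "H1_delta d A + H1_delta d B \<le> H1 (A \<union> B)" .
  qed
  finally show ?thesis .
qed

text \<open>Caratheodory's criterion: the annuli around the closed set that are not adjacent are separated,
  so the measures of the annuli are summable.\<close>

lemma H1_closed_measurable:
  fixes F X :: "'a::metric_space set"
  assumes "closed F"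
  shows "H1 (X \<inter> F) + H1 (X - F) = H1 X"
proof (rule antisym)
  have "X = (X \<inter> F) \<union> (X - F)" by auto
  then show "H1 X \<le> H1 (X \<inter> F) + H1 (X - F)"
    using H1_Un[of "X \<inter> F" "X - F"] by simp
  show "H1 (X \<inter> F) + H1 (X - F) \<le> H1 X"
  proof (cases "F = {} \<or> H1 X = top")
    case True
    then show ?thesis by auto
  next
    case False
    define r where "r = (\<lambda>n::nat. 1 / (real n + 1))"
    define R where "R = (\<lambda>n. {x \<in> X. r (Suc n) \<le> infdist x F \<and> infdist x F < r n})"
    define Y where "Y = (\<lambda>n. {x \<in> X. r n \<le> infdist x F})"
    have r_pos: "0 < r n" for n by (simp add: r_def)
    have r_anti: "m \<le> n \<Longrightarrow> r n \<le> r m" for m n by (simp add: r_def frac_le)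
    have r_strict: "r (Suc n) < r n" for n by (simp add: r_def frac_less2)
    have inf_le: "infdist x F - infdist y F \<le> dist x y" for x y
      using infdist_triangle[of x F y] by simp
    \<comment> \<open>Between two annuli of equal parity lies a full annulus of the other parity.
      Its width, here \<open>r (2*n+j-1) - r (2*n+j)\<close>, is the gap that
      \<open>H1_separated\<close> asks for.\<close>
    have partial: "(\<Sum>k<n. H1 (R (2*k+j))) \<le> H1 (\<Union>k<n. R (2*k+j))" for n j
    proof (induction n)
      case (Suc n)
      have "(\<Sum>k<Suc n. H1 (R (2*k+j))) \<le> H1 (\<Union>k<n. R (2*k+j)) + H1 (R (2*n+j))"
        using Suc by (simp add: add_right_mono)
      also have "\<dots> \<le> H1 ((\<Union>k<n. R (2*k+j)) \<union> R (2*n+j))"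
      proof (cases "n = 0")
        case False
        show ?thesis
        proof (rule H1_separated)
          show "0 < r (2*n+j-1) - r (2*n+j)"
            using r_strict[of "2*n+j-1"] False by (simp add: Suc_diff_1)
          fix x y assume "x \<in> (\<Union>k<n. R (2*k+j))" "y \<in> R (2*n+j)"
          then obtain k where k: "k < n" "r (Suc (2*k+j)) \<le> infdist x F" "infdist y F < r (2*n+j)"
            by (auto simp: R_def)
          have "r (2*n+j-1) \<le> r (Suc (2*k+j))"
            using k by (intro r_anti) auto
          then show "r (2*n+j-1) - r (2*n+j) \<le> dist x y"
            using k inf_le[of x y] by simp
        qed
      qed simp
      also have "\<dots> = H1 (\<Union>k<Suc n. R (2*k+j))"
        by (simp add: lessThan_Suc Un_commute)
      finally show ?case .
    qed simp
    have "(\<Sum>k. H1 (R (2*k+j))) \<le> H1 X" for j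
      by (intro suminf_le_const summableI order_trans[OF partial] H1_mono) (auto simp: R_def)
    then have half: "(\<Sum>k. H1 (R (2*k+j))) < top" for j
      using False by (metis less_top top.extremum_uniqueI)
    have fin: "(\<Sum>k. H1 (R k)) < top"
    proof -
      have "(\<Sum>k<n. H1 (R k)) \<le> (\<Sum>k. H1 (R (2*k+0))) + (\<Sum>k. H1 (R (2*k+1)))" for n
      proof -
        have "(\<Sum>k<n. H1 (R k)) \<le> (\<Sum>k<2*n. H1 (R k))"
          by (intro sum_mono2) auto
        also have "(\<Sum>k<2*n. H1 (R k)) = (\<Sum>k<n. H1 (R (2*k+0))) + (\<Sum>k<n. H1 (R (2*k+1)))"
          by (induction n) (auto simp: ac_simps)
        also have "\<dots> \<le> (\<Sum>k. H1 (R (2*k+0))) + (\<Sum>k. H1 (R (2*k+1)))"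
          by (intro add_mono sum_le_suminf) auto
        finally show ?thesis .
      qed
      then have "(\<Sum>k. H1 (R k)) \<le> (\<Sum>k. H1 (R (2*k+0))) + (\<Sum>k. H1 (R (2*k+1)))"
        by (intro suminf_le_const summableI)
      also have "\<dots> < top" using half[of 0] half[of 1] by (simp add: less_top)
      finally show ?thesis .
    qed
    \<comment> \<open>Here closedness of \<open>F\<close> enters: a point outside \<open>F\<close>
      has positive distance from it, hence lies in some annulus.\<close>
    have cover: "X - F \<subseteq> Y n \<union> (\<Union>k. R (k + n))" for n
    proof
      fix x assume x: "x \<in> X - F"
      then have pos: "0 < infdist x F"
        using False assms infdist_pos_not_in_closed by auto
      show "x \<in> Y n \<union> (\<Union>k. R (k + n))"
      proof (cases "r n \<le> infdist x F")
        case True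
        then show ?thesis using x by (simp add: Y_def)
      next
        case False
        obtain m where "1 / real (Suc m) < infdist x F" using nat_approx_posE[OF pos] .
        then have m: "r m \<le> infdist x F" by (simp add: r_def add.commute)
        define p where "p = (LEAST m. r m \<le> infdist x F)"
        have p: "r p \<le> infdist x F" unfolding p_def using m by (rule LeastI)
        have np: "n < p"
          using p False r_anti[of p n] by (metis linorder_not_le order_trans)
        then have "\<not> r (p - 1) \<le> infdist x F"
          unfolding p_def by (intro not_less_Least) (auto simp: p_def)
        then have "x \<in> R ((p - 1 - n) + n)"
          using np p x by (auto simp: R_def)
        then show ?thesis by blast
      qed
    qed
    have bound: "H1 (X \<inter> F) + H1 (X - F) \<le> H1 X + (\<Sum>k. H1 (R (k + n)))" for n
    proof -
      have "H1 (X - F) \<le> H1 (Y n) + (\<Sum>k. H1 (R (k + n)))"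
        using H1_mono[OF cover[of n]] H1_Un[of "Y n" "\<Union>k. R (k + n)"] H1_UN[of "\<lambda>k. R (k + n)"]
        by (meson add_left_mono order_trans)
      then have "H1 (X \<inter> F) + H1 (X - F) \<le> (H1 (X \<inter> F) + H1 (Y n)) + (\<Sum>k. H1 (R (k + n)))"
        by (simp add: add.assoc add_left_mono)
      also have "H1 (X \<inter> F) + H1 (Y n) \<le> H1 ((X \<inter> F) \<union> Y n)"
      proof (rule H1_separated[OF r_pos[of n]])
        fix x y assume "x \<in> X \<inter> F" "y \<in> Y n"
        then show "r n \<le> dist x y"
          using inf_le[of y x] by (simp add: Y_def dist_commute)
      qed
      also have "\<dots> \<le> H1 X"
        by (intro H1_mono) (auto simp: Y_def)
      finally show ?thesis by (simp add: add_right_mono)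
    qed
    have "(\<lambda>n. \<Sum>k. H1 (R (k + n))) \<longlonglongrightarrow> 0"
    proof -
      have eq: "H1 (R k) = ennreal (enn2real (H1 (R k)))" for k
        using ennreal_suminf_lessD[OF fin, of k] by (simp add: less_top)
      have s: "summable (\<lambda>k. enn2real (H1 (R k)))"
        using fin by (intro summable_suminf_not_top) (simp_all add: eq[symmetric] less_top)
      have "(\<Sum>k. H1 (R (k + n))) = ennreal (\<Sum>k. enn2real (H1 (R (k + n))))" for n
      proof -
        have "(\<Sum>k. H1 (R (k + n))) = (\<Sum>k. ennreal (enn2real (H1 (R (k + n)))))"
          by (simp only: eq[symmetric])
        also have "\<dots> = ennreal (\<Sum>k. enn2real (H1 (R (k + n))))"
          using s by (intro suminf_ennreal2)
            (auto simp: summable_iff_shift[of "\<lambda>k. enn2real (H1 (R k))"])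
        finally show ?thesis .
      qed
      moreover have "(\<lambda>n. \<Sum>k. enn2real (H1 (R (k + n)))) \<longlonglongrightarrow> 0"
        using suminf_exist_split2[OF s] .
      ultimately show ?thesis
        using tendsto_ennrealI[of "\<lambda>n. \<Sum>k. enn2real (H1 (R (k + n)))" 0 sequentially] by simp
    qed
    then have "(\<lambda>n. H1 X + (\<Sum>k. H1 (R (k + n)))) \<longlonglongrightarrow> H1 X + 0"
      by (intro tendsto_add tendsto_const)
    then show ?thesis
      using bound by (intro LIMSEQ_le_const[of _ "H1 X"]) auto
  qed
qed

text \<open>The sets satisfying Caratheodory's condition form a sigma-algebra; it contains the
  closed sets and so all Borel sets.\<close>

lemma measure_space_H1: "measure_space UNIV (sets (borel :: 'a::metric_space measure)) H1"
proof -
  interpret sigma_algebra UNIV "Pow UNIV :: 'a set set" by (rule sigma_algebra_Pow)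
  have oms: "outer_measure_space (Pow UNIV) (H1 :: 'a set \<Rightarrow> ennreal)"
    unfolding outer_measure_space_def positive_def increasing_def countably_subadditive_def
    by (auto intro: H1_mono H1_UN)
  have ms: "measure_space UNIV (lambda_system UNIV (Pow UNIV) H1) (H1 :: 'a set \<Rightarrow> ennreal)"
    by (rule caratheodory_lemma[OF oms])
  then have sa: "sigma_algebra (UNIV :: 'a set) (lambda_system UNIV (Pow UNIV) H1)"
    by (simp add: measure_space_def)
  have "closed F \<Longrightarrow> F \<in> lambda_system UNIV (Pow UNIV) H1" for F :: "'a set"
    unfolding lambda_system_eq using H1_closed_measurable[of F] by simp
  then have "sets (borel :: 'a measure) \<subseteq> lambda_system UNIV (Pow UNIV) H1"
    unfolding borel_eq_closed
    by (subst sets_measure_of) (simp, rule sigma_algebra.sigma_sets_subset[OF sa], auto)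
  then show ?thesis
    by (intro measure_down[OF ms]) (use sets.sigma_algebra_axioms[of "borel :: 'a measure"] in auto)
qed

lemma sets_arclength [simp, measurable_cong]: "sets (arclength \<Omega>) = sets borel"
  unfolding arclength_def
  using sets.sigma_sets_eq[of "borel :: (real^2) measure"] by (simp add: sets_measure_of_conv)

lemma space_arclength [simp]: "space (arclength \<Omega>) = UNIV"
  unfolding arclength_def by (simp add: space_measure_of_conv)

text \<open>A \<open>measure_of\<close> term has the given values only if the set function is a
  measure on the given sets, and is zero otherwise. Countable additivity of \<open>H1\<close> on
  Borel sets is what gives \<open>arclength\<close> its meaning.\<close>

lemma emeasure_arclength:
  assumes "A \<in> sets borel"
  shows "emeasure (arclength \<Omega>) A = H1 (A \<inter> frontier \<Omega>)"
  unfolding arclength_def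
proof (rule emeasure_measure_of_sigma)
  have ca: "countably_additive (sets (borel :: (real^2) measure)) H1"
    using measure_space_H1[where 'a="real^2"] by (simp add: measure_space_def)
  show "sigma_algebra UNIV (sets (borel :: (real^2) measure))"
    using sets.sigma_algebra_axioms[of "borel :: (real^2) measure"] by simp
  show "positive (sets borel) (\<lambda>A. H1 (A \<inter> frontier \<Omega>))"
    by (simp add: positive_def)
  show "countably_additive (sets borel) (\<lambda>A. H1 (A \<inter> frontier \<Omega>))"
    unfolding countably_additive_def
  proof (intro allI impI)
    fix A :: "nat \<Rightarrow> (real^2) set"
    assume A: "range A \<subseteq> sets borel" "disjoint_family A" "\<Union> (range A) \<in> sets borel"
    have "(\<Sum>i. H1 (A i \<inter> frontier \<Omega>)) = H1 (\<Union>i. A i \<inter> frontier \<Omega>)"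
      using A by (intro ca[unfolded countably_additive_def, rule_format])
        (auto simp: disjoint_family_on_def intro!: sets.Int)
    then show "(\<Sum>i. H1 (A i \<inter> frontier \<Omega>)) = H1 (\<Union> (range A) \<inter> frontier \<Omega>)"
      by simp
  qed
qed (use assms in auto)

text \<open>Images of the covering sets, cut down to \<open>A\<close> where the map contracts, have
  no larger diameters. Below it is applied to inverses of maps that do not shorten
  distances.\<close>

lemma H1_image_le:
  fixes f :: "'a::metric_space \<Rightarrow> 'b::metric_space"
  assumes "\<And>x y. x \<in> A \<Longrightarrow> y \<in> A \<Longrightarrow> dist (f x) (f y) \<le> dist x y"
  shows "H1 (f ` A) \<le> H1 A"
proof -
  have "H1_delta d (f ` A) \<le> H1_delta d A" if "0 < d" for d
    unfolding H1_delta_def[of d A]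
  proof (rule INF_greatest)
    fix C :: "nat \<Rightarrow> 'a set"
    assume "C \<in> {C. A \<subseteq> \<Union> (range C) \<and> (\<forall>i. bounded (C i) \<and> diameter (C i) \<le> d)}"
    then have C: "A \<subseteq> (\<Union>i. C i)" "\<And>i. bounded (C i)" "\<And>i. diameter (C i) \<le> d"
      by auto
    have dd: "dist x y \<le> diameter (C i)" if "x \<in> f ` (C i \<inter> A)" "y \<in> f ` (C i \<inter> A)" for x y i
    proof -
      from that obtain x' y'
        where xy: "x = f x'" "y = f y'" "x' \<in> C i" "x' \<in> A" "y' \<in> C i" "y' \<in> A"
        by auto
      show ?thesis
        using assms[OF xy(4,6)] diameter_bounded_bound[OF C(2) xy(3,5)] by (simp add: xy)
    qed
    have diam: "diameter (f ` (C i \<inter> A)) \<le> diameter (C i)" for i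
      using dd diameter_ge_0[OF C(2)] by (intro diameter_le_metric) auto
    have "H1_delta d (f ` A) \<le> (\<Sum>i. ennreal (diameter (f ` (C i \<inter> A))))"
    proof (rule H1_delta_le)
      show "f ` A \<subseteq> (\<Union>i. f ` (C i \<inter> A))"
      proof
        fix z assume "z \<in> f ` A"
        then obtain x where x: "x \<in> A" "z = f x" by blast
        then obtain i where "x \<in> C i" using C(1) by blast
        then show "z \<in> (\<Union>i. f ` (C i \<inter> A))" using x by blast
      qed
      show "bounded (f ` (C i \<inter> A))" for i
        unfolding bounded_two_points by (rule exI[of _ "diameter (C i)"], intro ballI dd)
      show "diameter (f ` (C i \<inter> A)) \<le> d" for i
        by (rule order_trans[OF diam C(3)])
    qed
    also have "\<dots> \<le> (\<Sum>i. ennreal (diameter (C i)))"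
      by (intro suminf_le summableI allI ennreal_leI diam)
    finally show "H1_delta d (f ` A) \<le> (\<Sum>i. ennreal (diameter (C i)))" .
  qed
  then show ?thesis
    unfolding H1_def by (intro SUP_mono) auto
qed

lemma H1_interval_finite: "H1 {a..b::real} < \<infinity>"
proof -
  have "H1_delta d {a..b} \<le> ennreal (max 0 (b - a))" if d: "0 < d" for d
  proof -
    define L where "L = max 0 (b - a)"
    obtain n :: nat where n: "L / d < real n" using reals_Archimedean2 by blast
    have L0: "0 \<le> L" by (simp add: L_def)
    have n0: "0 < real n" using n L0 d by (metis divide_nonneg_pos le_less_trans)
    define C where "C = (\<lambda>i. if i < n then {a + real i * (L/n) .. a + real (Suc i) * (L/n)} else {})"
    have diam: "diameter (C i) = (if i < n then L / n else 0)" for i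
      using divide_nonneg_pos[OF L0 n0] by (auto simp: C_def algebra_simps add_divide_distrib)
    have "H1_delta d {a..b} \<le> (\<Sum>i. ennreal (diameter (C i)))"
    proof (rule H1_delta_le)
      show "bounded (C i)" for i by (auto simp: C_def)
      show "diameter (C i) \<le> d" for i
        using n n0 d by (auto simp: diam field_simps)
      show "{a..b} \<subseteq> (\<Union>i. C i)"
      proof
        fix x assume x: "x \<in> {a..b}"
        show "x \<in> (\<Union>i. C i)"
        \<comment> \<open>The index formula of the other case would give \<open>n\<close> at the
          right endpoint, one past the last piece.\<close>
        proof (cases "x = b")
          case True
          have "b \<in> C (n - 1)" using x n0 True by (auto simp: C_def L_def field_simps of_nat_diff)
          then show ?thesis using True by blast
        next
          case False
          then have Lp: "0 < L" "L = b - a" using x by (auto simp: L_def)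
          define i where "i = nat \<lfloor>(x - a) * n / L\<rfloor>"
          have y0: "0 \<le> (x - a) * n / L" using x Lp n0 by simp
          have i: "real i \<le> (x - a) * n / L" "(x - a) * n / L < real i + 1"
            unfolding i_def using y0 by linarith+
          have "(x - a) / L < 1" using x False Lp by simp
          then have "(x - a) / L * real n < 1 * real n" using n0 by (intro mult_strict_right_mono)
          then have "(x - a) * n / L < n" by simp
          then have "i < n" using i by linarith
          moreover have "x \<in> {a + real i * (L/n) .. a + real (Suc i) * (L/n)}"
            using i Lp(1) n0 by (simp add: field_simps)
          ultimately have "x \<in> C i" by (simp add: C_def)
          then show ?thesis by blast
        qed
      qed
    qed
    also have "\<dots> = (\<Sum>i<n. ennreal (L / n))"
      by (subst suminf_finite[of "{..<n}"]) (auto simp: diam)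
    also have "\<dots> = ennreal L"
      using n0 L0 by (simp add: ennreal_of_nat_eq_real_of_nat ennreal_mult[symmetric])
    finally show ?thesis by (simp add: L_def)
  qed
  then have "H1 {a..b} \<le> ennreal (max 0 (b - a))"
    unfolding H1_def by (intro SUP_least) auto
  then show ?thesis by (simp add: le_less_trans)
qed

section \<open>A Plancherel inequality\<close>

lemma measurable_cis [measurable]: "cis \<in> borel_measurable borel"
  by (intro borel_measurable_continuous_onI continuous_intros)

lemma integral_lborel_affine:
  fixes f :: "'a::euclidean_space \<Rightarrow> 'b::{banach, second_countable_topology}"
  assumes [measurable]: "f \<in> borel_measurable borel" and c: "c \<noteq> 0"
  shows "(\<integral>x. f x \<partial>lborel) = \<bar>c\<bar>^DIM('a) *\<^sub>R (\<integral>x. f (t + c *\<^sub>R x) \<partial>lborel)"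
  by (subst lborel_affine[OF c, of t]) (simp add: integral_density integral_distr)

lemma nn_integral_lborel_affine:
  fixes f :: "'a::euclidean_space \<Rightarrow> ennreal"
  assumes [measurable]: "f \<in> borel_measurable borel" and c: "c \<noteq> 0"
  shows "(\<integral>\<^sup>+x. f x \<partial>lborel) = \<bar>c\<bar>^DIM('a) * (\<integral>\<^sup>+x. f (t + c *\<^sub>R x) \<partial>lborel)"
  by (subst lborel_affine[OF c, of t])
     (simp add: nn_integral_density nn_integral_distr nn_integral_cmult ennreal_power)

lemma integrable_lborel_affine:
  fixes f :: "'a::euclidean_space \<Rightarrow> 'b::{banach, second_countable_topology}"
  assumes f: "integrable lborel f" and c: "c \<noteq> 0"
  shows "integrable lborel (\<lambda>x. f (t + c *\<^sub>R x))"
proof -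
  have [measurable]: "f \<in> borel_measurable borel" using f by auto
  have "(\<integral>\<^sup>+x. norm (f x) \<partial>lborel) < \<infinity>" using f by (simp add: integrable_iff_bounded)
  then have "\<bar>c\<bar>^DIM('a) * (\<integral>\<^sup>+x. norm (f (t + c *\<^sub>R x)) \<partial>lborel) < \<infinity>"
    by (subst (asm) nn_integral_lborel_affine[OF _ c, of _ t]) (auto simp: ennreal_power)
  then have "(\<integral>\<^sup>+x. norm (f (t + c *\<^sub>R x)) \<partial>lborel) < \<infinity>"
    using c by (auto simp: ennreal_mult_less_top)
  then show ?thesis by (intro integrableI_bounded) auto
qed

lemma integrable_lborel_pair_mult:
  fixes f :: "'a::euclidean_space \<Rightarrow> real" and g :: "'b::euclidean_space \<Rightarrow> real"
  assumes f: "integrable lborel f" and g: "integrable lborel g"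
  shows "integrable (lborel \<Otimes>\<^sub>M lborel) (\<lambda>(x, y). f x * g y)"
proof (rule integrableI_bounded)
  have [measurable]: "f \<in> borel_measurable borel" "g \<in> borel_measurable borel"
    using f g by auto
  show "(\<lambda>(x, y). f x * g y) \<in> borel_measurable (lborel \<Otimes>\<^sub>M lborel)" by measurable
  have "(\<integral>\<^sup>+z. norm (case z of (x, y) \<Rightarrow> f x * g y) \<partial>(lborel \<Otimes>\<^sub>M lborel))
      = (\<integral>\<^sup>+x. \<integral>\<^sup>+y. ennreal \<bar>f x\<bar> * ennreal \<bar>g y\<bar> \<partial>lborel \<partial>lborel)"
    by (subst lborel.nn_integral_fst[symmetric]) (auto simp: abs_mult ennreal_mult)
  also have "\<dots> = (\<integral>\<^sup>+x. ennreal \<bar>f x\<bar> \<partial>lborel) * (\<integral>\<^sup>+y. ennreal \<bar>g y\<bar> \<partial>lborel)"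
    by (simp add: nn_integral_cmult nn_integral_multc)
  also have "\<dots> < \<infinity>"
    using f g by (simp add: integrable_iff_bounded ennreal_mult_less_top)
  finally show "(\<integral>\<^sup>+z. norm (case z of (x, y) \<Rightarrow> f x * g y) \<partial>(lborel \<Otimes>\<^sub>M lborel)) < \<infinity>" .
qed

section \<open>Gaussians and their Fourier transforms\<close>

definition gauss :: "'a::euclidean_space \<Rightarrow> real" where
  "gauss x = exp (- (norm x)\<^sup>2 / 2)"

lemma gauss_nonneg [simp]: "0 \<le> gauss x"
  by (simp add: gauss_def)

lemma measurable_gauss [measurable]: "gauss \<in> borel_measurable borel"
  unfolding gauss_def by measurable

text \<open>The one-dimensional case, read off from the characteristic function of the standard
  normal distribution.\<close>

lemma gauss_real_cis:
  "integrable lborel (\<lambda>x::real. complex_of_real (exp (- x\<^sup>2 / 2)) * cis (t * x))"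
  "(\<integral>x. complex_of_real (exp (- x\<^sup>2 / 2)) * cis (t * x) \<partial>lborel)
     = complex_of_real (sqrt (2 * pi) * exp (- t\<^sup>2 / 2))"
proof -
  have e: "exp (- x\<^sup>2 / 2) = sqrt (2 * pi) * std_normal_density x" for x :: real
    by (simp add: std_normal_density_def)
  have i: "integrable lborel (\<lambda>x. exp (- x\<^sup>2 / 2 :: real))"
    unfolding e by (intro integrable_mult_right integrable_normal_density) auto
  show "integrable lborel (\<lambda>x::real. complex_of_real (exp (- x\<^sup>2 / 2)) * cis (t * x))"
    by (rule Bochner_Integration.integrable_bound[OF i]) (auto simp: norm_mult)
  have "complex_of_real (exp (- t\<^sup>2 / 2)) = char std_normal_distribution t"
    by (simp add: char_std_normal_distribution)
  also have "\<dots> = (\<integral>x. std_normal_density x *\<^sub>R iexp (t * x) \<partial>lborel)"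
    unfolding char_def by (subst integral_density) (auto simp: normal_density_nonneg)
  finally have "complex_of_real (sqrt (2 * pi) * exp (- t\<^sup>2 / 2))
      = complex_of_real (sqrt (2 * pi)) * (\<integral>x. std_normal_density x *\<^sub>R iexp (t * x) \<partial>lborel)"
    by simp
  also have "\<dots> = (\<integral>x. complex_of_real (sqrt (2 * pi)) * (std_normal_density x *\<^sub>R iexp (t * x)) \<partial>lborel)"
    by (rule integral_mult_right_zero[symmetric])
  also have "\<dots> = (\<integral>x. complex_of_real (exp (- x\<^sup>2 / 2)) * cis (t * x) \<partial>lborel)"
    unfolding e by (intro Bochner_Integration.integral_cong) (auto simp: scaleR_conv_of_real cis_conv_exp)
  finally show "(\<integral>x. complex_of_real (exp (- x\<^sup>2 / 2)) * cis (t * x) \<partial>lborel)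
     = complex_of_real (sqrt (2 * pi) * exp (- t\<^sup>2 / 2))" by simp
qed

lemma cis_sum: "finite A \<Longrightarrow> cis (\<Sum>x\<in>A. f x) = (\<Prod>x\<in>A. cis (f x))"
  by (induction A rule: finite_induct) (auto simp flip: cis_mult)

lemma gauss_eq_prod: "gauss x = (\<Prod>b\<in>Basis. exp (- (x \<bullet> b)\<^sup>2 / 2))"
proof -
  have "- (norm x)\<^sup>2 / 2 = (\<Sum>b\<in>Basis. - (x \<bullet> b)\<^sup>2 / 2)"
    unfolding power2_norm_eq_inner euclidean_inner[of x x]
    by (simp add: sum_divide_distrib sum_negf power2_eq_square)
  then show ?thesis by (simp add: gauss_def exp_sum)
qed

text \<open>Over the basis the integrand is a product of one-dimensional factors and
  \<open>lborel\<close> is the image of a product measure.\<close>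

lemma gauss_cis:
  fixes t :: "'a::euclidean_space"
  shows "(\<integral>x. complex_of_real (gauss x) * cis (t \<bullet> x) \<partial>lborel)
     = complex_of_real (sqrt (2 * pi) ^ DIM('a) * gauss t)"
proof -
  interpret product_sigma_finite "\<lambda>_::'a. lborel :: real measure" ..
  have "(\<integral>x. complex_of_real (gauss x) * cis (t \<bullet> x) \<partial>lborel)
      = (\<integral>x. (\<Prod>b\<in>Basis. complex_of_real (exp (- (x \<bullet> b)\<^sup>2 / 2)) * cis ((t \<bullet> b) * (x \<bullet> b))) \<partial>lborel)"
  proof -
    have "cis (t \<bullet> x) = (\<Prod>b\<in>Basis. cis ((t \<bullet> b) * (x \<bullet> b)))" for x
      by (subst euclidean_inner) (simp add: cis_sum)
    then show ?thesis by (simp add: gauss_eq_prod prod.distrib)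
  qed
  also have "\<dots> = (\<integral>f. (\<Prod>b\<in>Basis. complex_of_real (exp (- (f b)\<^sup>2 / 2)) * cis ((t \<bullet> b) * f b))
      \<partial>(\<Pi>\<^sub>M b\<in>(Basis::'a set). lborel))"
  proof (subst lborel_eq, subst integral_distr)
    show "(\<integral>f. (\<Prod>b\<in>Basis. complex_of_real (exp (- ((\<Sum>c\<in>Basis. f c *\<^sub>R c) \<bullet> b)\<^sup>2 / 2)) *
            cis ((t \<bullet> b) * ((\<Sum>c\<in>Basis. f c *\<^sub>R c) \<bullet> b))) \<partial>(\<Pi>\<^sub>M b\<in>(Basis::'a set). lborel))
        = (\<integral>f. (\<Prod>b\<in>Basis. complex_of_real (exp (- (f b)\<^sup>2 / 2)) * cis ((t \<bullet> b) * f b))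
            \<partial>(\<Pi>\<^sub>M b\<in>(Basis::'a set). lborel))"
      by (intro Bochner_Integration.integral_cong refl prod.cong)
         (simp_all add: inner_sum_left inner_Basis if_distrib sum.delta cong: if_cong)
  qed measurable
  also have "\<dots> = (\<Prod>b\<in>(Basis::'a set). \<integral>x. complex_of_real (exp (- x\<^sup>2 / 2)) * cis ((t \<bullet> b) * x) \<partial>lborel)"
    by (rule product_integral_prod[OF _ gauss_real_cis(1)]) simp
  also have "\<dots> = complex_of_real (sqrt (2 * pi) ^ DIM('a) * gauss t)"
    unfolding gauss_real_cis(2) gauss_eq_prod by (simp add: prod.distrib del: of_real_mult flip: of_real_prod)
  finally show ?thesis .
qed

text \<open>A function that is not integrable has Bochner integral 0, whereas
  \<open>gauss_cis\<close> at frequency 0 gives a positive value.\<close>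

lemma integrable_gauss: "integrable lborel (gauss :: 'a::euclidean_space \<Rightarrow> real)"
proof -
  have "integrable lborel (\<lambda>x::'a. complex_of_real (gauss x))"
  proof (rule ccontr)
    assume "\<not> ?thesis"
    then have "(\<integral>x. complex_of_real (gauss x) * cis (0 \<bullet> x) \<partial>(lborel::'a measure)) = 0"
      using not_integrable_integral_eq[of lborel "\<lambda>x::'a. complex_of_real (gauss x)"] by (simp del: integral_complex_of_real)
    then show False unfolding gauss_cis by (simp add: gauss_def)
  qed
  then show ?thesis using integrable_Re by fastforce
qed

definition gauss_mass :: "'a::euclidean_space itself \<Rightarrow> real" where
  "gauss_mass _ = sqrt (2 * pi) ^ DIM('a)"

lemma gauss_mass_pos: "0 < gauss_mass TYPE('a::euclidean_space)"
  by (simp add: gauss_mass_def)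

lemma integral_gauss: "integral\<^sup>L lborel (gauss :: 'a::euclidean_space \<Rightarrow> real) = gauss_mass TYPE('a)"
proof -
  have "complex_of_real (\<integral>x. gauss x \<partial>(lborel::'a measure)) = complex_of_real (gauss_mass TYPE('a))"
    using gauss_cis[of "0::'a"] by (simp add: gauss_mass_def gauss_def[of 0])
  then show ?thesis by (simp only: of_real_eq_iff)
qed

lemma gauss_scaled_cis:
  fixes t :: "'a::euclidean_space"
  assumes "0 < e"
  shows "(\<integral>x. complex_of_real (gauss (e *\<^sub>R x)) * cis (x \<bullet> t) \<partial>lborel)
     = complex_of_real (gauss_mass TYPE('a) * gauss (t /\<^sub>R e) / e ^ DIM('a))"
proof -
  have "complex_of_real (gauss_mass TYPE('a) * gauss (t /\<^sub>R e))
      = (\<integral>x. complex_of_real (gauss x) * cis ((t /\<^sub>R e) \<bullet> x) \<partial>lborel)"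
    unfolding gauss_cis by (simp add: gauss_mass_def)
  also have "\<dots> = e ^ DIM('a) *\<^sub>R (\<integral>x. complex_of_real (gauss (e *\<^sub>R x)) * cis ((t /\<^sub>R e) \<bullet> (e *\<^sub>R x)) \<partial>lborel)"
    using assms by (subst integral_lborel_affine[of _ e 0]) auto
  also have "(\<lambda>x. cis ((t /\<^sub>R e) \<bullet> (e *\<^sub>R x))) = (\<lambda>x. cis (x \<bullet> t))"
    using assms by (simp add: inner_commute flip: mult.assoc)
  finally show ?thesis using assms by (simp add: scaleR_conv_of_real field_simps)
qed

section \<open>Test functions and the Fourier transform\<close>

definition Cc :: "('a::euclidean_space \<Rightarrow> real) \<Rightarrow> bool" where
  "Cc f \<longleftrightarrow> continuous_on UNIV f \<and> (\<exists>R. \<forall>x. R < norm x \<longrightarrow> f x = 0)"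

lemma Cc_measurable: "Cc f \<Longrightarrow> f \<in> borel_measurable borel"
  by (auto simp: Cc_def intro: borel_measurable_continuous_onI)

lemma Cc_bound:
  assumes "Cc f"
  obtains B R where "0 \<le> B" "0 \<le> R" "\<And>x. \<bar>f x\<bar> \<le> B" "\<And>x. R < norm x \<Longrightarrow> f x = 0"
proof -
  obtain R where R: "\<And>x. R < norm x \<Longrightarrow> f x = 0" using assms by (auto simp: Cc_def)
  have "bounded (f ` cball 0 R)"
    using assms by (intro compact_imp_bounded compact_continuous_image)
      (auto simp: Cc_def intro: continuous_on_subset)
  then obtain B where B: "\<And>x. x \<in> cball 0 R \<Longrightarrow> \<bar>f x\<bar> \<le> B"
    unfolding bounded_iff by (metis image_eqI real_norm_def)
  show thesis
  proof (rule that[of "max 0 B" "max 0 R"])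
    show "\<bar>f x\<bar> \<le> max 0 B" for x
      using B[of x] R[of x] by (cases "norm x \<le> R") auto
  qed (use R in auto)
qed

lemma integrable_bounded_support:
  fixes f :: "'a::euclidean_space \<Rightarrow> 'b::{banach, second_countable_topology}"
  assumes [measurable]: "f \<in> borel_measurable borel"
    and "\<And>x. norm (f x) \<le> B" "\<And>x. R < norm x \<Longrightarrow> f x = 0"
  shows "integrable lborel f"
proof (rule Bochner_Integration.integrable_bound)
  show "integrable lborel (\<lambda>x::'a. B * indicator (cball 0 R) x)"
    by (intro integrable_mult_right integrable_real_indicator)
       (use emeasure_bounded_finite[of "cball 0 R :: 'a set"] in auto)
  show "AE x in lborel. norm (f x) \<le> norm (B * indicator (cball 0 R) x :: real)"
    using assms(2,3) by (intro AE_I2) (auto simp: indicator_def intro: order_trans[OF _ abs_ge_self])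
qed auto

lemma Cc_integrable: "Cc f \<Longrightarrow> integrable lborel f"
  by (metis Cc_bound Cc_measurable integrable_bounded_support real_norm_def)

lemma Cc_mult: "Cc f \<Longrightarrow> continuous_on UNIV g \<Longrightarrow> Cc (\<lambda>x. f x * g x)"
  by (auto simp: Cc_def intro!: continuous_intros)

lemma Cc_square_integrable: "Cc f \<Longrightarrow> integrable lborel (\<lambda>x. (f x)\<^sup>2)"
  unfolding power2_eq_square by (intro Cc_integrable Cc_mult) (auto simp: Cc_def)

text \<open>The exponent has a positive sign and there is no normalising factor: transforms are only
  compared with each other, so such constants cancel.\<close>

definition ft :: "('a::euclidean_space \<Rightarrow> real) \<Rightarrow> 'a \<Rightarrow> complex" where
  "ft f \<xi> = (\<integral>x. complex_of_real (f x) * cis (\<xi> \<bullet> x) \<partial>lborel)"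

lemma measurable_ft [measurable]:
  assumes [measurable]: "f \<in> borel_measurable borel"
  shows "ft f \<in> borel_measurable borel"
  unfolding ft_def[abs_def] by measurable

lemma ft_norm_le: "integrable lborel f \<Longrightarrow> cmod (ft f \<xi>) \<le> (\<integral>x. \<bar>f x\<bar> \<partial>lborel)"
  unfolding ft_def by (rule order_trans[OF integral_norm_bound]) (simp add: norm_mult)

lemma integrable_mult_cis:
  assumes f: "integrable lborel f"
  shows "integrable lborel (\<lambda>x. complex_of_real (f x) * cis (\<xi> \<bullet> x))"
proof -
  have [measurable]: "f \<in> borel_measurable borel" using f by auto
  show ?thesis by (rule Bochner_Integration.integrable_bound[OF f]) (auto simp: norm_mult)
qed

text \<open>The transform of an integrable function is bounded but need not decay, so the
  integrability comes from the Gaussian.\<close>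

lemma integrable_ft_gauss:
  fixes g :: "'a::euclidean_space \<Rightarrow> real"
  assumes g: "integrable lborel g" and e: "0 < e"
  shows "integrable lborel (\<lambda>\<xi>. (cmod (ft g \<xi>))\<^sup>2 * gauss (e *\<^sub>R \<xi>))"
proof (rule Bochner_Integration.integrable_bound)
  have [measurable]: "g \<in> borel_measurable borel" using g by auto
  show "(\<lambda>\<xi>. (cmod (ft g \<xi>))\<^sup>2 * gauss (e *\<^sub>R \<xi>)) \<in> borel_measurable lborel" by measurable
  show "integrable lborel (\<lambda>\<xi>::'a. (\<integral>x. \<bar>g x\<bar> \<partial>lborel)\<^sup>2 * gauss (0 + e *\<^sub>R \<xi>))"
    using e by (intro integrable_mult_right integrable_lborel_affine integrable_gauss) auto
  show "AE \<xi> in lborel. norm ((cmod (ft g \<xi>))\<^sup>2 * gauss (e *\<^sub>R \<xi>))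
      \<le> norm ((\<integral>x. \<bar>g x\<bar> \<partial>lborel)\<^sup>2 * gauss (0 + e *\<^sub>R \<xi>))"
    using ft_norm_le[OF g] by (intro AE_I2) (auto simp: abs_mult intro!: mult_right_mono power_mono)
qed

text \<open>The square of the modulus is a double integral in \<open>x\<close> and \<open>y\<close>.
  Integrating in \<open>\<xi>\<close> first turns the damping into the kernel
  \<open>gauss ((x - y) /\<^sub>R e) / e ^ DIM('a)\<close>, and the substitution
  \<open>y = x - e *\<^sub>R z\<close> absorbs the power of \<open>e\<close>.\<close>

lemma integral_ft_gauss:
  fixes g :: "'a::euclidean_space \<Rightarrow> real"
  assumes g: "integrable lborel g" and e: "0 < e"
  shows "(\<integral>\<xi>. (cmod (ft g \<xi>))\<^sup>2 * gauss (e *\<^sub>R \<xi>) \<partial>lborel)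
       = gauss_mass TYPE('a) * (\<integral>x. \<integral>z. g x * g (x - e *\<^sub>R z) * gauss z \<partial>lborel \<partial>lborel)"
proof -
  have [measurable]: "g \<in> borel_measurable borel" using g by auto
  let ?h = "\<lambda>p::'a\<times>'a. \<lambda>\<xi>. complex_of_real (g (fst p) * g (snd p) * gauss (e *\<^sub>R \<xi>)) * cis (\<xi> \<bullet> (fst p - snd p))"
  have sq: "complex_of_real ((cmod (ft g \<xi>))\<^sup>2 * gauss (e *\<^sub>R \<xi>)) = (\<integral>p. ?h p \<xi> \<partial>lborel)" for \<xi>
  proof -
    let ?k = "\<lambda>x y. complex_of_real (g x * g y) * cis (\<xi> \<bullet> (x - y))"
    have i: "integrable (lborel \<Otimes>\<^sub>M lborel) (case_prod ?k)"
    proof (rule Bochner_Integration.integrable_bound[OF integrable_lborel_pair_mult[OF g g]])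
      show "case_prod ?k \<in> borel_measurable (lborel \<Otimes>\<^sub>M lborel)" by measurable
    qed (auto simp: norm_mult)
    have "complex_of_real ((cmod (ft g \<xi>))\<^sup>2) = ft g \<xi> * cnj (ft g \<xi>)"
      by (rule complex_norm_square)
    also have "cnj (ft g \<xi>) = (\<integral>y. complex_of_real (g y) * cis (- (\<xi> \<bullet> y)) \<partial>lborel)"
    proof -
      have "cnj (ft g \<xi>) = (\<integral>y. cnj (complex_of_real (g y) * cis (\<xi> \<bullet> y)) \<partial>lborel)"
        unfolding ft_def by (rule Bochner_Integration.integral_cnj[symmetric])
      then show ?thesis by (simp add: cis_cnj)
    qed
    also have "ft g \<xi> * \<dots> = (\<integral>x. \<integral>y. ?k x y \<partial>lborel \<partial>lborel)"
    proof -
      have "ft g \<xi> * (\<integral>y. complex_of_real (g y) * cis (- (\<xi> \<bullet> y)) \<partial>lborel)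
        = (\<integral>x. (complex_of_real (g x) * cis (\<xi> \<bullet> x)) *
             (\<integral>y. complex_of_real (g y) * cis (- (\<xi> \<bullet> y)) \<partial>lborel) \<partial>lborel)"
        unfolding ft_def by simp
      also have "\<dots> = (\<integral>x. \<integral>y. ?k x y \<partial>lborel \<partial>lborel)"
      proof (intro Bochner_Integration.integral_cong refl)
        fix x
        have "?k x y = (complex_of_real (g x) * cis (\<xi> \<bullet> x)) * (complex_of_real (g y) * cis (- (\<xi> \<bullet> y)))" for y
          using cis_mult[of "\<xi> \<bullet> x" "- (\<xi> \<bullet> y)"] by (simp add: inner_diff_right ac_simps)
        then show "(complex_of_real (g x) * cis (\<xi> \<bullet> x)) *
             (\<integral>y. complex_of_real (g y) * cis (- (\<xi> \<bullet> y)) \<partial>lborel) = (\<integral>y. ?k x y \<partial>lborel)"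
          by (simp only: integral_mult_right_zero)
      qed
      finally show ?thesis .
    qed
    also have "\<dots> = (\<integral>p. case_prod ?k p \<partial>(lborel \<Otimes>\<^sub>M lborel))"
      using lborel_pair.integral_fst'[OF i] by (simp only: prod.case)
    finally have "complex_of_real ((cmod (ft g \<xi>))\<^sup>2 * gauss (e *\<^sub>R \<xi>))
        = (\<integral>p. case_prod ?k p \<partial>lborel) * complex_of_real (gauss (e *\<^sub>R \<xi>))"
      by (simp add: lborel_prod)
    also have "\<dots> = (\<integral>p. case_prod ?k p * complex_of_real (gauss (e *\<^sub>R \<xi>)) \<partial>lborel)"
      by simp
    also have "\<dots> = (\<integral>p. ?h p \<xi> \<partial>lborel)"
      by (intro Bochner_Integration.integral_cong) (auto simp: ac_simps)
    finally show ?thesis .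
  qed
  \<comment> \<open>Absolute integrability in all three variables, which the exchange of integrals
    below needs, rests on the Gaussian factor in \<open>\<xi>\<close>.\<close>
  have ig: "integrable (lborel \<Otimes>\<^sub>M lborel) (\<lambda>(p::'a\<times>'a, \<xi>::'a). (case p of (x, y) \<Rightarrow> g x * g y) * gauss (0 + e *\<^sub>R \<xi>))"
    using e integrable_lborel_pair_mult[OF g g]
    by (intro integrable_lborel_pair_mult integrable_lborel_affine integrable_gauss) (auto simp: lborel_prod)
  have i: "integrable (lborel \<Otimes>\<^sub>M lborel) (case_prod ?h)"
  proof (rule Bochner_Integration.integrable_bound[OF ig])
    show "case_prod ?h \<in> borel_measurable (lborel \<Otimes>\<^sub>M lborel)"
      unfolding lborel_prod[symmetric] by measurable
  qed (auto simp: norm_mult split: prod.split)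
  have "complex_of_real (\<integral>\<xi>. (cmod (ft g \<xi>))\<^sup>2 * gauss (e *\<^sub>R \<xi>) \<partial>lborel)
      = (\<integral>\<xi>. \<integral>p. ?h p \<xi> \<partial>lborel \<partial>lborel)"
    unfolding sq[symmetric] by (rule integral_complex_of_real[symmetric])
  also have "\<dots> = (\<integral>p. \<integral>\<xi>. ?h p \<xi> \<partial>lborel \<partial>lborel)"
    by (rule lborel_pair.Fubini_integral[OF i])
  also have "\<dots> = (\<integral>p. complex_of_real (gauss_mass TYPE('a) * (g (fst p) * g (snd p) * (gauss ((fst p - snd p) /\<^sub>R e) / e ^ DIM('a)))) \<partial>lborel)"
  proof (intro Bochner_Integration.integral_cong refl)
    fix p :: "'a \<times> 'a"
    have "(\<integral>\<xi>. ?h p \<xi> \<partial>lborel) = (\<integral>\<xi>. complex_of_real (g (fst p) * g (snd p)) * (complex_of_real (gauss (e *\<^sub>R \<xi>)) * cis (\<xi> \<bullet> (fst p - snd p))) \<partial>lborel)"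
      by (intro Bochner_Integration.integral_cong) auto
    also have "\<dots> = complex_of_real (g (fst p) * g (snd p)) * complex_of_real (gauss_mass TYPE('a) * gauss ((fst p - snd p) /\<^sub>R e) / e ^ DIM('a))"
      using gauss_scaled_cis[OF e, of "fst p - snd p"] by simp
    finally show "(\<integral>\<xi>. ?h p \<xi> \<partial>lborel) = complex_of_real (gauss_mass TYPE('a) * (g (fst p) * g (snd p) * (gauss ((fst p - snd p) /\<^sub>R e) / e ^ DIM('a))))"
      by simp
  qed
  finally have 1: "(\<integral>\<xi>. (cmod (ft g \<xi>))\<^sup>2 * gauss (e *\<^sub>R \<xi>) \<partial>lborel)
      = (\<integral>p. gauss_mass TYPE('a) * (g (fst p) * g (snd p) * (gauss ((fst p - snd p) /\<^sub>R e) / e ^ DIM('a))) \<partial>lborel)"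
    unfolding integral_complex_of_real of_real_eq_iff .
  have i2: "integrable (lborel \<Otimes>\<^sub>M lborel) (\<lambda>(x::'a, y::'a). g x * g y * (gauss ((x - y) /\<^sub>R e) / e ^ DIM('a)))"
  proof (rule Bochner_Integration.integrable_bound)
    show "integrable (lborel \<Otimes>\<^sub>M lborel) (\<lambda>(x::'a, y::'a). (1 / e ^ DIM('a)) * (case (x, y) of (x, y) \<Rightarrow> g x * g y))"
      using integrable_lborel_pair_mult[OF g g] by (auto simp: case_prod_unfold)
    have "gauss z \<le> 1" for z :: 'a by (simp add: gauss_def)
    then have "\<bar>c * (gauss z / e ^ DIM('a))\<bar> \<le> \<bar>(1 / e ^ DIM('a)) * c\<bar>" for z :: 'a and c
      using e by (simp add: abs_mult divide_right_mono mult_left_le)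
    then have "norm (case p of (x::'a, y::'a) \<Rightarrow> g x * g y * (gauss ((x - y) /\<^sub>R e) / e ^ DIM('a)))
        \<le> norm (case p of (x, y) \<Rightarrow> (1 / e ^ DIM('a)) * (case (x, y) of (x, y) \<Rightarrow> g x * g y))" for p
      by (cases p) (simp only: prod.case real_norm_def)
    then show "AE p in lborel \<Otimes>\<^sub>M lborel. norm (case p of (x::'a, y::'a) \<Rightarrow> g x * g y * (gauss ((x - y) /\<^sub>R e) / e ^ DIM('a)))
        \<le> norm (case p of (x, y) \<Rightarrow> (1 / e ^ DIM('a)) * (case (x, y) of (x, y) \<Rightarrow> g x * g y))"
      by (intro AE_I2)
  qed measurable
  have "(\<integral>p. g (fst p) * g (snd p) * (gauss ((fst p - snd p) /\<^sub>R e) / e ^ DIM('a)) \<partial>lborel)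
      = (\<integral>x. \<integral>y. g x * g y * (gauss ((x - y) /\<^sub>R e) / e ^ DIM('a)) \<partial>lborel \<partial>lborel)"
    using lborel_pair.integral_fst'[OF i2, symmetric] by (simp only: lborel_prod case_prod_unfold fst_conv snd_conv)
  also have "\<dots> = (\<integral>x. \<integral>z. g x * g (x - e *\<^sub>R z) * gauss z \<partial>lborel \<partial>lborel)"
  proof (rule Bochner_Integration.integral_cong[OF refl])
    fix x :: 'a
    have "(\<integral>y. g x * g y * (gauss ((x - y) /\<^sub>R e) / e ^ DIM('a)) \<partial>lborel)
      = \<bar>- e\<bar> ^ DIM('a) *\<^sub>R (\<integral>z. g x * g (x + (- e) *\<^sub>R z) * (gauss ((x - (x + (- e) *\<^sub>R z)) /\<^sub>R e) / e ^ DIM('a)) \<partial>lborel)"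
      using e by (intro integral_lborel_affine) auto
    also have "\<dots> = (\<integral>z. \<bar>- e\<bar> ^ DIM('a) *\<^sub>R (g x * g (x + (- e) *\<^sub>R z) * (gauss ((x - (x + (- e) *\<^sub>R z)) /\<^sub>R e) / e ^ DIM('a))) \<partial>lborel)"
      by (rule integral_scaleR_right[symmetric])
    also have "\<dots> = (\<integral>z. g x * g (x - e *\<^sub>R z) * gauss z \<partial>lborel)"
      using e by (intro Bochner_Integration.integral_cong) auto
    finally show "(\<integral>y. g x * g y * (gauss ((x - y) /\<^sub>R e) / e ^ DIM('a)) \<partial>lborel)
      = (\<integral>z. g x * g (x - e *\<^sub>R z) * gauss z \<partial>lborel)" .
  qed
  finally show ?thesis unfolding 1 integral_mult_right_zero by (simp only:)
qed

lemma integrable_Cc_gauss: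
  fixes g :: "'a::euclidean_space \<Rightarrow> real"
  assumes "Cc g"
  shows "integrable (lborel \<Otimes>\<^sub>M lborel) (\<lambda>(x, z). g x * g (x - e *\<^sub>R z) * gauss z)"
proof -
  obtain B R where B: "\<And>x. \<bar>g x\<bar> \<le> B" using Cc_bound[OF assms] by metis
  have [measurable]: "g \<in> borel_measurable borel" by (rule Cc_measurable[OF assms])
  show ?thesis
  proof (rule Bochner_Integration.integrable_bound)
    show "integrable (lborel \<Otimes>\<^sub>M lborel) (\<lambda>(x, z). \<bar>g x\<bar> * (B * gauss (z::'a)))"
      using Cc_integrable[OF assms] integrable_gauss by (intro integrable_lborel_pair_mult) auto
    show "AE p in lborel \<Otimes>\<^sub>M lborel. norm (case p of (x, z) \<Rightarrow> g x * g (x - e *\<^sub>R z) * gauss z)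
        \<le> norm (case p of (x, z) \<Rightarrow> \<bar>g x\<bar> * (B * gauss (z::'a)))"
      by (intro AE_I2)
         (auto simp: abs_mult mult.assoc intro!: mult_left_mono mult_right_mono order_trans[OF B abs_ge_self])
  qed measurable
qed

text \<open>For fixed \<open>z\<close> the product of \<open>g\<close> with its translate is at most
  half the sum of the two squares, which have equal integrals by translation invariance.\<close>

lemma gauss_form_le:
  fixes g :: "'a::euclidean_space \<Rightarrow> real"
  assumes "Cc g"
  shows "(\<integral>x. \<integral>z. g x * g (x - e *\<^sub>R z) * gauss z \<partial>lborel \<partial>lborel)
      \<le> gauss_mass TYPE('a) * (\<integral>x. (g x)\<^sup>2 \<partial>lborel)"
proof -
  note i = integrable_Cc_gauss[OF assms, of e]
  have [measurable]: "g \<in> borel_measurable borel" by (rule Cc_measurable[OF assms])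
  have g2: "integrable lborel (\<lambda>x. (g x)\<^sup>2)" by (rule Cc_square_integrable[OF assms])
  have tr: "integrable lborel (\<lambda>x. (g (x - a))\<^sup>2)" "(\<integral>x. (g (x - a))\<^sup>2 \<partial>lborel) = (\<integral>x. (g x)\<^sup>2 \<partial>lborel)" for a
    using integrable_lborel_affine[OF g2, of 1 "-a"] integral_lborel_affine[of "\<lambda>x. (g x)\<^sup>2" 1 "-a"] by auto
  have "(\<integral>x. \<integral>z. g x * g (x - e *\<^sub>R z) * gauss z \<partial>lborel \<partial>lborel)
      = (\<integral>z. \<integral>x. g x * g (x - e *\<^sub>R z) * gauss z \<partial>lborel \<partial>lborel)"
    by (rule lborel_pair.Fubini_integral[OF i, symmetric])
  also have "\<dots> \<le> (\<integral>z. (\<integral>x. (g x)\<^sup>2 \<partial>lborel) * gauss (z::'a) \<partial>lborel)"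
  proof (rule integral_mono)
    show "integrable lborel (\<lambda>z. \<integral>x. g x * g (x - e *\<^sub>R z) * gauss z \<partial>lborel)"
      using lborel_pair.integrable_snd[OF i] by simp
    show "integrable lborel (\<lambda>z. (\<integral>x. (g x)\<^sup>2 \<partial>lborel) * gauss (z::'a))"
      by (intro integrable_mult_right integrable_gauss)
    fix z :: 'a
    obtain B R where B: "\<And>x. \<bar>g x\<bar> \<le> B" using Cc_bound[OF assms] by metis
    have ii: "integrable lborel (\<lambda>x. g x * g (x - e *\<^sub>R z))"
    proof (rule Bochner_Integration.integrable_bound)
      show "integrable lborel (\<lambda>x. g x * B)" using Cc_integrable[OF assms] by simp
    qed (auto simp: abs_mult intro!: mult_left_mono order_trans[OF B abs_ge_self])
    have "(\<integral>x. g x * g (x - e *\<^sub>R z) \<partial>lborel) \<le> (\<integral>x. ((g x)\<^sup>2 + (g (x - e *\<^sub>R z))\<^sup>2) / 2 \<partial>lborel)"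
    proof (rule integral_mono[OF ii])
      show "integrable lborel (\<lambda>x. ((g x)\<^sup>2 + (g (x - e *\<^sub>R z))\<^sup>2) / 2)"
        using g2 tr by auto
      show "g x * g (x - e *\<^sub>R z) \<le> ((g x)\<^sup>2 + (g (x - e *\<^sub>R z))\<^sup>2) / 2" for x
        using sum_squares_bound[of "g x" "g (x - e *\<^sub>R z)"] by simp
    qed
    also have "\<dots> = (\<integral>x. (g x)\<^sup>2 \<partial>lborel)"
      using g2 tr by simp
    finally show "(\<integral>x. g x * g (x - e *\<^sub>R z) * gauss z \<partial>lborel) \<le> (\<integral>x. (g x)\<^sup>2 \<partial>lborel) * gauss z"
      by (simp add: mult_right_mono)
  qed
  also have "\<dots> = gauss_mass TYPE('a) * (\<integral>x. (g x)\<^sup>2 \<partial>lborel)"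
    by (simp add: integral_gauss)
  finally show ?thesis .
qed

text \<open>Dominated convergence: the product converges by continuity of \<open>g\<close> and is
  dominated by \<open>\<bar>g x\<bar> * (B * gauss z)\<close> for every \<open>e n\<close>.\<close>

lemma gauss_form_tendsto:
  fixes g :: "'a::euclidean_space \<Rightarrow> real"
  assumes "Cc g" and e: "e \<longlonglongrightarrow> 0"
  shows "(\<lambda>n. \<integral>x. \<integral>z. g x * g (x - e n *\<^sub>R z) * gauss z \<partial>lborel \<partial>lborel)
      \<longlonglongrightarrow> gauss_mass TYPE('a) * (\<integral>x. (g x)\<^sup>2 \<partial>lborel)"
proof -
  obtain B R where B: "\<And>x. \<bar>g x\<bar> \<le> B" using Cc_bound[OF assms(1)] by metis
  have [measurable]: "g \<in> borel_measurable borel" by (rule Cc_measurable[OF assms(1)])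
  have "(\<lambda>n. \<integral>p. (case p of (x, z) \<Rightarrow> g x * g (x - e n *\<^sub>R z) * gauss z) \<partial>(lborel \<Otimes>\<^sub>M lborel))
      \<longlonglongrightarrow> (\<integral>p. (case p of (x, z) \<Rightarrow> (g x)\<^sup>2 * gauss (z::'a)) \<partial>(lborel \<Otimes>\<^sub>M lborel))"
  proof (rule integral_dominated_convergence)
    show "integrable (lborel \<Otimes>\<^sub>M lborel) (\<lambda>(x, z). \<bar>g x\<bar> * (B * gauss (z::'a)))"
      using Cc_integrable[OF assms(1)] integrable_gauss by (intro integrable_lborel_pair_mult) auto
    show "AE p in lborel \<Otimes>\<^sub>M lborel. norm (case p of (x, z) \<Rightarrow> g x * g (x - e n *\<^sub>R z) * gauss z)
        \<le> (case p of (x, z) \<Rightarrow> \<bar>g x\<bar> * (B * gauss (z::'a)))" for n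
      by (intro AE_I2) (auto simp: abs_mult mult.assoc intro!: mult_left_mono mult_right_mono B)
    have "(\<lambda>n. g x * g (x - e n *\<^sub>R z) * gauss z) \<longlonglongrightarrow> g x * g (x - 0 *\<^sub>R z) * gauss z" for x z
    proof -
      have "isCont g (x - 0 *\<^sub>R z)" using assms(1) by (auto simp: Cc_def continuous_on_eq_continuous_at)
      then show ?thesis by (intro tendsto_intros isCont_tendsto_compose[of _ g] e)
    qed
    then show "AE p in lborel \<Otimes>\<^sub>M lborel. (\<lambda>n. case p of (x, z) \<Rightarrow> g x * g (x - e n *\<^sub>R z) * gauss z)
        \<longlonglongrightarrow> (case p of (x, z) \<Rightarrow> (g x)\<^sup>2 * gauss z)"
      by (intro AE_I2) (auto simp: power2_eq_square)
  qed measurable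
  moreover have "(\<integral>p. (case p of (x, z) \<Rightarrow> g x * g (x - e n *\<^sub>R z) * gauss z) \<partial>(lborel \<Otimes>\<^sub>M lborel))
      = (\<integral>x. \<integral>z. g x * g (x - e n *\<^sub>R z) * gauss z \<partial>lborel \<partial>lborel)" for n
    using lborel_pair.integral_fst'[OF integrable_Cc_gauss[OF assms(1)], of "e n"] by simp
  moreover have "(\<integral>p. (case p of (x, z) \<Rightarrow> (g x)\<^sup>2 * gauss (z::'a)) \<partial>(lborel \<Otimes>\<^sub>M lborel))
      = gauss_mass TYPE('a) * (\<integral>x. (g x)\<^sup>2 \<partial>lborel)"
    using lborel_pair.integral_fst'[OF integrable_lborel_pair_mult[OF Cc_square_integrable[OF assms(1)] integrable_gauss[where 'a='a]]]
    by (simp add: integral_gauss mult.commute)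
  ultimately show ?thesis by simp
qed

text \<open>Plancherel's theorem in the only form needed. Damping \<open>|ft g|\<^sup>2\<close> by a wide Gaussian turns
  its integral into the form \<open>\<integral>\<integral> g x * g (x - e z) * gauss z\<close>, which is at most
  \<open>gauss_mass * \<parallel>g\<parallel>\<^sup>2\<close> for every \<open>e\<close> and tends to it as \<open>e\<close> tends to \<open>0\<close>.\<close>

lemma square_function_bound:
  fixes f :: "'a::euclidean_space \<Rightarrow> real"
  assumes "finite K" and f: "Cc f" and g: "\<And>k. k \<in> K \<Longrightarrow> Cc (g k)"
    and le: "\<And>\<xi>. (\<Sum>k\<in>K. (cmod (ft (g k) \<xi>))\<^sup>2) \<le> C * (cmod (ft f \<xi>))\<^sup>2" and C: "0 \<le> C"
  shows "(\<Sum>k\<in>K. \<integral>x. (g k x)\<^sup>2 \<partial>lborel) \<le> C * (\<integral>x. (f x)\<^sup>2 \<partial>lborel)"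
proof -
  define Q where "Q h e = (\<integral>x. \<integral>z. h x * h (x - e *\<^sub>R z) * gauss z \<partial>lborel \<partial>lborel)" for h :: "'a \<Rightarrow> real" and e :: real
  let ?N = "gauss_mass TYPE('a)"
  have N: "0 < ?N" by (rule gauss_mass_pos)
  define e :: "nat \<Rightarrow> real" where "e n = 1 / real (Suc n)" for n
  have e: "0 < e n" for n by (simp add: e_def)
  have e0: "e \<longlonglongrightarrow> 0" unfolding e_def using LIMSEQ_inverse_real_of_nat by (simp add: inverse_eq_divide)
  have "(\<Sum>k\<in>K. Q (g k) (e n)) \<le> C * (?N * (\<integral>x. (f x)\<^sup>2 \<partial>lborel))" for n
  proof -
    have "?N * (\<Sum>k\<in>K. Q (g k) (e n)) = (\<Sum>k\<in>K. \<integral>\<xi>. (cmod (ft (g k) \<xi>))\<^sup>2 * gauss (e n *\<^sub>R \<xi>) \<partial>lborel)"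
      unfolding sum_distrib_left Q_def
      by (intro sum.cong refl integral_ft_gauss[symmetric] e Cc_integrable g)
    also have "\<dots> = (\<integral>\<xi>. (\<Sum>k\<in>K. (cmod (ft (g k) \<xi>))\<^sup>2 * gauss (e n *\<^sub>R \<xi>)) \<partial>lborel)"
      by (intro Bochner_Integration.integral_sum[symmetric] integrable_ft_gauss e Cc_integrable g)
    also have "\<dots> \<le> (\<integral>\<xi>. C * ((cmod (ft f \<xi>))\<^sup>2 * gauss (e n *\<^sub>R \<xi>)) \<partial>lborel)"
    proof (rule integral_mono)
      show "integrable lborel (\<lambda>\<xi>. \<Sum>k\<in>K. (cmod (ft (g k) \<xi>))\<^sup>2 * gauss (e n *\<^sub>R \<xi>))"
        by (intro Bochner_Integration.integrable_sum integrable_ft_gauss e Cc_integrable g)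
      show "integrable lborel (\<lambda>\<xi>. C * ((cmod (ft f \<xi>))\<^sup>2 * gauss (e n *\<^sub>R \<xi>)))"
        by (intro integrable_mult_right integrable_ft_gauss e Cc_integrable f)
      show "(\<Sum>k\<in>K. (cmod (ft (g k) \<xi>))\<^sup>2 * gauss (e n *\<^sub>R \<xi>)) \<le> C * ((cmod (ft f \<xi>))\<^sup>2 * gauss (e n *\<^sub>R \<xi>))" for \<xi>
        using mult_right_mono[OF le[of \<xi>] gauss_nonneg[of "e n *\<^sub>R \<xi>"]]
        by (simp add: sum_distrib_right mult.assoc)
    qed
    also have "\<dots> = ?N * (C * Q f (e n))"
      using integral_ft_gauss[OF Cc_integrable[OF f] e[of n]] by (simp add: Q_def)
    also have "\<dots> \<le> ?N * (C * (?N * (\<integral>x. (f x)\<^sup>2 \<partial>lborel)))"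
      using N C gauss_form_le[OF f, of "e n"] by (intro mult_left_mono) (auto simp: Q_def)
    finally show ?thesis using N by simp
  qed
  moreover have "(\<lambda>n. \<Sum>k\<in>K. Q (g k) (e n)) \<longlonglongrightarrow> (\<Sum>k\<in>K. ?N * (\<integral>x. (g k x)\<^sup>2 \<partial>lborel))"
    unfolding Q_def by (intro tendsto_sum gauss_form_tendsto g e0)
  ultimately have "(\<Sum>k\<in>K. ?N * (\<integral>x. (g k x)\<^sup>2 \<partial>lborel)) \<le> C * (?N * (\<integral>x. (f x)\<^sup>2 \<partial>lborel))"
    by (intro LIMSEQ_le_const2) auto
  then show ?thesis
    using N by (simp add: sum_distrib_left[symmetric] mult.left_commute)
qed

section \<open>The dyadic maximal function of ball averages\<close>

lemma nn_integral_square_le: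
  assumes [measurable]: "h \<in> borel_measurable M"
  shows "(\<integral>\<^sup>+x. h x \<partial>M)\<^sup>2 \<le> emeasure M (space M) * (\<integral>\<^sup>+x. (h x)\<^sup>2 \<partial>M)"
  using Cauchy_Schwarz_nn_integral[of "\<lambda>_. 1" M h] by simp

lemma nn_integral_lborel_translate:
  fixes f :: "'a::euclidean_space \<Rightarrow> ennreal"
  assumes [measurable]: "f \<in> borel_measurable borel"
  shows "(\<integral>\<^sup>+x. f (x - a) \<partial>lborel) = (\<integral>\<^sup>+x. f x \<partial>lborel)"
    and "(\<integral>\<^sup>+x. f (a - x) \<partial>lborel) = (\<integral>\<^sup>+x. f x \<partial>lborel)"
  using nn_integral_lborel_affine[of f 1 "-a"] nn_integral_lborel_affine[of f "-1" a] by auto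

text \<open>Cauchy-Schwarz with respect to \<open>M\<close> gives one factor of the total mass;
  Fubini and translation invariance give the other.\<close>

lemma nn_integral_average_square_le:
  fixes h :: "'a::euclidean_space \<Rightarrow> ennreal"
  assumes M: "finite_measure M" and [measurable_cong]: "sets M = sets borel"
    and [measurable]: "h \<in> borel_measurable borel"
  shows "(\<integral>\<^sup>+x. (\<integral>\<^sup>+y. h (x - r *\<^sub>R y) \<partial>M)\<^sup>2 \<partial>lborel)
      \<le> (emeasure M (space M))\<^sup>2 * (\<integral>\<^sup>+x. (h x)\<^sup>2 \<partial>lborel)"
proof -
  interpret M: finite_measure M by fact
  interpret pair_sigma_finite M "lborel :: 'a measure" ..
  let ?m = "emeasure M (space M)"
  have "(\<integral>\<^sup>+x. (\<integral>\<^sup>+y. h (x - r *\<^sub>R y) \<partial>M)\<^sup>2 \<partial>lborel)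
      \<le> (\<integral>\<^sup>+x. ?m * (\<integral>\<^sup>+y. (h (x - r *\<^sub>R y))\<^sup>2 \<partial>M) \<partial>lborel)"
    by (intro nn_integral_mono nn_integral_square_le) measurable
  also have "\<dots> = ?m * (\<integral>\<^sup>+x. \<integral>\<^sup>+y. (h (x - r *\<^sub>R y))\<^sup>2 \<partial>M \<partial>lborel)"
    by (intro nn_integral_cmult) measurable
  also have "(\<integral>\<^sup>+x. \<integral>\<^sup>+y. (h (x - r *\<^sub>R y))\<^sup>2 \<partial>M \<partial>lborel) = (\<integral>\<^sup>+y. \<integral>\<^sup>+x. (h (x - r *\<^sub>R y))\<^sup>2 \<partial>lborel \<partial>M)"
    by (intro Fubini') measurable
  also have "\<dots> = (\<integral>\<^sup>+y. \<integral>\<^sup>+x. (h x)\<^sup>2 \<partial>lborel \<partial>M)"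
    by (intro nn_integral_cong nn_integral_lborel_translate(1)) measurable
  also have "\<dots> = ?m * (\<integral>\<^sup>+x. (h x)\<^sup>2 \<partial>lborel)"
    by (simp add: mult.commute)
  finally show ?thesis by (simp add: power2_eq_square mult.assoc)
qed

section \<open>Averages over balls\<close>

definition ball_vol :: "'a::euclidean_space itself \<Rightarrow> real" where
  "ball_vol _ = measure lborel (cball (0::'a) 1)"

lemma ball_vol_pos: "0 < ball_vol TYPE('a::euclidean_space)"
  unfolding ball_vol_def using content_cball_pos[of 1 "0::'a"] by simp

lemma emeasure_unit_cball: "emeasure lborel (cball (0::'a::euclidean_space) 1) = ball_vol TYPE('a)"
  unfolding ball_vol_def
  by (intro emeasure_eq_ennreal_measure) (use emeasure_bounded_finite[of "cball (0::'a) 1"] in auto)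

definition ball_kernel :: "real \<Rightarrow> 'a::euclidean_space \<Rightarrow> ennreal" where
  "ball_kernel r z = ennreal (of_bool (norm z \<le> r) / (ball_vol TYPE('a) * r ^ DIM('a)))"

lemma measurable_ball_kernel [measurable]:
  "(\<lambda>(r, z). ball_kernel r z) \<in> borel_measurable (borel \<Otimes>\<^sub>M borel)"
  unfolding ball_kernel_def by measurable

lemma measurable_ball_kernel' [measurable (raw)]:
  assumes "f \<in> borel_measurable M" "g \<in> borel_measurable M"
  shows "(\<lambda>x. ball_kernel (f x) (g x)) \<in> borel_measurable M"
  using measurable_compose[OF measurable_Pair[OF assms] measurable_ball_kernel] by simp

lemma ball_kernel_minus: "ball_kernel r (x - y) = ball_kernel r (y - x)"
  by (simp add: ball_kernel_def norm_minus_commute)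

definition ball_avg :: "real \<Rightarrow> ('a::euclidean_space \<Rightarrow> ennreal) \<Rightarrow> 'a \<Rightarrow> ennreal" where
  "ball_avg r h x = (\<integral>\<^sup>+y. ball_kernel r (x - y) * h y \<partial>lborel)"

text \<open>Measurability is stated jointly in radius and centre because the linearised maximal
  operator averages at \<open>x\<close> over a radius \<open>\<rho> x\<close>.\<close>

lemma measurable_ball_avg [measurable (raw)]:
  assumes [measurable]: "h \<in> borel_measurable borel" "f \<in> borel_measurable M" "g \<in> borel_measurable M"
  shows "(\<lambda>x. ball_avg (f x) h (g x)) \<in> borel_measurable M"
  unfolding ball_avg_def by measurable

lemma ball_avg_eq_uniform:
  fixes h :: "'a::euclidean_space \<Rightarrow> ennreal"
  assumes [measurable]: "h \<in> borel_measurable borel" and r: "0 < r"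
  shows "ball_avg r h x = (\<integral>\<^sup>+y. h (x - r *\<^sub>R y) \<partial>uniform_measure lborel (cball 0 1))"
proof -
  let ?V = "ball_vol TYPE('a)"
  have V: "0 < ?V" by (rule ball_vol_pos)
  have "ball_avg r h x = r ^ DIM('a) * (\<integral>\<^sup>+y. ball_kernel r (x - (x + (- r) *\<^sub>R y)) * h (x + (- r) *\<^sub>R y) \<partial>lborel)"
    unfolding ball_avg_def using r by (subst nn_integral_lborel_affine[of _ "- r" x]) (auto simp: ennreal_power)
  also have "\<dots> = (\<integral>\<^sup>+y. r ^ DIM('a) * (ball_kernel r (r *\<^sub>R y) * h (x - r *\<^sub>R y)) \<partial>lborel)"
    by (subst nn_integral_cmult) auto
  also have "\<dots> = (\<integral>\<^sup>+y. (h (x - r *\<^sub>R y) * indicator (cball 0 1) y) * ennreal (1 / ?V) \<partial>lborel)"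
  proof (intro nn_integral_cong)
    fix y :: 'a
    have "ennreal (r ^ DIM('a)) * ball_kernel r (r *\<^sub>R y) = indicator (cball 0 1) y * ennreal (1 / ?V)"
      using r V by (auto simp: ball_kernel_def indicator_def ennreal_mult[symmetric])
    then show "ennreal (r ^ DIM('a)) * (ball_kernel r (r *\<^sub>R y) * h (x - r *\<^sub>R y))
       = (h (x - r *\<^sub>R y) * indicator (cball 0 1) y) * ennreal (1 / ?V)"
      by (metis (no_types, lifting) mult.assoc mult.commute)
  qed
  also have "\<dots> = (\<integral>\<^sup>+y. h (x - r *\<^sub>R y) * indicator (cball 0 1) y \<partial>lborel) * ennreal (1 / ?V)"
    by (intro nn_integral_multc borel_measurable_times_ennreal borel_measurable_indicator) auto
  also have "\<dots> = (\<integral>\<^sup>+y. h (x - r *\<^sub>R y) * indicator (cball 0 1) y \<partial>lborel) / ennreal ?V"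
    using V by (simp add: divide_ennreal_def inverse_ennreal inverse_eq_divide)
  also have "\<dots> = (\<integral>\<^sup>+y. h (x - r *\<^sub>R y) \<partial>uniform_measure lborel (cball 0 1))"
    by (subst nn_integral_uniform_measure) (auto simp: emeasure_unit_cball)
  finally show ?thesis .
qed

lemma prob_space_uniform_ball: "prob_space (uniform_measure lborel (cball (0::'a::euclidean_space) 1))"
  using ball_vol_pos[where 'a='a]
  by (intro prob_space_uniform_measure) (auto simp: emeasure_unit_cball)

lemma nn_integral_ball_kernel:
  assumes "0 < r"
  shows "(\<integral>\<^sup>+y. ball_kernel r (x - y) \<partial>lborel) = 1" "(\<integral>\<^sup>+y. ball_kernel r (y - x) \<partial>lborel) = 1"
proof -
  interpret prob_space "uniform_measure lborel (cball (0::'a) 1)" by (rule prob_space_uniform_ball)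
  show 1: "(\<integral>\<^sup>+y. ball_kernel r (x - y) \<partial>lborel) = 1"
    using ball_avg_eq_uniform[OF _ assms, of "\<lambda>_. 1" x] emeasure_space_1 by (simp add: ball_avg_def)
  then show "(\<integral>\<^sup>+y. ball_kernel r (y - x) \<partial>lborel) = 1"
    by (subst ball_kernel_minus)
qed

lemma ball_avg_square_le:
  fixes h :: "'a::euclidean_space \<Rightarrow> ennreal"
  assumes [measurable]: "h \<in> borel_measurable borel" and r: "0 < r"
  shows "(\<integral>\<^sup>+x. (ball_avg r h x)\<^sup>2 \<partial>lborel) \<le> (\<integral>\<^sup>+x. (h x)\<^sup>2 \<partial>lborel)"
proof -
  interpret prob_space "uniform_measure lborel (cball (0::'a) 1)" by (rule prob_space_uniform_ball)
  show ?thesis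
    using nn_integral_average_square_le[of "uniform_measure lborel (cball (0::'a) 1)" h r] emeasure_space_1
    by (simp add: ball_avg_eq_uniform r finite_measure_axioms)
qed

text \<open>Say \<open>r \<le> s\<close>. Where the product is nonzero, \<open>x\<close> and
  \<open>y\<close> are within \<open>2 * s\<close>, and there the larger kernel is the constant
  \<open>2 ^ DIM('a) * ball_kernel (2 * s) (x - y)\<close>; the smaller kernel integrates to 1. The
  sum on the right covers both orders of the radii.\<close>

lemma ball_kernel_convolution_le:
  fixes x y :: "'a::euclidean_space"
  assumes "0 < r" "0 < s"
  shows "(\<integral>\<^sup>+z. ball_kernel r (x - z) * ball_kernel s (y - z) \<partial>lborel)
      \<le> 2 ^ DIM('a) * (ball_kernel (2 * r) (x - y) + ball_kernel (2 * s) (x - y))"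
proof -
  let ?V = "ball_vol TYPE('a)"
  have V: "0 < ?V" by (rule ball_vol_pos)
  have main: "(\<integral>\<^sup>+z. ball_kernel r (x - z) * ball_kernel s (y - z) \<partial>lborel)
      \<le> 2 ^ DIM('a) * ball_kernel (2 * s) (x - y)" if "0 < r" "r \<le> s" for r s and x y :: 'a
  proof -
    have s: "0 < s" using that by simp
    have eq: "2 ^ DIM('a) * ball_kernel (2 * s) (x - y) = ennreal (of_bool (norm (x - y) \<le> 2 * s) / (?V * s ^ DIM('a)))"
    proof -
      have "2 ^ DIM('a) * ball_kernel (2 * s) (x - y)
         = ennreal (2 ^ DIM('a)) * ennreal (of_bool (norm (x - y) \<le> 2 * s) / (?V * (2 * s) ^ DIM('a)))"
        by (simp add: ball_kernel_def ennreal_power[symmetric])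
      also have "\<dots> = ennreal (2 ^ DIM('a) * (of_bool (norm (x - y) \<le> 2 * s) / (?V * (2 * s) ^ DIM('a))))"
        using V s by (intro ennreal_mult[symmetric]) auto
      also have "2 ^ DIM('a) * (of_bool (norm (x - y) \<le> 2 * s) / (?V * (2 * s) ^ DIM('a)))
          = of_bool (norm (x - y) \<le> 2 * s) / (?V * s ^ DIM('a))"
        by (simp add: power_mult_distrib)
      finally show ?thesis .
    qed
    have "(\<integral>\<^sup>+z. ball_kernel r (x - z) * ball_kernel s (y - z) \<partial>lborel)
        \<le> (\<integral>\<^sup>+z. ball_kernel r (x - z) * (2 ^ DIM('a) * ball_kernel (2 * s) (x - y)) \<partial>lborel)"
    proof (intro nn_integral_mono)
      fix z
      show "ball_kernel r (x - z) * ball_kernel s (y - z)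
          \<le> ball_kernel r (x - z) * (2 ^ DIM('a) * ball_kernel (2 * s) (x - y))"
      proof (cases "norm (x - z) \<le> r \<and> norm (y - z) \<le> s")
        case True
        then have "norm (x - y) \<le> 2 * s"
          using norm_triangle_ineq4[of "x - z" "y - z"] that by simp
        then show ?thesis
          unfolding eq by (intro mult_left_mono) (simp_all add: ball_kernel_def True)
      next
        case False
        then show ?thesis by (auto simp: ball_kernel_def)
      qed
    qed
    also have "\<dots> = 2 ^ DIM('a) * ball_kernel (2 * s) (x - y)"
      by (subst nn_integral_multc) (auto simp: nn_integral_ball_kernel that)
    finally show ?thesis .
  qed
  show ?thesis
  proof (cases "r \<le> s")
    case True
    then show ?thesis
      using main[of r s x y] assms by (simp add: distrib_left add_increasing)
  next
    case False
    then have "(\<integral>\<^sup>+z. ball_kernel s (y - z) * ball_kernel r (x - z) \<partial>lborel) \<le> 2 ^ DIM('a) * ball_kernel (2 * r) (y - x)"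
      using assms by (intro main) auto
    then show ?thesis
      by (simp add: distrib_left add_increasing2 mult.commute ball_kernel_minus[of _ x y])
  qed
qed

text \<open>Among finitely many radii the best one can be chosen measurably: a new radius replaces
  the old choice on the measurable set where its average is at least as large.\<close>

lemma maximal_radius_exists:
  assumes "finite F" "F \<noteq> {}" and [measurable]: "h \<in> borel_measurable borel"
  shows "\<exists>\<rho>. \<rho> \<in> borel_measurable borel \<and> (\<forall>x. \<rho> x \<in> F \<and> (\<forall>r\<in>F. ball_avg r h x \<le> ball_avg (\<rho> x) h x))"
  using assms(1,2)
proof (induction F rule: finite_ne_induct)
  case (singleton r)
  then show ?case by (intro exI[of _ "\<lambda>_. r"]) auto
next
  case (insert r F)
  then obtain \<rho> where [measurable]: "\<rho> \<in> borel_measurable borel"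
    and \<rho>: "\<And>x. \<rho> x \<in> F" "\<And>x s. s \<in> F \<Longrightarrow> ball_avg s h x \<le> ball_avg (\<rho> x) h x" by blast
  define \<rho>' where "\<rho>' x = (if ball_avg (\<rho> x) h x \<le> ball_avg r h x then r else \<rho> x)" for x
  have "\<rho>' \<in> borel_measurable borel" unfolding \<rho>'_def by measurable
  moreover have "\<rho>' x \<in> insert r F \<and> (\<forall>s\<in>insert r F. ball_avg s h x \<le> ball_avg (\<rho>' x) h x)" for x
    using \<rho>(1)[of x] \<rho>(2)[of _ x] by (auto simp: \<rho>'_def intro: order_trans)
  ultimately show ?case by blast
qed

text \<open>The kernel of \<open>T T*\<close>, where \<open>T\<close> is the maximal operator linearised by a choice of radii \<open>\<rho>\<close>,
  is dominated by the kernels with radii \<open>2 \<rho>\<close>; hence the square of the norm of the maximal operator is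
  controlled by the norm itself.\<close>

lemma linearized_maximal_bound:
  fixes h :: "'a::euclidean_space \<Rightarrow> ennreal"
  assumes [measurable]: "h \<in> borel_measurable borel" "\<rho> \<in> borel_measurable borel" and \<rho>: "\<And>x. 0 < \<rho> x"
  defines "u \<equiv> \<lambda>x. ball_avg (\<rho> x) h x"
  shows "(\<integral>\<^sup>+x. (u x)\<^sup>2 \<partial>lborel) ^ 4 \<le>
    (\<integral>\<^sup>+x. (h x)\<^sup>2 \<partial>lborel)\<^sup>2 * (2 ^ (DIM('a) + 1))\<^sup>2 *
    ((\<integral>\<^sup>+x. (u x)\<^sup>2 \<partial>lborel) * (\<integral>\<^sup>+x. (ball_avg (2 * \<rho> x) u x)\<^sup>2 \<partial>lborel))"
proof -
  have [measurable]: "u \<in> borel_measurable borel" unfolding u_def by measurable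
  \<comment> \<open>The adjoint of the linearised operator applied to \<open>u\<close>, so that the
    integral of the square of \<open>u\<close> is the pairing of \<open>h\<close> with
    \<open>v\<close>.\<close>
  define v where "v y = (\<integral>\<^sup>+x. u x * ball_kernel (\<rho> x) (x - y) \<partial>lborel)" for y
  have [measurable]: "v \<in> borel_measurable borel" unfolding v_def by measurable
  define W where "W = (\<integral>\<^sup>+x. u x * ball_avg (2 * \<rho> x) u x \<partial>lborel)"
  let ?D = "2 ^ DIM('a) :: ennreal"
  have S: "(\<integral>\<^sup>+x. (u x)\<^sup>2 \<partial>lborel) = (\<integral>\<^sup>+y. h y * v y \<partial>lborel)"
  proof -
    have "(\<integral>\<^sup>+x. (u x)\<^sup>2 \<partial>lborel) = (\<integral>\<^sup>+x. u x * (\<integral>\<^sup>+y. ball_kernel (\<rho> x) (x - y) * h y \<partial>lborel) \<partial>lborel)"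
      by (simp add: power2_eq_square u_def ball_avg_def)
    also have "\<dots> = (\<integral>\<^sup>+x. \<integral>\<^sup>+y. h y * (u x * ball_kernel (\<rho> x) (x - y)) \<partial>lborel \<partial>lborel)"
      by (intro nn_integral_cong, subst nn_integral_cmult[symmetric]) (auto intro!: nn_integral_cong simp: ac_simps)
    also have "\<dots> = (\<integral>\<^sup>+y. \<integral>\<^sup>+x. h y * (u x * ball_kernel (\<rho> x) (x - y)) \<partial>lborel \<partial>lborel)"
      by (intro lborel_pair.Fubini') measurable
    also have "\<dots> = (\<integral>\<^sup>+y. h y * v y \<partial>lborel)"
      unfolding v_def by (intro nn_integral_cong nn_integral_cmult) measurable
    finally show ?thesis .
  qed
  have "(\<integral>\<^sup>+y. (v y)\<^sup>2 \<partial>lborel) =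
      (\<integral>\<^sup>+y. \<integral>\<^sup>+x. \<integral>\<^sup>+x'. u x * u x' * (ball_kernel (\<rho> x) (x - y) * ball_kernel (\<rho> x') (x' - y)) \<partial>lborel \<partial>lborel \<partial>lborel)"
  proof (intro nn_integral_cong)
    fix y
    have "(v y)\<^sup>2 = (\<integral>\<^sup>+x. u x * ball_kernel (\<rho> x) (x - y) \<partial>lborel) * v y"
      by (simp add: power2_eq_square v_def)
    also have "\<dots> = (\<integral>\<^sup>+x. u x * ball_kernel (\<rho> x) (x - y) * v y \<partial>lborel)"
      by (subst nn_integral_multc) auto
    also have "\<dots> = (\<integral>\<^sup>+x. \<integral>\<^sup>+x'. u x * u x' * (ball_kernel (\<rho> x) (x - y) * ball_kernel (\<rho> x') (x' - y)) \<partial>lborel \<partial>lborel)"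
      unfolding v_def
      by (intro nn_integral_cong, subst nn_integral_cmult[symmetric]) (auto intro!: nn_integral_cong simp: ac_simps)
    finally show "(v y)\<^sup>2 = (\<integral>\<^sup>+x. \<integral>\<^sup>+x'. u x * u x' * (ball_kernel (\<rho> x) (x - y) * ball_kernel (\<rho> x') (x' - y)) \<partial>lborel \<partial>lborel)" .
  qed
  also have "\<dots> = (\<integral>\<^sup>+x. \<integral>\<^sup>+y. \<integral>\<^sup>+x'. u x * u x' * (ball_kernel (\<rho> x) (x - y) * ball_kernel (\<rho> x') (x' - y)) \<partial>lborel \<partial>lborel \<partial>lborel)"
    by (intro lborel_pair.Fubini') measurable
  also have "\<dots> = (\<integral>\<^sup>+x. \<integral>\<^sup>+x'. \<integral>\<^sup>+y. u x * u x' * (ball_kernel (\<rho> x) (x - y) * ball_kernel (\<rho> x') (x' - y)) \<partial>lborel \<partial>lborel \<partial>lborel)"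
    by (intro nn_integral_cong lborel_pair.Fubini') measurable
  also have "\<dots> \<le> (\<integral>\<^sup>+x. \<integral>\<^sup>+x'. ?D * (u x * u x' * ball_kernel (2 * \<rho> x) (x - x'))
       + ?D * (u x * u x' * ball_kernel (2 * \<rho> x') (x - x')) \<partial>lborel \<partial>lborel)"
  proof (intro nn_integral_mono)
    fix x x'
    have "(\<integral>\<^sup>+y. u x * u x' * (ball_kernel (\<rho> x) (x - y) * ball_kernel (\<rho> x') (x' - y)) \<partial>lborel)
        = u x * u x' * (\<integral>\<^sup>+y. ball_kernel (\<rho> x) (x - y) * ball_kernel (\<rho> x') (x' - y) \<partial>lborel)"
      by (intro nn_integral_cmult) measurable
    also have "\<dots> \<le> u x * u x' * (?D * (ball_kernel (2 * \<rho> x) (x - x') + ball_kernel (2 * \<rho> x') (x - x')))"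
      by (intro mult_left_mono ball_kernel_convolution_le \<rho>) auto
    also have "\<dots> = ?D * (u x * u x' * ball_kernel (2 * \<rho> x) (x - x'))
       + ?D * (u x * u x' * ball_kernel (2 * \<rho> x') (x - x'))"
      by (simp add: distrib_left ac_simps)
    finally show "(\<integral>\<^sup>+y. u x * u x' * (ball_kernel (\<rho> x) (x - y) * ball_kernel (\<rho> x') (x' - y)) \<partial>lborel)
       \<le> ?D * (u x * u x' * ball_kernel (2 * \<rho> x) (x - x')) + ?D * (u x * u x' * ball_kernel (2 * \<rho> x') (x - x'))" .
  qed
  also have "\<dots> = ?D * (\<integral>\<^sup>+x. \<integral>\<^sup>+x'. u x * u x' * ball_kernel (2 * \<rho> x) (x - x') \<partial>lborel \<partial>lborel)
      + ?D * (\<integral>\<^sup>+x. \<integral>\<^sup>+x'. u x * u x' * ball_kernel (2 * \<rho> x') (x - x') \<partial>lborel \<partial>lborel)"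
    by (simp add: nn_integral_add nn_integral_cmult)
  \<comment> \<open>Exchanging the names of the two points makes this term equal to the other one;
    their sum doubles the dimensional constant.\<close>
  also have "(\<integral>\<^sup>+x. \<integral>\<^sup>+x'. u x * u x' * ball_kernel (2 * \<rho> x') (x - x') \<partial>lborel \<partial>lborel)
      = (\<integral>\<^sup>+x'. \<integral>\<^sup>+x. u x * u x' * ball_kernel (2 * \<rho> x') (x - x') \<partial>lborel \<partial>lborel)"
    by (intro lborel_pair.Fubini') measurable
  also have "\<dots> = (\<integral>\<^sup>+x. \<integral>\<^sup>+x'. u x * u x' * ball_kernel (2 * \<rho> x) (x - x') \<partial>lborel \<partial>lborel)"
    by (intro nn_integral_cong) (simp add: ball_kernel_minus mult.commute)
  also have "\<dots> = W"
    unfolding W_def ball_avg_def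
    by (intro nn_integral_cong, subst nn_integral_cmult[symmetric]) (auto intro!: nn_integral_cong simp: ac_simps)
  also have "?D * W + ?D * W = 2 ^ (DIM('a) + 1) * W"
    by (simp add: mult_2[symmetric] mult.assoc)
  finally have v: "(\<integral>\<^sup>+y. (v y)\<^sup>2 \<partial>lborel) \<le> 2 ^ (DIM('a) + 1) * W" .
  \<comment> \<open>Cauchy-Schwarz for the pairing of \<open>h\<close> and \<open>v\<close>, and
    once more for \<open>W\<close>, produces the fourth power of the statement.\<close>
  have "(\<integral>\<^sup>+x. (u x)\<^sup>2 \<partial>lborel)\<^sup>2 \<le> (\<integral>\<^sup>+x. (h x)\<^sup>2 \<partial>lborel) * (\<integral>\<^sup>+y. (v y)\<^sup>2 \<partial>lborel)"
    unfolding S by (intro Cauchy_Schwarz_nn_integral) measurable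
  also have "\<dots> \<le> (\<integral>\<^sup>+x. (h x)\<^sup>2 \<partial>lborel) * (2 ^ (DIM('a) + 1) * W)"
    by (intro mult_left_mono v) auto
  finally have "((\<integral>\<^sup>+x. (u x)\<^sup>2 \<partial>lborel)\<^sup>2)\<^sup>2 \<le> ((\<integral>\<^sup>+x. (h x)\<^sup>2 \<partial>lborel) * (2 ^ (DIM('a) + 1) * W))\<^sup>2"
    by (rule power_mono_ennreal)
  also have "\<dots> = (\<integral>\<^sup>+x. (h x)\<^sup>2 \<partial>lborel)\<^sup>2 * (2 ^ (DIM('a) + 1))\<^sup>2 * W\<^sup>2"
    by (simp add: power_mult_distrib mult.assoc)
  also have "\<dots> \<le> (\<integral>\<^sup>+x. (h x)\<^sup>2 \<partial>lborel)\<^sup>2 * (2 ^ (DIM('a) + 1))\<^sup>2 *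
    ((\<integral>\<^sup>+x. (u x)\<^sup>2 \<partial>lborel) * (\<integral>\<^sup>+x. (ball_avg (2 * \<rho> x) u x)\<^sup>2 \<partial>lborel))"
    unfolding W_def by (intro mult_left_mono Cauchy_Schwarz_nn_integral) (auto intro: measurable_ball_avg)
  finally show ?thesis by (simp flip: power_mult)
qed

text \<open>Only the scales with \<open>\<bar>k\<bar> \<le> n\<close> are taken, so that some finite
  bound is known beforehand.\<close>

definition dyadic_max :: "nat \<Rightarrow> ('a::euclidean_space \<Rightarrow> ennreal) \<Rightarrow> 'a \<Rightarrow> ennreal" where
  "dyadic_max n h x = (SUP k\<in>{- int n..int n}. ball_avg (2 powr k) h x)"

lemma measurable_dyadic_max [measurable]:
  "h \<in> borel_measurable borel \<Longrightarrow> dyadic_max n h \<in> borel_measurable borel"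
  unfolding dyadic_max_def by (intro borel_measurable_SUP measurable_ball_avg) auto

lemma square_add_le_ennreal: "(a + b)\<^sup>2 \<le> 2 * a\<^sup>2 + 2 * (b::ennreal)\<^sup>2"
proof -
  have "(a + b)\<^sup>2 = (a\<^sup>2 + b\<^sup>2) + 2 * a * b" by (rule power2_sum)
  also have "\<dots> \<le> (a\<^sup>2 + b\<^sup>2) + (a\<^sup>2 + b\<^sup>2)"
    by (intro add_left_mono sum_of_squares_ge_ennreal)
  also have "\<dots> = 2 * a\<^sup>2 + 2 * b\<^sup>2" by (simp add: mult_2 ac_simps)
  finally show ?thesis .
qed

lemma dyadic_max_step:
  fixes N :: real and h :: "'a::euclidean_space \<Rightarrow> ennreal"
  assumes N: "0 \<le> N"
    and valid: "\<And>h::'a \<Rightarrow> ennreal. h \<in> borel_measurable borel \<Longrightarrow>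
       (\<integral>\<^sup>+x. (h x)\<^sup>2 \<partial>lborel) < \<infinity> \<Longrightarrow>
       (\<integral>\<^sup>+x. (dyadic_max n h x)\<^sup>2 \<partial>lborel) \<le> ennreal N * (\<integral>\<^sup>+x. (h x)\<^sup>2 \<partial>lborel)"
    and [measurable]: "h \<in> borel_measurable borel" and fin: "(\<integral>\<^sup>+x. (h x)\<^sup>2 \<partial>lborel) < \<infinity>"
  shows "(\<integral>\<^sup>+x. (dyadic_max n h x)\<^sup>2 \<partial>lborel)
      \<le> ennreal (sqrt (2 * (2 ^ (DIM('a) + 1))\<^sup>2 * (N + 1))) * (\<integral>\<^sup>+x. (h x)\<^sup>2 \<partial>lborel)"
proof -
  let ?D = "2 ^ (DIM('a) + 1) :: real"
  define F where "F = (\<lambda>k::int. 2 powr k) ` {- int n..int n}"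
  obtain \<rho> where [measurable]: "\<rho> \<in> borel_measurable borel"
    and \<rho>F: "\<And>x. \<rho> x \<in> F" and \<rho>m: "\<And>x r. r \<in> F \<Longrightarrow> ball_avg r h x \<le> ball_avg (\<rho> x) h x"
    using maximal_radius_exists[of F h] by (auto simp: F_def)
  define u where "u x = ball_avg (\<rho> x) h x" for x
  have [measurable]: "u \<in> borel_measurable borel" unfolding u_def by measurable
  have u: "dyadic_max n h = u"
  proof
    fix x
    show "dyadic_max n h x = u x"
      unfolding dyadic_max_def u_def
    proof (rule antisym)
      show "(SUP k\<in>{- int n..int n}. ball_avg (2 powr k) h x) \<le> ball_avg (\<rho> x) h x"
        by (intro SUP_least \<rho>m) (auto simp: F_def)
      obtain k where "k \<in> {- int n..int n}" "\<rho> x = 2 powr k" using \<rho>F[of x] by (auto simp: F_def)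
      then show "ball_avg (\<rho> x) h x \<le> (SUP k\<in>{- int n..int n}. ball_avg (2 powr k) h x)"
        by (auto intro: SUP_upper)
    qed
  qed
  have \<rho>pos: "0 < \<rho> x" for x using \<rho>F[of x] by (auto simp: F_def)
  let ?S = "\<integral>\<^sup>+x. (u x)\<^sup>2 \<partial>lborel" and ?H = "\<integral>\<^sup>+x. (h x)\<^sup>2 \<partial>lborel"
  \<comment> \<open>This finiteness, supplied by the bound \<open>N\<close>, is what permits
    cancelling the square of \<open>s\<close> at the end.\<close>
  have Sfin: "?S < \<infinity>"
    using valid[of h] fin by (simp add: u) (meson ennreal_less_top ennreal_mult_less_top le_less_trans)
  have "(\<integral>\<^sup>+x. (ball_avg (2 * \<rho> x) u x)\<^sup>2 \<partial>lborel)
      \<le> (\<integral>\<^sup>+x. 2 * (dyadic_max n u x)\<^sup>2 + 2 * (ball_avg (2 powr (int n + 1)) u x)\<^sup>2 \<partial>lborel)"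
  proof (intro nn_integral_mono)
    fix x
    obtain k where k: "k \<in> {- int n..int n}" "\<rho> x = 2 powr k" using \<rho>F[of x] by (auto simp: F_def)
    then have e: "2 * \<rho> x = 2 powr (k + 1)" by (simp add: powr_add)
    have "ball_avg (2 * \<rho> x) u x \<le> dyadic_max n u x + ball_avg (2 powr (int n + 1)) u x"
    proof (cases "k = int n")
      case True
      then show ?thesis using e by (simp add: add_increasing)
    next
      case False
      then have "k + 1 \<in> {- int n..int n}" using k by auto
      then have "ball_avg (2 powr (k + 1)) u x \<le> dyadic_max n u x"
        unfolding dyadic_max_def by (rule SUP_upper)
      then show ?thesis using e by (simp add: add_increasing2)
    qed
    then have "(ball_avg (2 * \<rho> x) u x)\<^sup>2 \<le> (dyadic_max n u x + ball_avg (2 powr (int n + 1)) u x)\<^sup>2"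
      by (rule power_mono_ennreal)
    then show "(ball_avg (2 * \<rho> x) u x)\<^sup>2 \<le> 2 * (dyadic_max n u x)\<^sup>2 + 2 * (ball_avg (2 powr (int n + 1)) u x)\<^sup>2"
      using square_add_le_ennreal order_trans by blast
  qed
  also have "\<dots> = 2 * (\<integral>\<^sup>+x. (dyadic_max n u x)\<^sup>2 \<partial>lborel) + 2 * (\<integral>\<^sup>+x. (ball_avg (2 powr (int n + 1)) u x)\<^sup>2 \<partial>lborel)"
    by (subst nn_integral_add) (auto simp: nn_integral_cmult intro!: borel_measurable_times_ennreal borel_measurable_power_ennreal measurable_ball_avg)
  also have "\<dots> \<le> 2 * (ennreal N * ?S) + 2 * ?S"
    by (intro add_mono mult_left_mono valid ball_avg_square_le Sfin) auto
  also have "\<dots> = ennreal (2 * (N + 1)) * ?S"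
    using N by (simp add: distrib_left distrib_right ennreal_mult ennreal_plus mult.assoc)
  finally have M2: "(\<integral>\<^sup>+x. (ball_avg (2 * \<rho> x) u x)\<^sup>2 \<partial>lborel) \<le> ennreal (2 * (N + 1)) * ?S" .
  have "?S ^ 4 \<le> ?H\<^sup>2 * (2 ^ (DIM('a) + 1))\<^sup>2 * (?S * (\<integral>\<^sup>+x. (ball_avg (2 * \<rho> x) u x)\<^sup>2 \<partial>lborel))"
    unfolding u_def by (intro linearized_maximal_bound \<rho>pos) measurable
  also have "\<dots> \<le> ?H\<^sup>2 * (2 ^ (DIM('a) + 1))\<^sup>2 * (?S * (ennreal (2 * (N + 1)) * ?S))"
    by (intro mult_left_mono M2) auto
  finally have le: "?S ^ 4 \<le> ?H\<^sup>2 * (2 ^ (DIM('a) + 1))\<^sup>2 * (?S * (ennreal (2 * (N + 1)) * ?S))" .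
  obtain s where s: "?S = ennreal s" "0 \<le> s" using Sfin by (cases ?S) auto
  obtain t where t: "?H = ennreal t" "0 \<le> t" using fin by (cases ?H) auto
  have two: "(2 ^ (DIM('a) + 1) :: ennreal) = ennreal ?D"
    by (simp add: ennreal_power[symmetric] ennreal_mult)
  have "ennreal (s ^ 4) \<le> ennreal (t\<^sup>2 * ?D\<^sup>2 * (s * (2 * (N + 1) * s)))"
    using le N s(2) t(2) unfolding s(1) t(1) two by (simp only: ennreal_power ennreal_mult[symmetric] zero_le_power mult_nonneg_nonneg zero_le_numeral)
  then have real: "s ^ 4 \<le> t\<^sup>2 * ?D\<^sup>2 * (s * (2 * (N + 1) * s))"
    using N s(2) t(2) by (subst (asm) ennreal_le_iff) auto
  have "s \<le> sqrt (2 * ?D\<^sup>2 * (N + 1)) * t"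
  proof (cases "s = 0")
    case False
    then have sp: "0 < s" using s by simp
    have "s ^ 4 = s\<^sup>2 * s\<^sup>2" by simp
    moreover have "t\<^sup>2 * c * (s * (2 * (N + 1) * s)) = (2 * c * (N + 1) * t\<^sup>2) * s\<^sup>2" for c :: real
      by (simp add: power2_eq_square algebra_simps)
    ultimately have "s\<^sup>2 * s\<^sup>2 \<le> (2 * ?D\<^sup>2 * (N + 1) * t\<^sup>2) * s\<^sup>2"
      using real by (simp only:)
    then have "s\<^sup>2 \<le> 2 * ?D\<^sup>2 * (N + 1) * t\<^sup>2"
      using sp by (simp only: mult_le_cancel_right_pos zero_less_power)
    then have "sqrt (s\<^sup>2) \<le> sqrt (2 * ?D\<^sup>2 * (N + 1) * t\<^sup>2)" by (rule real_sqrt_le_mono)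
    then show ?thesis using s t by (simp add: real_sqrt_mult)
  qed (use N t in auto)
  then have "ennreal s \<le> ennreal (sqrt (2 * ?D\<^sup>2 * (N + 1)) * t)" by (rule ennreal_leI)
  then show ?thesis
    unfolding u s t using t N by (simp add: ennreal_mult)
qed

text \<open>The infimum \<open>N0\<close> of the bounds valid for a given \<open>n\<close> satisfies
  \<open>N0 \<le> sqrt (A * (N0 + 2))\<close>, which confines it to a range independent of
  \<open>n\<close>. A bound \<open>N\<close> within 1 of \<open>N0\<close> is used, so the infimum
  need not be attained.\<close>

lemma dyadic_max_bound:
  "\<exists>C\<ge>0. \<forall>n. \<forall>h::'a::euclidean_space \<Rightarrow> ennreal. h \<in> borel_measurable borel \<longrightarrow> (\<integral>\<^sup>+x. (h x)\<^sup>2 \<partial>lborel) < \<infinity> \<longrightarrow>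
     (\<integral>\<^sup>+x. (dyadic_max n h x)\<^sup>2 \<partial>lborel) \<le> ennreal C * (\<integral>\<^sup>+x. (h x)\<^sup>2 \<partial>lborel)"
proof -
  define A where "A = 2 * (2 ^ (DIM('a) + 1) :: real)\<^sup>2"
  have A: "0 \<le> A" by (simp add: A_def)
  have "(\<integral>\<^sup>+x. (dyadic_max n h x)\<^sup>2 \<partial>lborel) \<le> ennreal (2 * A + 3) * (\<integral>\<^sup>+x. (h x)\<^sup>2 \<partial>lborel)"
    if [measurable]: "h \<in> borel_measurable borel" and fin: "(\<integral>\<^sup>+x. (h x)\<^sup>2 \<partial>lborel) < \<infinity>" for n and h :: "'a \<Rightarrow> ennreal"
  proof -
    define V where "V = {N::real. 0 \<le> N \<and> (\<forall>h::'a \<Rightarrow> ennreal. h \<in> borel_measurable borel \<longrightarrow> (\<integral>\<^sup>+x. (h x)\<^sup>2 \<partial>lborel) < \<infinity> \<longrightarrow>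
       (\<integral>\<^sup>+x. (dyadic_max n h x)\<^sup>2 \<partial>lborel) \<le> ennreal N * (\<integral>\<^sup>+x. (h x)\<^sup>2 \<partial>lborel))}"
    \<comment> \<open>The crude bound by the number of scales depends on \<open>n\<close>; it only
      makes \<open>V\<close> nonempty.\<close>
    have ne: "real (2 * n + 1) \<in> V"
    proof -
      have "(\<integral>\<^sup>+x. (dyadic_max n h x)\<^sup>2 \<partial>lborel) \<le> ennreal (real (2 * n + 1)) * (\<integral>\<^sup>+x. (h x)\<^sup>2 \<partial>lborel)"
        if [measurable]: "h \<in> borel_measurable borel" for h :: "'a \<Rightarrow> ennreal"
      proof -
        have "(dyadic_max n h x)\<^sup>2 \<le> (\<Sum>k\<in>{- int n..int n}. (ball_avg (2 powr k) h x)\<^sup>2)" for x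
        proof -
          have "\<exists>k\<in>{- int n..int n}. dyadic_max n h x = ball_avg (2 powr k) h x"
          proof -
            have "dyadic_max n h x = Max ((\<lambda>k. ball_avg (2 powr k) h x) ` {- int n..int n})"
              unfolding dyadic_max_def by (subst Max_Sup) auto
            also have "\<dots> \<in> (\<lambda>k. ball_avg (2 powr k) h x) ` {- int n..int n}"
              by (intro Max_in) auto
            finally show ?thesis by auto
          qed
          then obtain k where k: "k \<in> {- int n..int n}" "dyadic_max n h x = ball_avg (2 powr k) h x" by blast
          then show ?thesis
            using member_le_sum[OF k(1), of "\<lambda>k. (ball_avg (2 powr real_of_int k) h x)\<^sup>2"] by simp
        qed
        then have "(\<integral>\<^sup>+x. (dyadic_max n h x)\<^sup>2 \<partial>lborel) \<le> (\<integral>\<^sup>+x. (\<Sum>k\<in>{- int n..int n}. (ball_avg (2 powr k) h x)\<^sup>2) \<partial>lborel)"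
          by (rule nn_integral_mono)
        also have "\<dots> = (\<Sum>k\<in>{- int n..int n}. \<integral>\<^sup>+x. (ball_avg (2 powr k) h x)\<^sup>2 \<partial>lborel)"
          by (rule nn_integral_sum) measurable
        also have "\<dots> \<le> (\<Sum>k\<in>{- int n..int n}. \<integral>\<^sup>+x. (h x)\<^sup>2 \<partial>lborel)"
          by (intro sum_mono ball_avg_square_le) auto
        also have "\<dots> = ennreal (real (2 * n + 1)) * (\<integral>\<^sup>+x. (h x)\<^sup>2 \<partial>lborel)"
        proof -
          have "card {- int n..int n} = 2 * n + 1" by simp
          then show ?thesis by (simp only: sum_constant ennreal_of_nat_eq_real_of_nat)
        qed
        finally show ?thesis .
      qed
      then show ?thesis by (auto simp: V_def)
    qed
    have bdd: "bdd_below V" by (intro bdd_belowI[of _ 0]) (auto simp: V_def)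
    define N0 where "N0 = Inf V"
    have N00: "0 \<le> N0" unfolding N0_def using ne by (intro cInf_greatest) (blast, simp add: V_def)
    obtain N where N: "N \<in> V" "N < N0 + 1"
      using cInf_lessD[of V "N0 + 1"] ne by (auto simp: N0_def)
    then have Nn: "0 \<le> N" by (auto simp: V_def)
    have "(\<integral>\<^sup>+x. (dyadic_max n h x)\<^sup>2 \<partial>lborel) \<le> ennreal (sqrt (A * (N + 1))) * (\<integral>\<^sup>+x. (h x)\<^sup>2 \<partial>lborel)"
      if "h \<in> borel_measurable borel" "(\<integral>\<^sup>+x. (h x)\<^sup>2 \<partial>lborel) < \<infinity>" for h :: "'a \<Rightarrow> ennreal"
      unfolding A_def using N(1) that by (intro dyadic_max_step[OF Nn]) (simp_all add: V_def)
    then have "sqrt (A * (N + 1)) \<in> V"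
      using Nn A by (simp add: V_def)
    then have "N0 \<le> sqrt (A * (N + 1))" unfolding N0_def by (rule cInf_lower[OF _ bdd])
    also have "\<dots> \<le> sqrt (A * (N0 + 2))"
      using N A by (intro real_sqrt_le_mono mult_left_mono) auto
    finally have "N0\<^sup>2 \<le> (sqrt (A * (N0 + 2)))\<^sup>2" using N00 by (intro power_mono)
    then have "N0\<^sup>2 \<le> A * (N0 + 2)" using N00 A by simp
    then have "N0 \<le> 2 * A + 2"
    proof -
      { assume "N0 > 2 * A + 2"
        then have "(2 * A + 2) * N0 < N0 * N0" using A by (intro mult_strict_right_mono) auto
        moreover have "A * 2 \<le> A * N0" using \<open>N0 > 2 * A + 2\<close> A by (intro mult_left_mono) auto
        ultimately have False using \<open>N0\<^sup>2 \<le> A * (N0 + 2)\<close> N00 by (simp add: power2_eq_square algebra_simps) }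
      then show ?thesis by force
    qed
    then have "N \<le> 2 * A + 3" using N by simp
    have "(\<integral>\<^sup>+x. (dyadic_max n h x)\<^sup>2 \<partial>lborel) \<le> ennreal N * (\<integral>\<^sup>+x. (h x)\<^sup>2 \<partial>lborel)"
      using N(1) that by (auto simp: V_def)
    also have "\<dots> \<le> ennreal (2 * A + 3) * (\<integral>\<^sup>+x. (h x)\<^sup>2 \<partial>lborel)"
      by (intro mult_right_mono ennreal_leI \<open>N \<le> 2 * A + 3\<close>) auto
    finally show ?thesis .
  qed
  then show ?thesis using A by (intro exI[of _ "2 * A + 3"]) auto
qed

section \<open>Fourier decay of arclength on a convex curve\<close>

text \<open>After rotation by a number \<open>w\<close> of modulus at most 1 the difference becomes
  real and nonnegative, and \<open>1 - Re (w * f x)\<close> is a nonnegative function, whose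
  integral increases with the measure.\<close>

lemma integral_diff_le_of_measure_le:
  fixes f :: "'a \<Rightarrow> complex"
  assumes "finite_measure M" "finite_measure N" and s: "sets M = sets N" and le: "M \<le> N"
    and [measurable]: "f \<in> borel_measurable N" and f1: "\<And>x. cmod (f x) \<le> 1"
  shows "cmod ((\<integral>x. f x \<partial>N) - (\<integral>x. f x \<partial>M)) \<le> measure N (space N) - measure M (space M)"
proof -
  interpret M: finite_measure M by fact
  interpret N: finite_measure N by fact
  note [measurable_cong] = s
  have fM [measurable]: "f \<in> borel_measurable M" by (simp cong: measurable_cong_sets add: s)
  have iN: "integrable N f" by (rule N.integrable_const_bound[of _ 1]) (auto simp: f1)
  have iM: "integrable M f" by (rule M.integrable_const_bound[of _ 1]) (auto simp: f1)
  define d where "d = (\<integral>x. f x \<partial>N) - (\<integral>x. f x \<partial>M)"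
  define w where "w = cnj (sgn d)"
  have w1: "cmod w \<le> 1" by (simp add: w_def norm_sgn)
  have "w * d = complex_of_real (cmod d)"
    using complex_norm_square[of d]
    by (cases "d = 0") (simp_all add: w_def sgn_eq mult.commute power2_eq_square field_simps)
  then have wd: "Re (w * d) = cmod d" by simp
  define \<phi> where "\<phi> x = Re (w * f x)" for x
  have [measurable]: "\<phi> \<in> borel_measurable N" unfolding \<phi>_def by measurable
  have phi1: "\<phi> x \<le> 1" "-1 \<le> \<phi> x" for x
  proof -
    have "\<bar>Re (w * f x)\<bar> \<le> cmod (w * f x)" by (rule abs_Re_le_cmod)
    also have "\<dots> \<le> 1 * 1" unfolding norm_mult by (intro mult_mono w1 f1) auto
    finally show "\<phi> x \<le> 1" "-1 \<le> \<phi> x" by (auto simp: \<phi>_def)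
  qed
  have pN: "integrable N \<phi>" unfolding \<phi>_def by (intro integrable_Re integrable_mult_right iN)
  have pM: "integrable M \<phi>" unfolding \<phi>_def by (intro integrable_Re integrable_mult_right iM)
  have d: "cmod d = (\<integral>x. \<phi> x \<partial>N) - (\<integral>x. \<phi> x \<partial>M)"
  proof -
    have "(\<integral>x. \<phi> x \<partial>N) = Re (w * (\<integral>x. f x \<partial>N))" "(\<integral>x. \<phi> x \<partial>M) = Re (w * (\<integral>x. f x \<partial>M))"
      unfolding \<phi>_def integral_Re[OF integrable_mult_right[OF iN]] integral_Re[OF integrable_mult_right[OF iM]]
      by (simp_all only: integral_mult_right_zero)
    moreover have "Re (w * d) = Re (w * (\<integral>x. f x \<partial>N)) - Re (w * (\<integral>x. f x \<partial>M))"
      unfolding d_def by (simp only: right_diff_distrib minus_complex.sel)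
    ultimately show ?thesis using wd by simp
  qed
  have "(\<integral>x. 1 - \<phi> x \<partial>M) \<le> (\<integral>x. 1 - \<phi> x \<partial>N)"
  proof -
    have "ennreal (\<integral>x. 1 - \<phi> x \<partial>M) = (\<integral>\<^sup>+x. ennreal (1 - \<phi> x) \<partial>M)"
      using pM phi1 by (intro nn_integral_eq_integral[symmetric]) auto
    also have "\<dots> \<le> (\<integral>\<^sup>+x. ennreal (1 - \<phi> x) \<partial>N)"
      by (rule nn_integral_mono_measure[OF s le])
    also have "\<dots> = ennreal (\<integral>x. 1 - \<phi> x \<partial>N)"
      using pN phi1 by (intro nn_integral_eq_integral) auto
    finally show ?thesis using phi1 by (subst (asm) ennreal_le_iff) auto
  qed
  moreover have "(\<integral>x. 1 - \<phi> x \<partial>M) = measure M (space M) - (\<integral>x. \<phi> x \<partial>M)"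
    "(\<integral>x. 1 - \<phi> x \<partial>N) = measure N (space N) - (\<integral>x. \<phi> x \<partial>N)"
    using pM pN by simp_all
  ultimately show ?thesis unfolding d_def[symmetric] d by linarith
qed

lemma borel_shift_image:
  fixes c :: real
  assumes "E \<in> sets borel"
  shows "(\<lambda>t. t + c) ` E \<in> sets borel"
proof -
  have "(\<lambda>t. t + c) ` E = (\<lambda>t. t - c) -` E" by force
  also have "\<dots> \<in> sets borel"
    using measurable_sets[of "\<lambda>t. t - c" borel borel E] assms by simp
  finally show ?thesis .
qed

text \<open>A decreasing measure on an interval: the oscillating factor changes sign under the shift by
  half a period, so after averaging with the shifted integral only the mass of the first half period
  survives.\<close>

lemma oscillatory_decreasing_measure:
  fixes \<mu> :: "real measure"
  assumes fin: "finite_measure \<mu>" and sets[measurable_cong]: "sets \<mu> = sets borel"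
    and J[measurable]: "J \<in> sets borel" and null: "emeasure \<mu> (- J) = 0"
    and lower: "\<And>t. t \<in> J \<Longrightarrow> a < t" and down: "\<And>t t'. t \<in> J \<Longrightarrow> a < t' \<Longrightarrow> t' \<le> t \<Longrightarrow> t' \<in> J"
    and s: "0 < s" and rs: "\<bar>r\<bar> * s = pi"
    and mono: "\<And>E. E \<in> sets borel \<Longrightarrow> E \<subseteq> J \<Longrightarrow> (\<lambda>t. t + s) ` E \<subseteq> J \<Longrightarrow> emeasure \<mu> ((\<lambda>t. t + s) ` E) \<le> emeasure \<mu> E"
  shows "cmod (\<integral>t. cis (r * t) \<partial>\<mu>) \<le> measure \<mu> {..a + s}"
proof -
  interpret finite_measure \<mu> by fact
  have sp: "space \<mu> = UNIV" using sets_eq_imp_space_eq[OF sets] by simp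
  define e where "e t = cis (r * t)" for t
  have [measurable]: "e \<in> borel_measurable borel" unfolding e_def by measurable
  have e1: "cmod (e t) = 1" for t by (simp add: e_def)
  have shift: "e (t + s) = - e t" for t
  proof -
    have "r * s = pi \<or> r * s = - pi" using rs by (auto simp: abs_if split: if_splits)
    then have "cis (r * s) = -1" by (auto simp: cis.code complex_eq_iff)
    then show ?thesis by (simp add: e_def distrib_left flip: cis_mult)
  qed
  \<comment> \<open>\<open>J1\<close> holds the heights that stay in \<open>J\<close> when raised by
    \<open>s\<close>; raising \<open>J1\<close> gives exactly \<open>J2\<close>, because
    \<open>J\<close> is closed downwards.\<close>
  define J1 where "J1 = {t \<in> J. t + s \<in> J}"
  define J2 where "J2 = {t \<in> J. a + s < t}"
  have [measurable]: "J1 \<in> sets borel" "J2 \<in> sets borel" unfolding J1_def J2_def by measurable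
  have J2_image: "(\<lambda>t. t + s) ` {t \<in> J1. t + s \<in> E} = J2 \<inter> E" for E
  proof (intro equalityI subsetI)
    fix x assume "x \<in> J2 \<inter> E"
    then have "x - s \<in> {t \<in> J1. t + s \<in> E}"
      using down[of x "x - s"] s by (auto simp: J1_def J2_def)
    then show "x \<in> (\<lambda>t. t + s) ` {t \<in> J1. t + s \<in> E}" by (intro image_eqI[of _ _ "x - s"]) auto
  qed (auto simp: J1_def J2_def dest: lower)
  have ii: "integrable \<mu> (\<lambda>t. indicator A t *\<^sub>R e t)" if [measurable]: "A \<in> sets borel" for A
    by (rule integrable_const_bound[of _ 1]) (auto simp: e1 indicator_def)
  define I where "I A = (\<integral>t. indicator A t *\<^sub>R e t \<partial>\<mu>)" for A
  have I_le: "cmod (I A) \<le> measure \<mu> A" if [measurable]: "A \<in> sets borel" for A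
  proof -
    have "cmod (I A) \<le> (\<integral>t. cmod (indicator A t *\<^sub>R e t) \<partial>\<mu>)" unfolding I_def by (rule integral_norm_bound)
    also have "\<dots> = measure \<mu> A" by (simp add: e1 sp)
    finally show ?thesis .
  qed
  have I_add: "I (A \<union> B) = I A + I B" if "A \<inter> B = {}" and [measurable]: "A \<in> sets borel" "B \<in> sets borel" for A B
  proof -
    have "indicator (A \<union> B) t *\<^sub>R e t = indicator A t *\<^sub>R e t + indicator B t *\<^sub>R e t" for t
      using that(1) by (auto simp: indicator_def)
    then show ?thesis unfolding I_def using ii by simp
  qed
  \<comment> \<open>\<open>\<mu>1\<close> is the raised restriction to \<open>J1\<close> and
    \<open>\<mu>2\<close> the restriction to \<open>J2\<close>. The hypothesis \<open>mono\<close>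
    says that \<open>\<mu>2 \<le> \<mu>1\<close>, while the sign change makes the integral over
    \<open>\<mu>1\<close> equal to \<open>- I J1\<close>.\<close>
  define \<mu>1 where "\<mu>1 = distr (density \<mu> (\<lambda>t. ennreal (indicator J1 t))) borel (\<lambda>t. t + s)"
  define \<mu>2 where "\<mu>2 = density \<mu> (\<lambda>t. ennreal (indicator J2 t))"
  have em1: "emeasure \<mu>1 E = emeasure \<mu> {t \<in> J1. t + s \<in> E}" if [measurable]: "E \<in> sets borel" for E
  proof -
    have [measurable]: "(\<lambda>t. t + s) -` E \<in> sets borel"
      using measurable_sets[of "\<lambda>t. t + s" borel borel E] by simp
    have "emeasure \<mu>1 E = (\<integral>\<^sup>+t. indicator J1 t * indicator ((\<lambda>t. t + s) -` E) t \<partial>\<mu>)"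
      unfolding \<mu>1_def by (simp add: emeasure_distr emeasure_density sp ennreal_indicator)
    also have "\<dots> = (\<integral>\<^sup>+t. indicator {t \<in> J1. t + s \<in> E} t \<partial>\<mu>)"
      by (intro nn_integral_cong) (auto simp: indicator_def)
    finally show ?thesis by simp
  qed
  have em2: "emeasure \<mu>2 E = emeasure \<mu> (J2 \<inter> E)" if [measurable]: "E \<in> sets borel" for E
    unfolding \<mu>2_def by (simp add: emeasure_density ennreal_indicator indicator_inter_arith[symmetric])
  have le: "\<mu>2 \<le> \<mu>1"
  proof (subst le_measure)
    show "sets \<mu>2 = sets \<mu>1" by (simp add: \<mu>1_def \<mu>2_def sets)
    show "\<forall>E\<in>sets \<mu>2. emeasure \<mu>2 E \<le> emeasure \<mu>1 E"
    proof
      fix E assume "E \<in> sets \<mu>2"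
      then have E[measurable]: "E \<in> sets borel" by (simp add: \<mu>2_def sets)
      have "emeasure \<mu> ((\<lambda>t. t + s) ` {t \<in> J1. t + s \<in> E}) \<le> emeasure \<mu> {t \<in> J1. t + s \<in> E}"
        by (rule mono) (auto simp: J1_def)
      then show "emeasure \<mu>2 E \<le> emeasure \<mu>1 E"
        by (simp add: em1 em2 J2_image)
    qed
  qed
  have fin1: "finite_measure \<mu>1"
    by (rule finite_measureI) (simp add: em1 \<mu>1_def[THEN arg_cong[of _ _ space]])
  have fin2: "finite_measure \<mu>2"
    by (rule finite_measureI) (simp add: em2 sp \<mu>2_def[THEN arg_cong[of _ _ space]])
  have int1: "(\<integral>t. e t \<partial>\<mu>1) = - I J1"
  proof -
    have "(\<integral>t. e t \<partial>\<mu>1) = (\<integral>t. e (t + s) \<partial>density \<mu> (\<lambda>t. ennreal (indicator J1 t)))"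
      unfolding \<mu>1_def by (intro integral_distr) measurable
    also have "\<dots> = (\<integral>t. indicator J1 t *\<^sub>R e (t + s) \<partial>\<mu>)"
      by (intro integral_density) auto
    finally show ?thesis by (simp add: shift I_def)
  qed
  have int2: "(\<integral>t. e t \<partial>\<mu>2) = I J2"
    unfolding \<mu>2_def I_def by (intro integral_density) auto
  have m1: "measure \<mu>1 (space \<mu>1) = measure \<mu> J1"
    by (simp add: measure_def em1 \<mu>1_def[THEN arg_cong[of _ _ space]])
  have m2: "measure \<mu>2 (space \<mu>2) = measure \<mu> J2"
    by (simp add: measure_def em2 sp \<mu>2_def[THEN arg_cong[of _ _ space]])
  have "cmod ((\<integral>t. e t \<partial>\<mu>1) - (\<integral>t. e t \<partial>\<mu>2)) \<le> measure \<mu>1 (space \<mu>1) - measure \<mu>2 (space \<mu>2)"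
    by (rule integral_diff_le_of_measure_le[OF fin2 fin1 _ le]) (auto simp: \<mu>1_def \<mu>2_def sets e1)
  then have mid: "cmod (I J1 + I J2) \<le> measure \<mu> J1 - measure \<mu> J2"
    unfolding int1 int2 m1 m2 by (metis norm_minus_cancel minus_add uminus_add_conv_diff add.commute diff_conv_add_uminus)
  have sub: "J1 \<subseteq> J" "J2 \<subseteq> J" by (auto simp: J1_def J2_def)
  have 1: "I J = I J1 + I (J - J1)" using I_add[of J1 "J - J1"] sub by (simp add: Un_absorb1)
  have 2: "I J = I J2 + I (J - J2)" using I_add[of J2 "J - J2"] sub by (simp add: Un_absorb1)
  \<comment> \<open>\<open>I J\<close> is split once along \<open>J1\<close> and once along
    \<open>J2\<close>. The masses of the three error terms add up to
    \<open>2 * measure \<mu> (J - J2)\<close>, and \<open>J - J2\<close> consists of heights at most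
    \<open>a + s\<close>.\<close>
  have "2 * I J = I J + I J" by (rule mult_2)
  also have "\<dots> = (I J1 + I (J - J1)) + (I J2 + I (J - J2))" by (rule arg_cong2[where f="(+)", OF 1 2])
  also have "\<dots> = (I J1 + I J2) + I (J - J1) + I (J - J2)" by (simp only: ac_simps)
  finally have "2 * cmod (I J) = cmod ((I J1 + I J2) + I (J - J1) + I (J - J2))"
    by (metis norm_mult norm_numeral)
  also have "\<dots> \<le> cmod (I J1 + I J2) + cmod (I (J - J1)) + cmod (I (J - J2))"
    using norm_triangle_ineq[of "I J1 + I J2 + I (J - J1)" "I (J - J2)"] norm_triangle_ineq[of "I J1 + I J2" "I (J - J1)"]
    by simp
  also have "\<dots> \<le> (measure \<mu> J1 - measure \<mu> J2) + measure \<mu> (J - J1) + measure \<mu> (J - J2)"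
    by (intro add_mono mid I_le) auto
  also have "\<dots> = 2 * measure \<mu> (J - J2)"
    using sub by (simp add: finite_measure_Diff)
  also have "\<dots> \<le> 2 * measure \<mu> {..a + s}"
    by (intro mult_left_mono finite_measure_mono) (auto simp: J2_def)
  finally have "cmod (I J) \<le> measure \<mu> {..a + s}" by simp
  moreover have "I J = (\<integral>t. cis (r * t) \<partial>\<mu>)"
    unfolding I_def
  proof (rule integral_cong_AE)
    have "AE t in \<mu>. t \<notin> - J"
      using null by (intro AE_not_in) (auto simp: null_sets_def sets)
    then show "AE t in \<mu>. indicator J t *\<^sub>R e t = cis (r * t)"
      by eventually_elim (auto simp: e_def)
  qed measurable
  ultimately show ?thesis by simp
qed

text \<open>The inverse of \<open>\<phi>\<close> is a contraction from a bounded set of reals onto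
  \<open>A\<close>.\<close>

lemma H1_finite_of_expanding_functional:
  fixes A :: "'a::metric_space set" and \<phi> :: "'a \<Rightarrow> real"
  assumes "\<And>x y. x \<in> A \<Longrightarrow> y \<in> A \<Longrightarrow> dist x y \<le> \<bar>\<phi> x - \<phi> y\<bar>" and b: "\<And>x. x \<in> A \<Longrightarrow> \<bar>\<phi> x\<bar> \<le> L"
  shows "H1 A < \<infinity>"
proof -
  have inj: "inj_on \<phi> A" using assms(1) by (force intro!: inj_onI)
  have "H1 A = H1 (inv_into A \<phi> ` (\<phi> ` A))" using inj by simp
  also have "\<dots> \<le> H1 (\<phi> ` A)"
    by (rule H1_image_le) (use assms(1) inj in \<open>auto simp: dist_real_def\<close>)
  also have "\<dots> \<le> H1 {- L..L}" using b by (intro H1_mono) (auto simp: abs_le_iff minus_le_iff)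
  also have "\<dots> < \<infinity>" by (rule H1_interval_finite)
  finally show ?thesis .
qed

section \<open>Orthonormal frames and the boundary of a planar convex domain\<close>

definition perp :: "real^2 \<Rightarrow> real^2" where
  "perp v = vector [- (v $ 2), v $ 1]"

definition onb :: "real^2 \<Rightarrow> real^2 \<Rightarrow> bool" where
  "onb u v \<longleftrightarrow> norm u = 1 \<and> norm v = 1 \<and> u \<bullet> v = 0 \<and> (\<forall>x. x = (x \<bullet> u) *\<^sub>R u + (x \<bullet> v) *\<^sub>R v)"

lemma onb_perp: assumes "norm v = 1" shows "onb (perp v) v"
proof -
  have v: "v $ 1 * v $ 1 + v $ 2 * v $ 2 = 1"
    using assms by (simp add: norm_eq_1 inner_vec_def sum_2)
  have "x = (x \<bullet> perp v) *\<^sub>R perp v + (x \<bullet> v) *\<^sub>R v" for x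
  proof -
    have "x $ 1 = x $ 1 * (v $ 1 * v $ 1 + v $ 2 * v $ 2)" "x $ 2 = x $ 2 * (v $ 1 * v $ 1 + v $ 2 * v $ 2)"
      by (simp_all add: v)
    then show ?thesis
      by (simp add: vec_eq_iff forall_2 perp_def inner_vec_def sum_2 algebra_simps)
  qed
  then show ?thesis
    using assms v by (simp add: onb_def norm_eq_1 perp_def inner_vec_def sum_2 algebra_simps)
qed

lemma onb_uminus: "onb u v \<Longrightarrow> onb (- u) v" "onb u v \<Longrightarrow> onb u (- v)"
  by (auto simp: onb_def)

lemma onb_dist:
  assumes "onb u v"
  shows "(dist x y)\<^sup>2 = (x \<bullet> u - y \<bullet> u)\<^sup>2 + (x \<bullet> v - y \<bullet> v)\<^sup>2"
proof -
  define a b where "a = x \<bullet> u - y \<bullet> u" and "b = x \<bullet> v - y \<bullet> v"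
  have "x - y = a *\<^sub>R u + b *\<^sub>R v"
    using assms unfolding onb_def a_def b_def by (metis inner_diff_left)
  then have "(dist x y)\<^sup>2 = (a *\<^sub>R u + b *\<^sub>R v) \<bullet> (a *\<^sub>R u + b *\<^sub>R v)"
    by (simp add: dist_norm power2_norm_eq_inner)
  also have "\<dots> = a\<^sup>2 + b\<^sup>2"
    using assms by (simp add: onb_def norm_eq_1 inner_add_left inner_add_right inner_commute power2_eq_square)
  finally show ?thesis by (simp add: a_def b_def)
qed

locale convex_domain =
  fixes \<Omega> :: "(real^2) set"
  assumes conv: "convex \<Omega>" and op: "open \<Omega>" and bdd: "bounded \<Omega>" and zero: "0 \<in> \<Omega>"
begin

lemma frontier_eq: "frontier \<Omega> = closure \<Omega> - \<Omega>"
  using op by (simp add: frontier_def interior_open)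

lemma compact_closure_domain: "compact (closure \<Omega>)"
  using bdd by (simp add: compact_closure)

lemma interior_eq: "interior \<Omega> = \<Omega>"
  using op by (rule interior_open)

lemma supporting_normal:
  assumes "p \<in> frontier \<Omega>"
  obtains n where "n \<noteq> 0" "\<And>q. q \<in> frontier \<Omega> \<Longrightarrow> n \<bullet> q \<le> n \<bullet> p"
proof -
  have "p \<notin> \<Omega>" using assms by (simp add: frontier_eq)
  then obtain n b where n: "n \<noteq> 0" "\<forall>x\<in>\<Omega>. n \<bullet> x \<le> b" "\<forall>x\<in>{p}. b \<le> n \<bullet> x"
    using separating_hyperplane_sets[of \<Omega> "{p}"] conv zero by auto
  have "closure \<Omega> \<subseteq> {x. n \<bullet> x \<le> b}"
    using n by (intro closure_minimal closed_halfspace_le) auto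
  then show thesis using n by (intro that[of n]) (auto simp: frontier_eq)
qed

text \<open>Points with an outer normal in a fixed quadrant lie on a monotone curve, on which the
  \<open>l\<^sup>1\<close> distance is the increment of a linear functional.\<close>

lemma H1_frontier_finite: "H1 (frontier \<Omega>) < \<infinity>"
proof -
  define Q where "Q a b = {p \<in> frontier \<Omega>. \<exists>n. n \<noteq> 0 \<and> 0 \<le> a * n $ 1 \<and> 0 \<le> b * n $ 2 \<and>
      (\<forall>q\<in>frontier \<Omega>. n \<bullet> q \<le> n \<bullet> p)}" for a b :: real
  obtain R where R: "\<And>x. x \<in> frontier \<Omega> \<Longrightarrow> norm x \<le> R"
    using bounded_closure[OF bdd] by (auto simp: bounded_iff frontier_eq)
  have fin: "H1 (Q a b) < \<infinity>" if ab: "\<bar>a\<bar> = 1" "\<bar>b\<bar> = 1" for a b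
  proof (rule H1_finite_of_expanding_functional[of _ "\<lambda>p. a * p $ 1 - b * p $ 2" "R + R"])
    have aa: "a = 1 \<or> a = -1" "b = 1 \<or> b = -1" using ab by auto
    fix p q assume pq: "p \<in> Q a b" "q \<in> Q a b"
    \<comment> \<open>If both signed coordinates increased from \<open>x\<close> to
      \<open>y\<close>, then \<open>y\<close> would lie strictly beyond the supporting line at
      \<open>x\<close>, whose normal has the signs of the quadrant.\<close>
    have sgn: "a * (y $ 1 - x $ 1) \<le> 0 \<or> b * (y $ 2 - x $ 2) \<le> 0" if "x \<in> Q a b" "y \<in> Q a b" for x y
    proof (rule ccontr)
      assume "\<not> ?thesis"
      then have c: "0 < a * (y $ 1 - x $ 1)" "0 < b * (y $ 2 - x $ 2)" by auto
      from that obtain n where n: "n \<noteq> 0" "0 \<le> a * n $ 1" "0 \<le> b * n $ 2" "n \<bullet> y \<le> n \<bullet> x"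
        unfolding Q_def by blast
      have "(a * n $ 1) * (a * (y $ 1 - x $ 1)) + (b * n $ 2) * (b * (y $ 2 - x $ 2)) = n \<bullet> y - n \<bullet> x"
        using aa by (auto simp: inner_vec_def sum_2 algebra_simps)
      moreover have "n $ 1 \<noteq> 0 \<or> n $ 2 \<noteq> 0"
        using n(1) by (auto simp: vec_eq_iff forall_2)
      then have "0 < a * n $ 1 \<or> 0 < b * n $ 2" using n aa by auto
      then have "0 < (a * n $ 1) * (a * (y $ 1 - x $ 1)) + (b * n $ 2) * (b * (y $ 2 - x $ 2))"
        using c n by (auto intro: add_pos_nonneg add_nonneg_pos mult_pos_pos mult_nonneg_nonneg less_imp_le)
      ultimately show False using n by simp
    qed
    have "dist p q \<le> \<bar>p $ 1 - q $ 1\<bar> + \<bar>p $ 2 - q $ 2\<bar>"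
      using norm_le_l1_cart[of "p - q"] by (simp add: dist_norm sum_2)
    also have "\<dots> = \<bar>(a * p $ 1 - b * p $ 2) - (a * q $ 1 - b * q $ 2)\<bar>"
      using sgn[OF pq] sgn[OF pq(2,1)] aa by auto
    finally show "dist p q \<le> \<bar>(a * p $ 1 - b * p $ 2) - (a * q $ 1 - b * q $ 2)\<bar>" .
  next
    fix p assume "p \<in> Q a b"
    then have "norm p \<le> R" using R by (auto simp: Q_def)
    then have "\<bar>p $ 1\<bar> \<le> R" "\<bar>p $ 2\<bar> \<le> R" using component_le_norm_cart order_trans by blast+
    then show "\<bar>a * p $ 1 - b * p $ 2\<bar> \<le> R + R"
      using ab abs_triangle_ineq4[of "a * p $ 1" "b * p $ 2"] by (simp add: abs_mult)
  qed
  have "frontier \<Omega> \<subseteq> (Q 1 1 \<union> Q 1 (-1)) \<union> (Q (-1) 1 \<union> Q (-1) (-1))"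
  proof
    fix p assume p: "p \<in> frontier \<Omega>"
    obtain n where n: "n \<noteq> 0" "\<And>q. q \<in> frontier \<Omega> \<Longrightarrow> n \<bullet> q \<le> n \<bullet> p"
      using supporting_normal[OF p] by blast
    show "p \<in> (Q 1 1 \<union> Q 1 (-1)) \<union> (Q (-1) 1 \<union> Q (-1) (-1))"
      using p n by (cases "0 \<le> n $ 1"; cases "0 \<le> n $ 2") (auto simp: Q_def)
  qed
  then have "H1 (frontier \<Omega>) \<le> H1 ((Q 1 1 \<union> Q 1 (-1)) \<union> (Q (-1) 1 \<union> Q (-1) (-1)))" by (rule H1_mono)
  also have "\<dots> \<le> (H1 (Q 1 1) + H1 (Q 1 (-1))) + (H1 (Q (-1) 1) + H1 (Q (-1) (-1)))"
    by (intro order_trans[OF H1_Un] add_mono H1_Un)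
  also have "\<dots> < \<infinity>" using fin by simp
  finally show ?thesis .
qed

section \<open>Arclength on the boundary, the support function and the caps\<close>

abbreviation "\<sigma> \<equiv> arclength \<Omega>"

lemma finite_measure_arclength: "finite_measure \<sigma>"
  using H1_frontier_finite by (intro finite_measureI) (simp add: emeasure_arclength)

sublocale arc: finite_measure \<sigma> by (rule finite_measure_arclength)

lemma AE_frontier: "AE p in \<sigma>. p \<in> frontier \<Omega>"
  by (rule AE_I[of _ _ "- frontier \<Omega>"]) (auto simp: emeasure_arclength borel_closed)

definition supp :: "real^2 \<Rightarrow> real" where
  "supp v = (SUP x\<in>closure \<Omega>. x \<bullet> v)"

lemma supp_ge: "x \<in> closure \<Omega> \<Longrightarrow> x \<bullet> v \<le> supp v"
  unfolding supp_def
  by (intro cSUP_upper bounded_imp_bdd_above compact_imp_bounded compact_continuous_image compact_closure_domain)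
     (auto intro!: continuous_intros)

lemma supp_gt: "v \<noteq> 0 \<Longrightarrow> x \<in> \<Omega> \<Longrightarrow> x \<bullet> v < supp v"
proof -
  assume v: "v \<noteq> 0" and x: "x \<in> \<Omega>"
  obtain e where e: "0 < e" "ball x e \<subseteq> \<Omega>" using op x by (auto simp: open_contains_ball)
  define y where "y = x + (e / (2 * norm v)) *\<^sub>R v"
  have "y \<in> ball x e" using e v by (simp add: y_def dist_norm)
  then have "y \<in> closure \<Omega>" using e(2) closure_subset[of \<Omega>] by (meson subsetD)
  then have "y \<bullet> v \<le> supp v" by (rule supp_ge)
  moreover have "y \<bullet> v = x \<bullet> v + (e / (2 * norm v)) * (v \<bullet> v)" by (simp add: y_def inner_add_left)
  moreover have "0 < (e / (2 * norm v)) * (v \<bullet> v)" using e v by simp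
  ultimately show ?thesis by linarith
qed

lemma supp_attained: "v \<noteq> 0 \<Longrightarrow> \<exists>p\<in>frontier \<Omega>. p \<bullet> v = supp v"
proof -
  assume v: "v \<noteq> 0"
  have ne: "closure \<Omega> \<noteq> {}" using zero closure_subset by blast
  have "continuous_on (closure \<Omega>) (\<lambda>x. x \<bullet> v)" by (intro continuous_intros)
  from continuous_attains_sup[OF compact_closure_domain ne this]
  obtain p where p: "p \<in> closure \<Omega>" "\<And>x. x \<in> closure \<Omega> \<Longrightarrow> x \<bullet> v \<le> p \<bullet> v" by blast
  have "supp v = p \<bullet> v"
    using p ne by (intro antisym supp_ge) (auto simp: supp_def intro!: cSUP_least)
  moreover then have "p \<notin> \<Omega>" using supp_gt[OF v, of p] by auto
  ultimately show ?thesis using p by (auto simp: frontier_eq)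
qed

lemma supp_pos: "v \<noteq> 0 \<Longrightarrow> 0 < supp v"
  using supp_gt[OF _ zero] by simp

text \<open>Resolves the definite description. A line at level \<open>c\<close> with the domain
  below it has \<open>c\<close> at least the maximal height on the closure, and since it touches the
  frontier \<open>c\<close> is at most that height.\<close>

lemma ell_plus_eq:
  assumes v: "norm v = 1"
  shows "ell_plus \<Omega> v = {y. y \<bullet> v = supp v}"
proof -
  have v0: "v \<noteq> 0" and vv: "v \<bullet> v = 1" using v by (auto simp: norm_eq_1)
  show ?thesis
    unfolding ell_plus_def
  proof (rule the_equality)
    obtain p where p: "p \<in> frontier \<Omega>" "p \<bullet> v = supp v" using supp_attained[OF v0] by blast
    have "x \<in> {y - t *\<^sub>R v |y t. 0 < t \<and> y \<in> {y. y \<bullet> v = supp v}}" if "x \<in> \<Omega>" for x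
      using supp_gt[OF v0 that] vv
      by (intro CollectI exI[of _ "x + (supp v - x \<bullet> v) *\<^sub>R v"] exI[of _ "supp v - x \<bullet> v"])
         (auto simp: inner_add_left)
    then show "(\<exists>c. {y. y \<bullet> v = supp v} = {y. y \<bullet> v = c}) \<and> {y. y \<bullet> v = supp v} \<inter> frontier \<Omega> \<noteq> {} \<and>
       \<Omega> \<subseteq> {y - t *\<^sub>R v |y t. 0 < t \<and> y \<in> {y. y \<bullet> v = supp v}}"
      using p by blast
  next
    fix L assume L: "(\<exists>c. L = {y. y \<bullet> v = c}) \<and> L \<inter> frontier \<Omega> \<noteq> {} \<and> \<Omega> \<subseteq> {y - t *\<^sub>R v |y t. 0 < t \<and> y \<in> L}"
    then obtain c q where c: "L = {y. y \<bullet> v = c}" and q: "q \<in> frontier \<Omega>" "q \<bullet> v = c" by blast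
    have "x \<bullet> v \<le> c" if "x \<in> \<Omega>" for x
    proof -
      from L that have "x \<in> {y - t *\<^sub>R v |y t. 0 < t \<and> y \<in> L}" by blast
      then obtain y t where "x = y - t *\<^sub>R v" "0 < t" "y \<bullet> v = c" using c by blast
      then show ?thesis using vv by (simp add: inner_diff_left)
    qed
    then have "closure \<Omega> \<subseteq> {x. v \<bullet> x \<le> c}"
      by (intro closure_minimal closed_halfspace_le) (auto simp: inner_commute)
    moreover obtain p where "p \<in> frontier \<Omega>" "p \<bullet> v = supp v" using supp_attained[OF v0] by blast
    ultimately have "supp v \<le> c" by (auto simp: frontier_eq inner_commute)
    moreover have "c \<le> supp v" using supp_ge[of q v] q by (auto simp: frontier_eq)
    ultimately show "L = {y. y \<bullet> v = supp v}" using c by simp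
  qed
qed

lemma ell_minus_eq: "ell_minus \<Omega> v = ell_plus \<Omega> (- v)"
proof -
  have "(\<exists>c. L = {y. y \<bullet> v = c}) \<longleftrightarrow> (\<exists>c. L = {y. y \<bullet> - v = c})" for L :: "(real^2) set"
  proof -
    have "{y. y \<bullet> - v = c} = {y. y \<bullet> v = - c}" for c by auto
    then show ?thesis by (metis minus_minus)
  qed
  then show ?thesis unfolding ell_minus_def ell_plus_def by simp
qed

lemma infdist_hyperplane:
  fixes v y :: "real^2"
  assumes v: "norm v = 1"
  shows "infdist y {z. z \<bullet> v = c} = \<bar>y \<bullet> v - c\<bar>"
proof (rule antisym)
  have vv: "v \<bullet> v = 1" using v by (simp add: norm_eq_1)
  let ?z = "y - (y \<bullet> v - c) *\<^sub>R v"
  have z: "?z \<in> {z. z \<bullet> v = c}" using vv by (simp add: inner_diff_left)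
  then show "infdist y {z. z \<bullet> v = c} \<le> \<bar>y \<bullet> v - c\<bar>"
    using infdist_le[OF z, of y] v by (simp add: dist_norm)
  have "\<bar>y \<bullet> v - c\<bar> \<le> dist y x" if "x \<bullet> v = c" for x
    using Cauchy_Schwarz_ineq2[of "y - x" v] v that by (simp add: dist_norm inner_diff_left)
  then show "\<bar>y \<bullet> v - c\<bar> \<le> infdist y {z. z \<bullet> v = c}"
    unfolding infdist_def using z by (auto intro!: cINF_greatest)
qed

lemma cap_plus_eq:
  assumes v: "norm v = 1"
  shows "cap_plus \<Omega> v d = {y \<in> frontier \<Omega>. supp v - d \<le> y \<bullet> v}"
proof -
  have "\<bar>y \<bullet> v - supp v\<bar> = supp v - y \<bullet> v" if "y \<in> frontier \<Omega>" for y
    using supp_ge[of y v] that by (simp add: frontier_eq)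
  then show ?thesis
    unfolding cap_plus_def ell_plus_eq[OF v] infdist_hyperplane[OF v] by auto
qed

lemma cap_minus_eq: "cap_minus \<Omega> v d = cap_plus \<Omega> (- v) d"
  unfolding cap_plus_def cap_minus_def ell_minus_eq ..

text \<open>The two caps are kept apart, with the lower one written as the cap of
  \<open>- v\<close>, because the estimate of a single arc produces only one of them.\<close>

definition cap_mass :: "real^2 \<Rightarrow> real \<Rightarrow> real" where
  "cap_mass v d = measure \<sigma> {y \<in> frontier \<Omega>. supp v - d \<le> y \<bullet> v}"

lemma Lambda_eq: "norm v = 1 \<Longrightarrow> Lambda \<Omega> v d = max (cap_mass v d) (cap_mass (- v) d)"
  by (simp add: Lambda_def cap_minus_eq cap_plus_eq cap_mass_def)

lemma cap_measurable [measurable]: "{y \<in> frontier \<Omega>. c \<le> y \<bullet> v} \<in> sets borel"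
proof -
  have "{y \<in> frontier \<Omega>. c \<le> y \<bullet> v} = frontier \<Omega> \<inter> {y. v \<bullet> y \<ge> c}" by (auto simp: inner_commute)
  then show ?thesis by (simp add: borel_closed closed_Int closed_halfspace_ge)
qed

lemma cap_mass_mono: "d \<le> e \<Longrightarrow> cap_mass v d \<le> cap_mass v e"
  unfolding cap_mass_def by (intro arc.finite_measure_mono) auto

lemma cap_mass_nonneg [simp]: "0 \<le> cap_mass v d"
  by (simp add: cap_mass_def)

lemma cap_mass_le: "cap_mass v d \<le> measure \<sigma> UNIV"
  unfolding cap_mass_def by (intro arc.finite_measure_mono) auto

section \<open>The two sides of the boundary, as graphs over the height in a given direction\<close>

definition side :: "real^2 \<Rightarrow> (real^2) set" where
  "side u = {p \<in> frontier \<Omega>. \<exists>t>0. p - t *\<^sub>R u \<in> \<Omega>}"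

lemma side_borel [measurable]: "side u \<in> sets borel"
proof -
  have "side u = frontier \<Omega> \<inter> (\<Union>t\<in>{0<..}. (\<lambda>p. p - t *\<^sub>R u) -` \<Omega>)" by (auto simp: side_def)
  moreover have "open (\<Union>t\<in>{0<..}. (\<lambda>p. p - t *\<^sub>R u) -` \<Omega>)"
    by (intro open_UN ballI open_vimage op continuous_intros)
  ultimately show ?thesis by (simp add: borel_closed borel_open sets.Int)
qed

text \<open>A point common to both sides would lie on a segment between two points of the convex
  domain, hence in the domain, which misses its frontier.\<close>

lemma side_disjoint: "side u \<inter> side (- u) = {}"
proof -
  { fix p assume "p \<in> side u" "p \<in> side (- u)"
    then obtain s t where st: "0 < s" "p - s *\<^sub>R u \<in> \<Omega>" "0 < t" "p + t *\<^sub>R u \<in> \<Omega>" and p: "p \<notin> \<Omega>"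
      by (auto simp: side_def frontier_eq)
    have "(t / (s + t)) *\<^sub>R (p - s *\<^sub>R u) + (s / (s + t)) *\<^sub>R (p + t *\<^sub>R u) \<in> \<Omega>"
      using st by (intro convexD[OF conv]) (auto simp: add_divide_distrib[symmetric])
    also have "(t / (s + t)) *\<^sub>R (p - s *\<^sub>R u) + (s / (s + t)) *\<^sub>R (p + t *\<^sub>R u)
        = (t / (s + t) + s / (s + t)) *\<^sub>R p" 
      by (simp add: algebra_simps)
    also have "t / (s + t) + s / (s + t) = 1" using st by (simp add: add_divide_distrib[symmetric])
    finally have False using p by simp }
  then show ?thesis by blast
qed

text \<open>Otherwise the boundary point would lie strictly inside a segment from a point of the
  open domain to a point of its closure, hence in the domain. This makes each side a graph over the
  height.\<close>

lemma side_maximal: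
  assumes uv: "onb u v" and p: "p \<in> side u" and k: "k \<in> closure \<Omega>" "k \<bullet> v = p \<bullet> v"
  shows "k \<bullet> u \<le> p \<bullet> u"
proof (rule ccontr)
  assume c: "\<not> ?thesis"
  define s where "s = k \<bullet> u - p \<bullet> u"
  have s: "0 < s" using c by (simp add: s_def)
  have kp: "k = p + s *\<^sub>R u"
  proof -
    have "k - p = ((k - p) \<bullet> u) *\<^sub>R u + ((k - p) \<bullet> v) *\<^sub>R v" using uv unfolding onb_def by blast
    then show ?thesis using k by (simp add: inner_diff_left s_def algebra_simps)
  qed
  obtain t where t: "0 < t" "p - t *\<^sub>R u \<in> \<Omega>" "p \<notin> \<Omega>" using p by (auto simp: side_def frontier_eq)
  have "u \<noteq> 0" using uv by (auto simp: onb_def)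
  have "p = (1 - t / (s + t)) *\<^sub>R (p - t *\<^sub>R u) + (t / (s + t)) *\<^sub>R k"
  proof -
    have "(1 - t / (s + t)) *\<^sub>R (p - t *\<^sub>R u) + (t / (s + t)) *\<^sub>R k
       = p + ((t / (s + t)) * s - (1 - t / (s + t)) * t) *\<^sub>R u"
      unfolding kp by (simp add: algebra_simps)
    also have "(t / (s + t)) * s - (1 - t / (s + t)) * t = 0" using s t by (simp add: field_simps)
    finally show ?thesis by simp
  qed
  moreover have "p - t *\<^sub>R u \<noteq> k"
  proof
    assume "p - t *\<^sub>R u = k"
    then have "(s + t) *\<^sub>R u = 0" unfolding kp by (simp add: algebra_simps)
    then show False using s t \<open>u \<noteq> 0\<close> by simp
  qed
  ultimately have "p \<in> open_segment (p - t *\<^sub>R u) k"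
    unfolding in_segment using s t by (intro conjI exI[of _ "t / (s + t)"]) auto
  then have "p \<in> interior \<Omega>"
    using in_interior_closure_convex_segment[OF conv, of "p - t *\<^sub>R u" k] t k by (auto simp: interior_eq)
  then show False using t by (simp add: interior_eq)
qed

lemma side_height:
  assumes uv: "onb u v" and p: "p \<in> side u"
  shows "- supp (- v) < p \<bullet> v" "p \<bullet> v < supp v"
proof -
  have v0: "v \<noteq> 0" using uv by (auto simp: onb_def)
  obtain t where t: "0 < t" "p - t *\<^sub>R u \<in> \<Omega>" using p by (auto simp: side_def)
  have "(p - t *\<^sub>R u) \<bullet> v = p \<bullet> v" using uv by (simp add: onb_def inner_diff_left)
  then show "- supp (- v) < p \<bullet> v" "p \<bullet> v < supp v"
    using supp_gt[OF v0 t(2)] supp_gt[of "- v", OF _ t(2)] v0 by auto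
qed

lemma domain_height:
  assumes v: "v \<noteq> 0" and t: "- supp (- v) < t" "t < supp v"
  shows "\<exists>q\<in>\<Omega>. q \<bullet> v = t"
proof -
  have ex: "\<exists>x\<in>\<Omega>. t < x \<bullet> v" if v: "v \<noteq> 0" and "t < supp v" for t and v :: "real^2"
  proof (rule ccontr)
    assume "\<not> ?thesis"
    then have "closure \<Omega> \<subseteq> {x. v \<bullet> x \<le> t}"
      by (intro closure_minimal closed_halfspace_le) (auto simp: inner_commute not_less)
    moreover obtain p where "p \<in> frontier \<Omega>" "p \<bullet> v = supp v" using supp_attained[OF v] by blast
    ultimately show False using that by (auto simp: frontier_eq inner_commute)
  qed
  obtain x where x: "x \<in> \<Omega>" "t < x \<bullet> v" using ex[OF v t(2)] by blast
  obtain y where y: "y \<in> \<Omega>" "- t < y \<bullet> (- v)" using ex[of "- v" "- t"] v t by auto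
  have "\<exists>z\<in>\<Omega>. v \<bullet> z = t"
    using x y by (intro connected_ivt_hyperplane[OF convex_connected[OF conv] y(1) x(1)]) (auto simp: inner_commute)
  then show ?thesis by (auto simp: inner_commute)
qed

text \<open>A ray in direction \<open>u\<close> from a domain point at the given height leaves the
  bounded domain through the side.\<close>

lemma side_exists:
  assumes uv: "onb u v" and t: "- supp (- v) < t" "t < supp v"
  shows "\<exists>p\<in>side u. p \<bullet> v = t"
proof -
  have v0: "v \<noteq> 0" "u \<noteq> 0" using uv by (auto simp: onb_def)
  obtain q where q: "q \<in> \<Omega>" "q \<bullet> v = t" using domain_height[OF v0(1) t] by blast
  obtain d where d: "0 < d" "q + d *\<^sub>R u \<in> frontier \<Omega>"
    using ray_to_frontier[OF bdd, of q u] q v0 by (auto simp: interior_eq)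
  then have "q + d *\<^sub>R u \<in> side u" using q by (auto simp: side_def intro!: exI[of _ d])
  moreover have "(q + d *\<^sub>R u) \<bullet> v = t" using q uv by (simp add: onb_def inner_add_left)
  ultimately show ?thesis by blast
qed

lemma side_unique:
  assumes uv: "onb u v" and "p \<in> side u" "q \<in> side u" "p \<bullet> v = q \<bullet> v"
  shows "p = q"
proof -
  have "p \<bullet> u = q \<bullet> u"
    using side_maximal[OF uv, of p q] side_maximal[OF uv, of q p] assms by (auto simp: side_def frontier_eq)
  then show ?thesis using onb_dist[OF uv, of p q] assms by simp
qed

text \<open>At every height strictly between the extremes there is a point of the domain, and a
  frontier point at that height lies to one side of it. What remains is the top and the bottom
  segment.\<close>

lemma frontier_split:
  assumes uv: "onb u v" and p: "p \<in> frontier \<Omega>"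
  shows "p \<in> side u \<or> p \<in> side (- u) \<or> p \<bullet> v = supp v \<or> p \<bullet> v = - supp (- v)"
proof (rule ccontr)
  assume c: "\<not> ?thesis"
  have v0: "v \<noteq> 0" using uv by (auto simp: onb_def)
  have "p \<bullet> v \<le> supp v" "p \<bullet> (- v) \<le> supp (- v)"
    using p supp_ge[of p v] supp_ge[of p "- v"] by (auto simp: frontier_eq)
  then have "- supp (- v) < p \<bullet> v" "p \<bullet> v < supp v" using c by auto
  then obtain q where q: "q \<in> \<Omega>" "q \<bullet> v = p \<bullet> v" using domain_height[OF v0] by blast
  define s where "s = p \<bullet> u - q \<bullet> u"
  have qp: "q = p - s *\<^sub>R u"
  proof -
    have "q - p = ((q - p) \<bullet> u) *\<^sub>R u + ((q - p) \<bullet> v) *\<^sub>R v" using uv unfolding onb_def by blast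
    then show ?thesis using q by (simp add: inner_diff_left s_def algebra_simps)
  qed
  have "s \<noteq> 0" using qp q p by (auto simp: frontier_eq)
  then consider "0 < s" | "0 < - s" by linarith
  then show False
  proof cases
    case 1
    then have "p \<in> side u" using qp q p by (auto simp: side_def)
    then show False using c by simp
  next
    case 2
    then have "p \<in> side (- u)" using qp q p by (auto simp: side_def intro!: exI[of _ "- s"])
    then show False using c by simp
  qed
qed

text \<open>The point of the chord from \<open>p\<close> to \<open>q\<close> at height
  \<open>t\<close>. Its weight \<open>l\<close> is exposed so that coordinates in every direction
  \<open>u\<close> can be compared.\<close>

lemma convex_combination_height:
  assumes "p \<in> closure \<Omega>" "q \<in> closure \<Omega>" "p \<bullet> v \<le> t" "t \<le> q \<bullet> v"
  obtains k l where "k \<in> closure \<Omega>" "k \<bullet> v = t" "0 \<le> l" "l \<le> 1" "t = (1 - l) * (p \<bullet> v) + l * (q \<bullet> v)"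
    "\<And>u. k \<bullet> u = (1 - l) * (p \<bullet> u) + l * (q \<bullet> u)"
proof -
  obtain l where l: "0 \<le> l" "l \<le> 1" "t = (1 - l) * (p \<bullet> v) + l * (q \<bullet> v)"
  proof (cases "p \<bullet> v = q \<bullet> v")
    case True
    then show thesis using assms by (intro that[of 0]) auto
  next
    case False
    then have pos: "0 < q \<bullet> v - p \<bullet> v" using assms by simp
    define l where "l = (t - p \<bullet> v) / (q \<bullet> v - p \<bullet> v)"
    have "l * (q \<bullet> v - p \<bullet> v) = t - p \<bullet> v" using pos by (simp add: l_def)
    then have "t = (1 - l) * (p \<bullet> v) + l * (q \<bullet> v)" by (simp add: algebra_simps)
    then show thesis using assms pos by (intro that[of l]) (auto simp: l_def)
  qed
  have "(1 - l) *\<^sub>R p + l *\<^sub>R q \<in> closure \<Omega>"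
    using l assms by (intro convexD[OF convex_closure[OF conv]]) auto
  then show thesis using l by (intro that[of "(1 - l) *\<^sub>R p + l *\<^sub>R q" l]) (auto simp: inner_add_left)
qed

text \<open>The side is the graph of a concave function of the height, increasing below the height of its
  maximum \<open>m\<close>, so its increments shrink when the heights are shifted upwards.\<close>

lemma side_shift_contracts:
  assumes uv: "onb u v" and in_side: "p \<in> side u" "p' \<in> side u" "q \<in> side u" "q' \<in> side u"
    and q: "q \<bullet> v = p \<bullet> v + s" "q' \<bullet> v = p' \<bullet> v + s" and s: "0 < s"
    and m: "m \<in> closure \<Omega>" "\<And>k. k \<in> closure \<Omega> \<Longrightarrow> k \<bullet> u \<le> m \<bullet> u" and h: "q \<bullet> v \<le> m \<bullet> v" "q' \<bullet> v \<le> m \<bullet> v"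
  shows "dist q q' \<le> dist p p'"
proof -
  have cl: "x \<in> closure \<Omega>" if "x \<in> side u" for x using that by (auto simp: side_def frontier_eq)
  \<comment> \<open>Up to the height of \<open>m\<close> the graph increases, since the chord from
    \<open>x\<close> to the maximizer \<open>m\<close> does not descend and stays below the
    graph.\<close>
  have mono: "x \<bullet> u \<le> y \<bullet> u" if xy: "x \<in> side u" "y \<in> side u" "x \<bullet> v \<le> y \<bullet> v" "y \<bullet> v \<le> m \<bullet> v" for x y
  proof -
    obtain k l where k: "k \<in> closure \<Omega>" "k \<bullet> v = y \<bullet> v" "0 \<le> l" "l \<le> 1"
        "\<And>u. k \<bullet> u = (1 - l) * (x \<bullet> u) + l * (m \<bullet> u)"
      using convex_combination_height[OF cl[OF xy(1)] m(1) xy(3,4)] by metis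
    have "x \<bullet> u = (1 - l) * (x \<bullet> u) + l * (x \<bullet> u)" by (simp add: algebra_simps)
    also have "\<dots> \<le> k \<bullet> u"
      unfolding k(5) using m(2)[OF cl[OF xy(1)]] k by (intro add_left_mono mult_left_mono) auto
    also have "\<dots> \<le> y \<bullet> u" by (rule side_maximal[OF uv xy(2) k(1,2)])
    finally show ?thesis .
  qed
  have main: "\<bar>y \<bullet> u - y' \<bullet> u\<bar> \<le> \<bar>x \<bullet> u - x' \<bullet> u\<bar>"
    if in_side: "x \<in> side u" "x' \<in> side u" "y \<in> side u" "y' \<in> side u" and le: "x \<bullet> v \<le> x' \<bullet> v"
      and y: "y \<bullet> v = x \<bullet> v + s" "y' \<bullet> v = x' \<bullet> v + s" "y \<bullet> v \<le> m \<bullet> v" "y' \<bullet> v \<le> m \<bullet> v" for x x' y y'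
  proof -
    have "x \<bullet> u \<le> x' \<bullet> u" "y \<bullet> u \<le> y' \<bullet> u" using that s by (auto intro!: mono)
    \<comment> \<open>Concavity at four points: the chord from \<open>x\<close> to \<open>y'\<close>
      is evaluated at the heights of \<open>x'\<close> and \<open>y\<close>. As these heights have
      the same sum as those of \<open>x\<close> and \<open>y'\<close>, the weights are
      \<open>l\<close> and \<open>1 - l\<close>, and the two chord values add up to the left-hand
      side; the side lies above the chord.\<close>
    moreover have "x \<bullet> u + y' \<bullet> u \<le> x' \<bullet> u + y \<bullet> u"
    proof -
      obtain k l where k: "k \<in> closure \<Omega>" "k \<bullet> v = x' \<bullet> v" "x' \<bullet> v = (1 - l) * (x \<bullet> v) + l * (y' \<bullet> v)"
          "\<And>u. k \<bullet> u = (1 - l) * (x \<bullet> u) + l * (y' \<bullet> u)"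
        using convex_combination_height[OF cl[OF in_side(1)] cl[OF in_side(4)] le] y(2) s
        by (metis add_increasing2 less_imp_le order_refl)
      obtain k' l' where k': "k' \<in> closure \<Omega>" "k' \<bullet> v = y \<bullet> v" "y \<bullet> v = (1 - l') * (x \<bullet> v) + l' * (y' \<bullet> v)"
          "\<And>u. k' \<bullet> u = (1 - l') * (x \<bullet> u) + l' * (y' \<bullet> u)"
        using convex_combination_height[OF cl[OF in_side(1)] cl[OF in_side(4)], of v "y \<bullet> v"] y le s
        by (metis add_right_mono add_increasing2 less_imp_le order_refl)
      have "(l + l' - 1) * (y' \<bullet> v - x \<bullet> v) = 0"
        using k(3) k'(3) y by (simp add: algebra_simps)
      moreover have "y' \<bullet> v - x \<bullet> v > 0" using y le s by simp
      ultimately have l': "l' = 1 - l" by simp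
      have "x \<bullet> u + y' \<bullet> u = k \<bullet> u + k' \<bullet> u" unfolding k(4) k'(4) l' by (simp add: algebra_simps)
      also have "\<dots> \<le> x' \<bullet> u + y \<bullet> u"
        by (intro add_mono side_maximal[OF uv] in_side k k')
      finally show ?thesis .
    qed
    ultimately show ?thesis by linarith
  qed
  have "\<bar>q \<bullet> u - q' \<bullet> u\<bar> \<le> \<bar>p \<bullet> u - p' \<bullet> u\<bar>"
  proof (cases "p \<bullet> v \<le> p' \<bullet> v")
    case True
    then show ?thesis using main[of p p' q q'] in_side q h by simp
  next
    case False
    then show ?thesis using main[of p' p q' q] in_side q h by (simp add: abs_minus_commute)
  qed
  then have "(q \<bullet> u - q' \<bullet> u)\<^sup>2 \<le> (p \<bullet> u - p' \<bullet> u)\<^sup>2" by (simp add: abs_le_square_iff)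
  then have "(dist q q')\<^sup>2 \<le> (dist p p')\<^sup>2" unfolding onb_dist[OF uv] using q by simp
  then show ?thesis by (simp add: power2_le_iff_abs_le)
qed

text \<open>The map \<open>f\<close> moves a point of the side down by height \<open>s\<close>. It
  is injective because a side point is determined by its height, and its inverse, moving up, is the
  contraction.\<close>

lemma H1_side_shift:
  assumes uv: "onb u v" and m: "m \<in> closure \<Omega>" "\<And>k. k \<in> closure \<Omega> \<Longrightarrow> k \<bullet> u \<le> m \<bullet> u"
    and s: "0 < s" and E: "\<And>t. t \<in> E \<Longrightarrow> - supp (- v) < t \<and> t < supp v \<and> t + s \<le> m \<bullet> v"
  shows "H1 {p \<in> side u. p \<bullet> v \<in> (\<lambda>t. t + s) ` E} \<le> H1 {p \<in> side u. p \<bullet> v \<in> E}"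
proof -
  let ?A = "{p \<in> side u. p \<bullet> v \<in> E}" and ?B = "{p \<in> side u. p \<bullet> v \<in> (\<lambda>t. t + s) ` E}"
  have "\<exists>p\<in>?A. p \<bullet> v + s = q \<bullet> v" if "q \<in> ?B" for q
  proof -
    from that obtain t where t: "t \<in> E" "q \<bullet> v = t + s" by blast
    then obtain p where "p \<in> side u" "p \<bullet> v = t" using side_exists[OF uv] E by blast
    then show ?thesis using t by auto
  qed
  then have "\<forall>q\<in>?B. \<exists>p. p \<in> ?A \<and> p \<bullet> v + s = q \<bullet> v" by blast
  from bchoice[OF this] obtain f where f: "\<And>q. q \<in> ?B \<Longrightarrow> f q \<in> ?A \<and> f q \<bullet> v + s = q \<bullet> v" by blast
  have inj: "inj_on f ?B"
  proof (rule inj_onI)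
    fix x y assume "x \<in> ?B" "y \<in> ?B" "f x = f y"
    then show "x = y" using f[of x] f[of y] by (intro side_unique[OF uv]) auto
  qed
  have "H1 ?B = H1 (inv_into ?B f ` (f ` ?B))" using inj by simp
  also have "\<dots> \<le> H1 (f ` ?B)"
  proof (rule H1_image_le)
    fix x y assume "x \<in> f ` ?B" "y \<in> f ` ?B"
    then obtain x' y' where xy: "x = f x'" "x' \<in> ?B" "y = f y'" "y' \<in> ?B" by blast
    have "dist x' y' \<le> dist x y"
      using xy f[OF xy(2)] f[OF xy(4)] E s
      by (intro side_shift_contracts[OF uv _ _ _ _ _ _ s m]) auto
    then show "dist (inv_into ?B f x) (inv_into ?B f y) \<le> dist x y"
      using xy inj by (simp add: inv_into_f_f)
  qed
  also have "\<dots> \<le> H1 ?A" using f by (intro H1_mono) blast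
  finally show ?thesis .
qed

text \<open>The image of arclength on the arc under the height function is a decreasing measure by
  \<open>H1_side_shift\<close>. The heights at most \<open>- supp (- v) + s\<close> that survive
  belong to the cap at the lowest point, which is the cap of \<open>- v\<close>.\<close>

lemma side_oscillatory:
  assumes uv: "onb u v" and m: "m \<in> closure \<Omega>" "\<And>k. k \<in> closure \<Omega> \<Longrightarrow> k \<bullet> u \<le> m \<bullet> u"
    and J[measurable]: "J \<in> sets borel" and J_sub: "\<And>t. t \<in> J \<Longrightarrow> - supp (- v) < t \<and> t < supp v \<and> t \<le> m \<bullet> v"
    and down: "\<And>t t'. t \<in> J \<Longrightarrow> - supp (- v) < t' \<Longrightarrow> t' \<le> t \<Longrightarrow> t' \<in> J"
    and s: "0 < s" and rs: "\<bar>r\<bar> * s = pi"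
  shows "cmod (\<integral>p. indicator {p \<in> side u. p \<bullet> v \<in> J} p *\<^sub>R cis (r * (p \<bullet> v)) \<partial>\<sigma>) \<le> cap_mass (- v) s"
proof -
  let ?A = "{p \<in> side u. p \<bullet> v \<in> J}"
  have A[measurable]: "?A \<in> sets borel" by measurable
  define \<mu> where "\<mu> = distr (density \<sigma> (\<lambda>p. ennreal (indicator ?A p))) borel (\<lambda>p. p \<bullet> v)"
  have side_sub: "side u \<subseteq> frontier \<Omega>" by (auto simp: side_def)
  have em: "emeasure \<mu> E = H1 {p \<in> side u. p \<bullet> v \<in> E \<inter> J}" if [measurable]: "E \<in> sets borel" for E
  proof -
    have [measurable]: "(\<lambda>p. p \<bullet> v) -` E \<in> sets borel"
      using measurable_sets[of "\<lambda>p. p \<bullet> v" borel borel E] by simp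
    have "emeasure \<mu> E = (\<integral>\<^sup>+p. indicator ?A p * indicator ((\<lambda>p. p \<bullet> v) -` E) p \<partial>\<sigma>)"
      unfolding \<mu>_def by (simp add: emeasure_distr emeasure_density ennreal_indicator)
    also have "\<dots> = (\<integral>\<^sup>+p. indicator {p \<in> side u. p \<bullet> v \<in> E \<inter> J} p \<partial>\<sigma>)"
      by (intro nn_integral_cong) (auto simp: indicator_def)
    also have "\<dots> = emeasure \<sigma> {p \<in> side u. p \<bullet> v \<in> E \<inter> J}"
      by (intro nn_integral_indicator) simp
    also have "\<dots> = H1 ({p \<in> side u. p \<bullet> v \<in> E \<inter> J} \<inter> frontier \<Omega>)"
      by (intro emeasure_arclength) measurable
    also have "{p \<in> side u. p \<bullet> v \<in> E \<inter> J} \<inter> frontier \<Omega> = {p \<in> side u. p \<bullet> v \<in> E \<inter> J}"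
      using side_sub by blast
    finally show ?thesis .
  qed
  have "cmod (\<integral>t. cis (r * t) \<partial>\<mu>) \<le> measure \<mu> {..- supp (- v) + s}"
  proof (rule oscillatory_decreasing_measure[OF _ _ J _ _ _ s rs])
    show "finite_measure \<mu>"
    proof (rule finite_measureI)
      have "emeasure \<mu> UNIV \<le> H1 (frontier \<Omega>)" using side_sub by (subst em) (auto intro!: H1_mono)
      then show "emeasure \<mu> (space \<mu>) \<noteq> \<infinity>" using H1_frontier_finite by (auto simp: \<mu>_def top_unique)
    qed
    show "sets \<mu> = sets borel" by (simp add: \<mu>_def)
    show "emeasure \<mu> (- J) = 0" by (subst em) auto
    fix E assume E: "E \<in> sets borel" "E \<subseteq> J" "(\<lambda>t. t + s) ` E \<subseteq> J"
    note borel_shift_image[OF E(1), measurable]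
    have "H1 {p \<in> side u. p \<bullet> v \<in> (\<lambda>t. t + s) ` E} \<le> H1 {p \<in> side u. p \<bullet> v \<in> E}"
      using E J_sub by (intro H1_side_shift[OF uv m s]) blast+
    then show "emeasure \<mu> ((\<lambda>t. t + s) ` E) \<le> emeasure \<mu> E"
      using E by (simp add: em Int_absorb2)
  qed (use J_sub down in blast)+
  moreover have "(\<integral>t. cis (r * t) \<partial>\<mu>) = (\<integral>p. indicator ?A p *\<^sub>R cis (r * (p \<bullet> v)) \<partial>\<sigma>)"
  proof -
    have "(\<integral>t. cis (r * t) \<partial>\<mu>) = (\<integral>p. cis (r * (p \<bullet> v)) \<partial>density \<sigma> (\<lambda>p. ennreal (indicator ?A p)))"
      unfolding \<mu>_def by (intro integral_distr) measurable
    also have "\<dots> = (\<integral>p. indicator ?A p *\<^sub>R cis (r * (p \<bullet> v)) \<partial>\<sigma>)"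
      by (intro integral_density) auto
    finally show ?thesis .
  qed
  moreover have "measure \<mu> {..- supp (- v) + s} \<le> cap_mass (- v) s"
  proof -
    have "emeasure \<mu> {..- supp (- v) + s} \<le> emeasure \<sigma> {y \<in> frontier \<Omega>. supp (- v) - s \<le> y \<bullet> (- v)}"
      using side_sub by (subst em, simp, subst emeasure_arclength) (auto intro!: H1_mono)
    then show ?thesis unfolding cap_mass_def measure_def
      by (intro enn2real_mono) (auto simp: less_top[symmetric])
  qed
  ultimately show ?thesis by simp
qed

end

lemma cball_borel [measurable]: "cball (a::'a::euclidean_space) r \<in> sets borel"
  by (simp add: borel_closed)

section \<open>Decay of the Fourier transform of arclength\<close>

context convex_domain
begin

lemma Lambda_ge: "norm v = 1 \<Longrightarrow> cap_mass v d \<le> Lambda \<Omega> v d" "norm v = 1 \<Longrightarrow> cap_mass (- v) d \<le> Lambda \<Omega> v d"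
  by (simp_all add: Lambda_eq)

lemma Lambda_nonneg: "norm v = 1 \<Longrightarrow> 0 \<le> Lambda \<Omega> v d"
  by (simp add: Lambda_eq le_max_iff_disj)

lemma Lambda_mono: "norm v = 1 \<Longrightarrow> d \<le> e \<Longrightarrow> Lambda \<Omega> v d \<le> Lambda \<Omega> v e"
  unfolding Lambda_eq by (intro max.mono cap_mass_mono)

lemma Lambda_le: "norm v = 1 \<Longrightarrow> Lambda \<Omega> v d \<le> measure \<sigma> UNIV"
  by (simp add: Lambda_eq cap_mass_le)

lemma maximizer_exists:
  assumes "u \<noteq> 0"
  shows "\<exists>m\<in>closure \<Omega>. \<forall>k\<in>closure \<Omega>. k \<bullet> u \<le> m \<bullet> u"
proof -
  obtain p where "p \<in> frontier \<Omega>" "p \<bullet> u = supp u" using supp_attained[OF assms] by blast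
  then show ?thesis using supp_ge[of _ u] by (intro bexI[of _ p]) (auto simp: frontier_eq)
qed

text \<open>The constant counts six pieces: each side is cut at the height of its extreme point into
  two monotone arcs, and the top and bottom segments \<open>T\<close> and \<open>B\<close> are
  estimated by their lengths.\<close>

lemma arclength_fourier_decay:
  assumes v: "norm v = 1" and s: "0 < s" and rs: "\<bar>r\<bar> * s = pi"
  shows "cmod (\<integral>p. cis (r * (p \<bullet> v)) \<partial>\<sigma>) \<le> 6 * Lambda \<Omega> v s"
proof -
  define u where "u = perp v"
  have uv: "onb u v" unfolding u_def by (rule onb_perp[OF v])
  have u0: "u \<noteq> 0" "v \<noteq> 0" using uv by (auto simp: onb_def)
  obtain m where m: "m \<in> closure \<Omega>" "\<And>k. k \<in> closure \<Omega> \<Longrightarrow> k \<bullet> u \<le> m \<bullet> u"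
    using maximizer_exists[OF u0(1)] by blast
  obtain n where n: "n \<in> closure \<Omega>" "\<And>k. k \<in> closure \<Omega> \<Longrightarrow> k \<bullet> (- u) \<le> n \<bullet> (- u)"
    using maximizer_exists[of "- u"] u0 by auto
  \<comment> \<open>The cut height itself is given to \<open>J1\<close> and \<open>J3\<close>; the
    strict inequalities in \<open>J2\<close> and \<open>J4\<close> keep the arcs disjoint.\<close>
  define J1 J2 J3 J4 where
    "J1 = {t. - supp (- v) < t \<and> t < supp v \<and> t \<le> m \<bullet> v}" and
    "J2 = {t. - supp (- (- v)) < t \<and> t < supp (- v) \<and> t < m \<bullet> (- v)}" and
    "J3 = {t. - supp (- v) < t \<and> t < supp v \<and> t \<le> n \<bullet> v}" and
    "J4 = {t. - supp (- (- v)) < t \<and> t < supp (- v) \<and> t < n \<bullet> (- v)}"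
  have [measurable]: "J1 \<in> sets borel" "J2 \<in> sets borel" "J3 \<in> sets borel" "J4 \<in> sets borel"
    unfolding J1_def J2_def J3_def J4_def by measurable
  define A1 A2 A3 A4 T B where
    "A1 = {p \<in> side u. p \<bullet> v \<in> J1}" and "A2 = {p \<in> side u. p \<bullet> (- v) \<in> J2}" and
    "A3 = {p \<in> side (- u). p \<bullet> v \<in> J3}" and "A4 = {p \<in> side (- u). p \<bullet> (- v) \<in> J4}" and
    "T = {p \<in> frontier \<Omega>. p \<bullet> v = supp v}" and "B = {p \<in> frontier \<Omega>. p \<bullet> v = - supp (- v)}"
  have fr [measurable]: "frontier \<Omega> \<in> sets borel" by (simp add: borel_closed)
  have [measurable]: "A1 \<in> sets borel" "A2 \<in> sets borel" "A3 \<in> sets borel" "A4 \<in> sets borel"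
      "T \<in> sets borel" "B \<in> sets borel"
    unfolding A1_def A2_def A3_def A4_def T_def B_def by measurable
  define I where "I A = (\<integral>p. indicator A p *\<^sub>R cis (r * (p \<bullet> v)) \<partial>\<sigma>)" for A
  have ii: "integrable \<sigma> (\<lambda>p. indicator A p *\<^sub>R cis (r * (p \<bullet> v)))" if [measurable]: "A \<in> sets borel" for A
    by (rule arc.integrable_const_bound[of _ 1]) (auto simp: indicator_def)
  have rs': "\<bar>- r\<bar> * s = pi" using rs by simp
  have i1: "cmod (I A1) \<le> cap_mass (- v) s"
    unfolding I_def A1_def by (rule side_oscillatory[OF uv m _ _ _ s rs]) (auto simp: J1_def)
  have i3: "cmod (I A3) \<le> cap_mass (- v) s"
    unfolding I_def A3_def by (rule side_oscillatory[OF onb_uminus(1)[OF uv] n _ _ _ s rs]) (auto simp: J3_def)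
  \<comment> \<open>Above the maximum the side increases downwards, so heights are taken along
    \<open>- v\<close>. Changing the sign of \<open>r\<close> as well leaves the oscillating factor
    unchanged.\<close>
  have i2: "cmod (I A2) \<le> cap_mass v s"
  proof -
    have "cmod (\<integral>p. indicator {p \<in> side u. p \<bullet> (- v) \<in> J2} p *\<^sub>R cis ((- r) * (p \<bullet> (- v))) \<partial>\<sigma>) \<le> cap_mass (- (- v)) s"
      by (rule side_oscillatory[OF onb_uminus(2)[OF uv] m _ _ _ s rs']) (auto simp: J2_def)
    then show ?thesis by (simp add: I_def A2_def)
  qed
  have i4: "cmod (I A4) \<le> cap_mass v s"
  proof -
    have "cmod (\<integral>p. indicator {p \<in> side (- u). p \<bullet> (- v) \<in> J4} p *\<^sub>R cis ((- r) * (p \<bullet> (- v))) \<partial>\<sigma>) \<le> cap_mass (- (- v)) s"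
      by (rule side_oscillatory[OF onb_uminus(2)[OF onb_uminus(1)[OF uv]] n _ _ _ s rs']) (auto simp: J4_def)
    then show ?thesis by (simp add: I_def A4_def)
  qed
  have I_le: "cmod (I A) \<le> measure \<sigma> A" if [measurable]: "A \<in> sets borel" for A
  proof -
    have "cmod (I A) \<le> (\<integral>p. cmod (indicator A p *\<^sub>R cis (r * (p \<bullet> v))) \<partial>\<sigma>)" unfolding I_def by (rule integral_norm_bound)
    also have "\<dots> = measure \<sigma> A" by simp
    finally show ?thesis .
  qed
  have iT: "cmod (I T) \<le> cap_mass v s"
    using s unfolding cap_mass_def by (intro order_trans[OF I_le] arc.finite_measure_mono) (auto simp: T_def)
  have iB: "cmod (I B) \<le> cap_mass (- v) s"
    using s unfolding cap_mass_def by (intro order_trans[OF I_le] arc.finite_measure_mono) (auto simp: B_def)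
  have split: "indicator A1 p + indicator A2 p + indicator A3 p + indicator A4 p + indicator T p + indicator B p = (1::real)"
    if p: "p \<in> frontier \<Omega>" for p
  proof -
    have pos: "0 < supp v" "0 < supp (- v)" using supp_pos u0 by auto
    consider "p \<in> side u" | "p \<in> side (- u)" | "p \<in> T" "p \<notin> side u" "p \<notin> side (- u)" | "p \<in> B" "p \<notin> side u" "p \<notin> side (- u)"
      using frontier_split[OF uv p] p by (auto simp: T_def B_def)
    then show ?thesis
    proof cases
      case 1
      then have "p \<notin> side (- u)" using side_disjoint[of u] by blast
      then show ?thesis using 1 side_height[OF uv 1]
        by (auto simp: indicator_def A1_def A2_def A3_def A4_def T_def B_def J1_def J2_def)
    next
      case 2
      then have "p \<notin> side u" using side_disjoint[of u] by blast
      then show ?thesis using 2 side_height[OF onb_uminus(1)[OF uv] 2]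
        by (auto simp: indicator_def A1_def A2_def A3_def A4_def T_def B_def J3_def J4_def)
    next
      case 3
      then show ?thesis using pos by (auto simp: indicator_def A1_def A2_def A3_def A4_def T_def B_def)
    next
      case 4
      then show ?thesis using pos by (auto simp: indicator_def A1_def A2_def A3_def A4_def T_def B_def)
    qed
  qed
  have "(\<integral>p. cis (r * (p \<bullet> v)) \<partial>\<sigma>) = (\<integral>p. indicator A1 p *\<^sub>R cis (r * (p \<bullet> v)) + indicator A2 p *\<^sub>R cis (r * (p \<bullet> v))
     + indicator A3 p *\<^sub>R cis (r * (p \<bullet> v)) + indicator A4 p *\<^sub>R cis (r * (p \<bullet> v))
     + indicator T p *\<^sub>R cis (r * (p \<bullet> v)) + indicator B p *\<^sub>R cis (r * (p \<bullet> v)) \<partial>\<sigma>)"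
  proof (rule integral_cong_AE)
    show "AE p in \<sigma>. cis (r * (p \<bullet> v)) = indicator A1 p *\<^sub>R cis (r * (p \<bullet> v)) + indicator A2 p *\<^sub>R cis (r * (p \<bullet> v))
     + indicator A3 p *\<^sub>R cis (r * (p \<bullet> v)) + indicator A4 p *\<^sub>R cis (r * (p \<bullet> v))
     + indicator T p *\<^sub>R cis (r * (p \<bullet> v)) + indicator B p *\<^sub>R cis (r * (p \<bullet> v))"
      using AE_frontier by eventually_elim (simp add: split flip: scaleR_add_left)
  qed measurable
  also have "\<dots> = I A1 + I A2 + I A3 + I A4 + I T + I B"
    unfolding I_def using ii by simp
  finally have "cmod (\<integral>p. cis (r * (p \<bullet> v)) \<partial>\<sigma>) \<le> cmod (I A1) + cmod (I A2) + cmod (I A3) + cmod (I A4) + cmod (I T) + cmod (I B)"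
    by (auto intro!: order_trans[OF norm_triangle_ineq] add_mono)
  then show ?thesis
    using i1 i2 i3 i4 iT iB Lambda_ge[OF v, of s] by linarith
qed

definition sigma_hat :: "real^2 \<Rightarrow> complex" where
  "sigma_hat \<xi> = (\<integral>p. cis (\<xi> \<bullet> p) \<partial>\<sigma>)"

lemma sigma_hat_decay:
  assumes "\<xi> \<noteq> 0"
  shows "cmod (sigma_hat \<xi>) \<le> 6 * Lambda \<Omega> (\<xi> /\<^sub>R norm \<xi>) (pi / norm \<xi>)"
proof -
  have "\<xi> \<bullet> p = norm \<xi> * (p \<bullet> (\<xi> /\<^sub>R norm \<xi>))" for p using assms by (simp add: inner_commute)
  then show ?thesis
    unfolding sigma_hat_def using arclength_fourier_decay[of "\<xi> /\<^sub>R norm \<xi>" "pi / norm \<xi>" "norm \<xi>"] assms by simp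
qed

end

section \<open>Low frequencies, and the Fourier transform of the disc\<close>

lemma cis_minus_one_le: "cmod (cis t - 1) \<le> \<bar>t\<bar>"
proof -
  have "cmod (cis t - 1) = cmod (iexp t - 1)" by (simp add: cis_conv_exp)
  also have "\<dots> \<le> \<bar>t\<bar>"
    using iexp_approx1[of t 0] by simp
  finally show ?thesis .
qed

lemma fourier_near_zero:
  fixes M :: "'a::euclidean_space measure"
  assumes M: "finite_measure M" and [measurable_cong]: "sets M = sets borel" and D: "AE y in M. norm y \<le> D"
  shows "cmod ((\<integral>y. cis (\<xi> \<bullet> y) \<partial>M) - complex_of_real (measure M (space M))) \<le> measure M (space M) * (D * norm \<xi>)"
proof -
  interpret finite_measure M by fact
  have i: "integrable M (\<lambda>y. cis (\<xi> \<bullet> y))" by (rule integrable_const_bound[of _ 1]) auto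
  have "(\<integral>y. cis (\<xi> \<bullet> y) \<partial>M) - complex_of_real (measure M (space M)) = (\<integral>y. cis (\<xi> \<bullet> y) - 1 \<partial>M)"
    using i by simp (simp add: scaleR_conv_of_real)
  also have "cmod \<dots> \<le> (\<integral>y. cmod (cis (\<xi> \<bullet> y) - 1) \<partial>M)" by (rule integral_norm_bound)
  also have "\<dots> \<le> (\<integral>y. D * norm \<xi> \<partial>M)"
  proof (rule integral_mono_AE)
    show "integrable M (\<lambda>y. cmod (cis (\<xi> \<bullet> y) - 1))" using i by auto
    show "AE y in M. cmod (cis (\<xi> \<bullet> y) - 1) \<le> D * norm \<xi>"
      using D
    proof eventually_elim
      case (elim y)
      have "cmod (cis (\<xi> \<bullet> y) - 1) \<le> \<bar>\<xi> \<bullet> y\<bar>" by (rule cis_minus_one_le)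
      also have "\<dots> \<le> norm \<xi> * norm y" by (rule Cauchy_Schwarz_ineq2)
      also have "\<dots> \<le> D * norm \<xi>" using mult_right_mono[OF elim norm_ge_zero[of \<xi>]] by (simp add: mult.commute)
      finally show ?case .
    qed
  qed auto
  finally show ?thesis by simp
qed

definition unit_ball_measure :: "(real^2) measure" where
  "unit_ball_measure = uniform_measure lborel (cball 0 1)"

definition ball_hat :: "real^2 \<Rightarrow> complex" where
  "ball_hat \<xi> = (\<integral>y. cis (\<xi> \<bullet> y) \<partial>unit_ball_measure)"

lemma sets_unit_ball_measure [simp, measurable_cong]: "sets unit_ball_measure = sets borel"
  and space_unit_ball_measure [simp]: "space unit_ball_measure = UNIV"
  by (simp_all add: unit_ball_measure_def)

lemma prob_space_unit_ball_measure: "prob_space unit_ball_measure"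
  unfolding unit_ball_measure_def by (rule prob_space_uniform_ball)

lemma AE_unit_ball_measure: "AE y in unit_ball_measure. norm y \<le> 1"
  unfolding unit_ball_measure_def
  using ball_vol_pos[where 'a="real^2"] by (intro AE_uniform_measureI) (auto simp: emeasure_unit_cball)

lemma integral_unit_ball_measure:
  assumes [measurable]: "f \<in> borel_measurable borel"
  shows "integral\<^sup>L unit_ball_measure f = (\<integral>y. indicator (cball 0 1) y *\<^sub>R (f y :: complex) \<partial>lborel) /\<^sub>R ball_vol TYPE(real^2)"
proof -
  let ?V = "ball_vol TYPE(real^2)"
  have V: "0 < ?V" by (rule ball_vol_pos)
  have "unit_ball_measure = density lborel (\<lambda>y. ennreal (indicator (cball 0 1) y / ?V))"
    unfolding unit_ball_measure_def uniform_measure_def emeasure_unit_cball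
    using V by (intro density_cong borel_measurable_divide_ennreal borel_measurable_indicator
        measurable_compose[OF _ measurable_ennreal] borel_measurable_divide)
      (auto simp: divide_ennreal[symmetric] ennreal_indicator)
  then have "integral\<^sup>L unit_ball_measure f = (\<integral>y. f y \<partial>density lborel (\<lambda>y. ennreal (indicator (cball 0 1) y / ?V)))"
    by simp
  also have "\<dots> = (\<integral>y. (indicator (cball 0 1) y / ?V) *\<^sub>R f y \<partial>lborel)"
    using V by (intro integral_density) (simp_all, measurable)
  also have "\<dots> = (\<integral>y. (1 / ?V) *\<^sub>R (indicator (cball 0 1) y *\<^sub>R f y) \<partial>lborel)"
    by simp
  finally show ?thesis by (simp only: integral_scaleR_right inverse_eq_divide)
qed

text \<open>Shifting by the vector \<open>h\<close> of length \<open>x = pi / norm \<xi>\<close>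
  along \<open>\<xi>\<close> changes the sign of the integrand, so twice the integral is an integral
  over the symmetric difference of two discs. That set lies in the annulus between
  \<open>1 - x\<close> and \<open>1 + x\<close>, of area \<open>4 * x\<close> times that of the
  disc. For \<open>x > 1\<close> the trivial bound 1 suffices.\<close>

lemma ball_hat_decay:
  assumes "\<xi> \<noteq> 0"
  shows "cmod (ball_hat \<xi>) \<le> 2 * pi / norm \<xi>"
proof -
  interpret prob_space unit_ball_measure by (rule prob_space_unit_ball_measure)
  let ?V = "ball_vol TYPE(real^2)" and ?B = "cball (0::real^2) 1"
  have V: "0 < ?V" by (rule ball_vol_pos)
  define x where "x = pi / norm \<xi>"
  have x: "0 < x" using assms by (simp add: x_def)
  show ?thesis
  proof (cases "x \<le> 1")
    case False
    have "cmod (ball_hat \<xi>) \<le> (\<integral>y. cmod (cis (\<xi> \<bullet> y)) \<partial>unit_ball_measure)"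
      unfolding ball_hat_def by (rule integral_norm_bound)
    also have "\<dots> = 1" using prob_space by simp
    also have "\<dots> \<le> 2 * x" using False by simp
    finally show ?thesis by (simp add: x_def)
  next
    case True
    define h where "h = x *\<^sub>R (\<xi> /\<^sub>R norm \<xi>)"
    have nh: "norm h = x" using assms x by (simp add: h_def)
    have xh: "\<xi> \<bullet> h = pi" using assms by (simp add: h_def x_def power2_norm_eq_inner[symmetric] power2_eq_square)
    define f where "f y = cis (\<xi> \<bullet> y)" for y
    have [measurable]: "f \<in> borel_measurable borel" unfolding f_def by measurable
    have fh: "f (y + h) = - f y" for y
      unfolding f_def by (simp add: inner_add_right xh flip: cis_mult)
    define I where "I = (\<integral>y. indicator ?B y *\<^sub>R f y \<partial>lborel)"
    have bfin: "emeasure lborel (cball a r) < \<infinity>" for a :: "real^2" and r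
      by (rule emeasure_bounded_finite) simp
    have ii: "integrable lborel (\<lambda>y. indicator (cball a 1) y *\<^sub>R f y)" for a
      using bfin[of a 1] by (intro Bochner_Integration.integrable_bound[OF integrable_real_indicator[of "cball a 1" lborel]])
        (auto simp: indicator_def f_def)
    have "I = (\<integral>y. indicator ?B (- h + y) *\<^sub>R f (- h + y) \<partial>lborel)"
    proof -
      have [measurable]: "(\<lambda>y. indicator ?B y *\<^sub>R f y) \<in> borel_measurable borel" by measurable
      show ?thesis
        unfolding I_def using integral_lborel_affine[of "\<lambda>y. indicator ?B y *\<^sub>R f y" 1 "- h"] by simp
    qed
    also have "\<dots> = (\<integral>y. - (indicator (cball h 1) y *\<^sub>R f y) \<partial>lborel)"
    proof (intro Bochner_Integration.integral_cong refl)
      fix y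
      have "f y = - f (- h + y)" using fh[of "- h + y"] by simp
      then show "indicator ?B (- h + y) *\<^sub>R f (- h + y) = - (indicator (cball h 1) y *\<^sub>R f y)"
        by (auto simp: indicator_def dist_norm norm_minus_commute)
    qed
    finally have "2 * I = I + (\<integral>y. - (indicator (cball h 1) y *\<^sub>R f y) \<partial>lborel)" by simp
    also have "\<dots> = (\<integral>y. indicator ?B y *\<^sub>R f y - indicator (cball h 1) y *\<^sub>R f y \<partial>lborel)"
      unfolding I_def using ii by (simp add: ii[of 0])
    finally have "2 * cmod I = cmod (\<integral>y. indicator ?B y *\<^sub>R f y - indicator (cball h 1) y *\<^sub>R f y \<partial>lborel)"
      by (metis norm_mult norm_numeral)
    also have "\<dots> \<le> (\<integral>y. cmod (indicator ?B y *\<^sub>R f y - indicator (cball h 1) y *\<^sub>R f y) \<partial>lborel)"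
      by (rule integral_norm_bound)
    also have "\<dots> \<le> (\<integral>y. indicator (cball 0 (1 + x) - ball (0::real^2) (1 - x)) y \<partial>lborel)"
    proof (rule integral_mono)
      show "integrable lborel (\<lambda>y. cmod (indicator ?B y *\<^sub>R f y - indicator (cball h 1) y *\<^sub>R f y))"
        using ii by auto
      have "emeasure lborel (cball 0 (1 + x) - ball (0::real^2) (1 - x)) \<le> emeasure lborel (cball (0::real^2) (1 + x))"
        by (intro emeasure_mono) auto
      then show "integrable lborel (indicator (cball 0 (1 + x) - ball (0::real^2) (1 - x)) :: _ \<Rightarrow> real)"
        using bfin[of 0 "1 + x"] by (intro integrable_real_indicator) (auto intro: le_less_trans)
      fix y
      have "norm y \<le> norm (y - h) + x" "norm (y - h) \<le> norm y + x"
        using norm_triangle_ineq[of "y - h" h] norm_triangle_ineq4[of y h] nh by auto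
      then show "cmod (indicator ?B y *\<^sub>R f y - indicator (cball h 1) y *\<^sub>R f y)
         \<le> indicator (cball 0 (1 + x) - ball 0 (1 - x)) y"
        using x by (auto simp: indicator_def f_def dist_norm norm_minus_commute)
    qed
    also have "\<dots> = measure lborel (cball 0 (1 + x) - ball (0::real^2) (1 - x))" by simp
    also have "\<dots> = measure lborel (cball (0::real^2) (1 + x)) - measure lborel (ball (0::real^2) (1 - x))"
    proof (rule measure_Diff)
      show "emeasure lborel (cball (0::real^2) (1 + x)) \<noteq> \<infinity>" using bfin[of 0 "1 + x"] by simp
      show "ball 0 (1 - x) \<subseteq> cball (0::real^2) (1 + x)" using x by auto
    qed auto
    also have "\<dots> = 4 * x * ?V"
      using x True by (simp add: ball_vol_def content_cball content_ball power2_eq_square algebra_simps)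
    finally have "cmod I \<le> 2 * x * ?V" by simp
    then show ?thesis
      unfolding ball_hat_def f_def[symmetric] using V integral_unit_ball_measure[of f]
      by (simp add: I_def[symmetric] x_def field_simps)
  qed
qed

section \<open>The square function\<close>

text \<open>The indices on either side of \<open>k0\<close> contribute at most a full geometric
  series, with sum 2.\<close>

lemma sum_half_powers_le:
  fixes F :: "int set"
  assumes "finite F"
  shows "(\<Sum>k\<in>F. (1/2::real) ^ nat \<bar>k - k0\<bar>) \<le> 4"
proof -
  have half: "(\<Sum>k\<in>A. (1/2::real) ^ g k) \<le> 2" if "finite A" "inj_on g A" for A :: "int set" and g :: "int \<Rightarrow> nat"
  proof -
    have "(\<Sum>k\<in>A. (1/2::real) ^ g k) = (\<Sum>n\<in>g ` A. (1/2) ^ n)" using that by (simp add: sum.reindex)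
    also have "\<dots> \<le> (\<Sum>n. (1/2::real) ^ n)" using that by (intro sum_le_suminf) (auto intro: summable_geometric)
    also have "\<dots> = 2" by (simp add: suminf_geometric)
    finally show ?thesis .
  qed
  have "F = {k \<in> F. k0 \<le> k} \<union> {k \<in> F. k < k0}" by auto
  then have "(\<Sum>k\<in>F. (1/2::real) ^ nat \<bar>k - k0\<bar>)
      = (\<Sum>k\<in>{k \<in> F. k0 \<le> k}. (1/2) ^ nat \<bar>k - k0\<bar>) + (\<Sum>k\<in>{k \<in> F. k < k0}. (1/2) ^ nat \<bar>k - k0\<bar>)"
    using assms by (subst sum.union_disjoint[symmetric]) auto
  also have "\<dots> \<le> 2 + 2"
    using assms by (intro add_mono half) (auto simp: inj_on_def)
  finally show ?thesis by simp
qed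

lemma sum_min_square_dyadic:
  fixes F :: "int set"
  assumes "finite F" and \<rho>: "0 < \<rho>"
  shows "(\<Sum>k\<in>F. (min (2 powr k * \<rho>) (1 / (2 powr k * \<rho>)))\<^sup>2) \<le> 16"
proof -
  \<comment> \<open>The last scale with \<open>2 powr k * \<rho> \<le> 1\<close>. There the product
    \<open>a\<close> lies between 1/2 and 1, and moving \<open>n\<close> scales away costs a factor
    \<open>(1/2) ^ n\<close> in the minimum, up to the factor 2 from
    \<open>1 / a < 2\<close>.\<close>
  define k0 where "k0 = \<lfloor>- log 2 \<rho>\<rfloor>"
  define a where "a = 2 powr k0 * \<rho>"
  have "2 powr k0 \<le> 2 powr (- log 2 \<rho>)" "2 powr (- log 2 \<rho>) < 2 powr (k0 + 1)"
    unfolding k0_def by (intro powr_mono powr_less_mono; linarith)+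
  then have "2 powr k0 \<le> 1 / \<rho>" "1 / \<rho> < 2 * 2 powr k0"
    using \<rho> by (auto simp: powr_minus powr_add inverse_eq_divide)
  then have a: "a \<le> 1" "1/2 < a"
    using \<rho> by (auto simp: a_def field_simps)
  have each: "(min (2 powr k * \<rho>) (1 / (2 powr k * \<rho>)))\<^sup>2 \<le> 4 * (1/2) ^ nat \<bar>k - k0\<bar>" for k :: int
  proof -
    define n where "n = nat \<bar>k - k0\<bar>"
    have hp: "(1/2::real) ^ n = 2 powr (- real n)" by (simp add: powr_minus powr_realpow power_one_over inverse_eq_divide)
    have h1: "(1/2::real) ^ n \<le> 1" by (simp add: power_le_one)
    have pos: "0 < 2 powr k * \<rho>" using \<rho> by simp
    have "min (2 powr k * \<rho>) (1 / (2 powr k * \<rho>)) \<le> 2 * (1/2) ^ n"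
    proof (cases "k \<le> k0")
      case True
      have "2 powr k = 2 powr k0 * 2 powr (- real n)" using True by (simp add: n_def flip: powr_add)
      then have "2 powr k * \<rho> = (1/2) ^ n * a" by (simp add: a_def hp)
      also have "\<dots> \<le> (1/2) ^ n * 1" using a by (intro mult_left_mono) auto
      also have "\<dots> \<le> 2 * (1/2) ^ n" by simp
      finally show ?thesis by (simp add: min.coboundedI1)
    next
      case False
      have "2 powr k = 2 powr k0 / 2 powr (- real n)" using False by (simp add: n_def flip: powr_diff)
      then have "1 / (2 powr k * \<rho>) = (1/2) ^ n * (1 / a)" by (simp add: a_def hp)
      also have "\<dots> \<le> (1/2) ^ n * 2" using a by (intro mult_left_mono) (auto simp: field_simps)
      finally show ?thesis by (simp add: min.coboundedI2)
    qed
    then have "(min (2 powr k * \<rho>) (1 / (2 powr k * \<rho>)))\<^sup>2 \<le> (2 * (1/2) ^ n)\<^sup>2"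
      using pos by (intro power_mono) auto
    also have "\<dots> = 4 * ((1/2) ^ n * (1/2) ^ n)" by (simp add: power2_eq_square)
    also have "\<dots> \<le> 4 * ((1/2) ^ n * 1)" by (intro mult_left_mono h1) auto
    finally show ?thesis by (simp add: n_def)
  qed
  have "(\<Sum>k\<in>F. (min (2 powr k * \<rho>) (1 / (2 powr k * \<rho>)))\<^sup>2) \<le> (\<Sum>k\<in>F. 4 * (1/2) ^ nat \<bar>k - k0\<bar>)"
    by (intro sum_mono each)
  also have "\<dots> \<le> 4 * 4"
    unfolding sum_distrib_left[symmetric] by (intro mult_left_mono sum_half_powers_le assms) auto
  finally show ?thesis by simp
qed

text \<open>On \<open>{d / 2 powr k ..< 2 * (d / 2 powr k)}\<close> the integrand is at least
  \<open>H (d / 2 powr k)\<close> divided by twice the length of the interval. These intervals are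
  disjoint and reach up to at most \<open>2 * T\<close>, whence the range of the integral and the
  factor 2.\<close>

lemma dyadic_sum_le_integral:
  fixes H :: "real \<Rightarrow> real" and F :: "int set"
  assumes F: "finite F" and d: "0 < d" and H: "mono H" "\<And>t. 0 \<le> H t"
    and T: "\<And>k. k \<in> F \<Longrightarrow> d / 2 powr k \<le> T"
  shows "(\<Sum>k\<in>F. ennreal (H (d / 2 powr k)))
      \<le> 2 * (\<integral>\<^sup>+t. ennreal (H t / t) * indicator {0<..<2 * T} t \<partial>lborel)"
proof -
  have [measurable]: "H \<in> borel_measurable borel" by (rule borel_measurable_mono[OF H(1)])
  define N where "N = density lborel (\<lambda>t. ennreal (H t / t))"
  define I where "I k = {d / 2 powr k..<2 * (d / 2 powr k)}" for k :: int
  have dk: "0 < d / 2 powr k" for k :: int using d by simp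
  have em: "emeasure N A = (\<integral>\<^sup>+t. ennreal (H t / t) * indicator A t \<partial>lborel)" if "A \<in> sets borel" for A
    unfolding N_def using that by (intro emeasure_density) auto
  have each: "ennreal (H (d / 2 powr k)) \<le> 2 * emeasure N (I k)" for k
  proof -
    let ?d = "d / 2 powr k"
    have "ennreal (H ?d) = 2 * (ennreal (H ?d / (2 * ?d)) * ennreal ?d)"
    proof -
      have q: "0 \<le> H ?d / (2 * ?d)" using H(2)[of ?d] dk[of k] by (intro divide_nonneg_pos) auto
      have "ennreal (H ?d) = ennreal (2 * (H ?d / (2 * ?d) * ?d))" using dk[of k] d by simp
      also have "\<dots> = ennreal 2 * ennreal (H ?d / (2 * ?d) * ?d)"
        by (intro ennreal_mult mult_nonneg_nonneg q less_imp_le[OF dk]) auto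
      also have "ennreal (H ?d / (2 * ?d) * ?d) = ennreal (H ?d / (2 * ?d)) * ennreal ?d"
        by (intro ennreal_mult q less_imp_le[OF dk])
      finally show ?thesis by simp
    qed
    also have "ennreal (H ?d / (2 * ?d)) * ennreal ?d = (\<integral>\<^sup>+t. ennreal (H ?d / (2 * ?d)) * indicator (I k) t \<partial>lborel)"
      using dk[of k] by (simp add: nn_integral_cmult I_def)
    also have "\<dots> \<le> (\<integral>\<^sup>+t. ennreal (H t / t) * indicator (I k) t \<partial>lborel)"
    proof (intro nn_integral_mono)
      fix t
      show "ennreal (H ?d / (2 * ?d)) * indicator (I k) t \<le> ennreal (H t / t) * indicator (I k) t"
      proof (cases "t \<in> I k")
        case True
        then have t: "?d \<le> t" "t < 2 * ?d" by (auto simp: I_def)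
        have "H ?d / (2 * ?d) \<le> H t / t"
          using t dk[of k] H(2)[of ?d] monoD[OF H(1) t(1)] by (intro frac_le) auto
        then show ?thesis using True by (simp add: ennreal_leI)
      qed simp
    qed
    also have "\<dots> = emeasure N (I k)" by (rule em[symmetric]) (simp add: I_def)
    finally show ?thesis by (simp add: mult_left_mono)
  qed
  have disj: "disjoint_family_on I F"
  proof -
    have "I j \<inter> I k = {}" if "j < k" for j k
    proof -
      have "2 * 2 powr j \<le> 2 powr k"
      proof -
        have "2 * 2 powr j = 2 powr (real_of_int j + 1)" by (simp add: powr_add)
        also have "\<dots> \<le> 2 powr k" using that by (intro powr_mono) auto
        finally show ?thesis .
      qed
      then have "2 * (d / 2 powr k) \<le> d / 2 powr j"
        using d by (simp add: field_simps)
      then show ?thesis by (auto simp: I_def)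
    qed
    then show ?thesis unfolding disjoint_family_on_def by (metis Int_commute linorder_neq_iff)
  qed
  have "(\<Sum>k\<in>F. ennreal (H (d / 2 powr k))) \<le> (\<Sum>k\<in>F. 2 * emeasure N (I k))"
    by (intro sum_mono each)
  also have "\<dots> = 2 * emeasure N (\<Union>k\<in>F. I k)"
    unfolding sum_distrib_left[symmetric] using disj F
    by (subst sum_emeasure) (auto simp: N_def I_def)
  also have "\<dots> \<le> 2 * emeasure N {0<..<2 * T}"
  proof (intro mult_left_mono emeasure_mono)
    show "(\<Union>k\<in>F. I k) \<subseteq> {0<..<2 * T}"
    proof
      fix x assume "x \<in> (\<Union>k\<in>F. I k)"
      then obtain k where "k \<in> F" "x \<in> I k" by blast
      then show "x \<in> {0<..<2 * T}" using T[of k] dk[of k] unfolding I_def by simp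
    qed
  qed (auto simp: N_def)
  finally show ?thesis by (simp add: em)
qed

section \<open>Convolution with a measure, and approximation by test functions\<close>

definition conv_measure :: "'a::euclidean_space measure \<Rightarrow> real \<Rightarrow> ('a \<Rightarrow> real) \<Rightarrow> 'a \<Rightarrow> real" where
  "conv_measure M r f x = (\<integral>y. f (x - r *\<^sub>R y) \<partial>M)"

text \<open>Plancherel is available for test functions only, so averaging over a dilated compactly
  supported measure must not leave that class.\<close>

lemma conv_measure_Cc:
  fixes M :: "'a::euclidean_space measure"
  assumes M: "finite_measure M" and [measurable_cong]: "sets M = sets borel"
    and D: "AE y in M. norm y \<le> D" and f: "Cc f"
  shows "Cc (conv_measure M r f)"
  unfolding Cc_def
proof
  interpret finite_measure M by fact
  have [measurable]: "f \<in> borel_measurable borel" by (rule Cc_measurable[OF f])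
  obtain B R where B: "\<And>x. \<bar>f x\<bar> \<le> B" and R: "\<And>x. R < norm x \<Longrightarrow> f x = 0" using Cc_bound[OF f] by metis
  show "continuous_on UNIV (conv_measure M r f)"
  proof (rule continuous_on_sequentiallyI)
    fix u :: "nat \<Rightarrow> 'a" and a assume u: "u \<longlonglongrightarrow> a"
    show "(\<lambda>n. conv_measure M r f (u n)) \<longlonglongrightarrow> conv_measure M r f a"
      unfolding conv_measure_def
    proof (rule integral_dominated_convergence[where w="\<lambda>_. B"])
      have "(\<lambda>n. f (u n - r *\<^sub>R y)) \<longlonglongrightarrow> f (a - r *\<^sub>R y)" for y
      proof -
        have "isCont f (a - r *\<^sub>R y)" using f by (auto simp: Cc_def continuous_on_eq_continuous_at)
        then show ?thesis by (rule isCont_tendsto_compose) (intro tendsto_intros u)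
      qed
      then show "AE y in M. (\<lambda>n. f (u n - r *\<^sub>R y)) \<longlonglongrightarrow> f (a - r *\<^sub>R y)" by simp
    qed (auto simp: B)
  qed
  have "conv_measure M r f x = 0" if x: "R + \<bar>r\<bar> * D < norm x" for x
  proof -
    have "(\<integral>y. f (x - r *\<^sub>R y) \<partial>M) = (\<integral>y. 0 \<partial>M)"
    proof (rule integral_cong_AE)
      show "AE y in M. f (x - r *\<^sub>R y) = 0"
        using D
      proof eventually_elim
        case (elim y)
        have "norm x \<le> norm (x - r *\<^sub>R y) + \<bar>r\<bar> * norm y"
          using norm_triangle_ineq[of "x - r *\<^sub>R y" "r *\<^sub>R y"] by simp
        moreover have "\<bar>r\<bar> * norm y \<le> \<bar>r\<bar> * D" using elim by (intro mult_left_mono) auto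
        ultimately show ?case using x by (intro R) simp
      qed
    qed auto
    then show ?thesis by (simp add: conv_measure_def)
  qed
  then show "\<exists>R. \<forall>x. R < norm x \<longrightarrow> conv_measure M r f x = 0" by blast
qed

lemma ft_conv_measure:
  fixes M :: "'a::euclidean_space measure"
  assumes M: "finite_measure M" and [measurable_cong]: "sets M = sets borel" and f: "Cc f"
  shows "ft (conv_measure M r f) \<xi> = (\<integral>y. cis ((r *\<^sub>R \<xi>) \<bullet> y) \<partial>M) * ft f \<xi>"
proof -
  interpret M: finite_measure M by fact
  interpret P: pair_sigma_finite "lborel :: 'a measure" M ..
  have [measurable]: "f \<in> borel_measurable borel" by (rule Cc_measurable[OF f])
  have fi: "integrable lborel f" by (rule Cc_integrable[OF f])
  let ?h = "\<lambda>x y. complex_of_real (f (x - r *\<^sub>R y)) * cis (\<xi> \<bullet> x)"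
  have int: "integrable (lborel \<Otimes>\<^sub>M M) (case_prod ?h)"
  proof (rule integrableI_bounded)
    show "case_prod ?h \<in> borel_measurable (lborel \<Otimes>\<^sub>M M)" by measurable
    have "(\<integral>\<^sup>+p. ennreal (norm (case_prod ?h p)) \<partial>(lborel \<Otimes>\<^sub>M M)) = (\<integral>\<^sup>+y. \<integral>\<^sup>+x. ennreal \<bar>f (x - r *\<^sub>R y)\<bar> \<partial>lborel \<partial>M)"
      by (subst P.nn_integral_snd[symmetric]) (auto simp: norm_mult)
    also have "\<dots> = (\<integral>\<^sup>+y. \<integral>\<^sup>+x. ennreal \<bar>f x\<bar> \<partial>lborel \<partial>M)"
      by (intro nn_integral_cong nn_integral_lborel_translate(1)) measurable
    also have "\<dots> = (\<integral>\<^sup>+x. ennreal \<bar>f x\<bar> \<partial>lborel) * emeasure M (space M)" by simp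
    also have "\<dots> < \<infinity>"
      using fi M.emeasure_finite[of "space M"]
      by (auto simp: integrable_iff_bounded less_top[symmetric] ennreal_mult_eq_top_iff)
    finally show "(\<integral>\<^sup>+p. ennreal (norm (case_prod ?h p)) \<partial>(lborel \<Otimes>\<^sub>M M)) < \<infinity>" .
  qed
  have "ft (conv_measure M r f) \<xi> = (\<integral>x. \<integral>y. ?h x y \<partial>M \<partial>lborel)"
    unfolding ft_def conv_measure_def
  proof (rule Bochner_Integration.integral_cong[OF refl])
    fix x
    have "(\<integral>y. ?h x y \<partial>M) = (\<integral>y. complex_of_real (f (x - r *\<^sub>R y)) \<partial>M) * cis (\<xi> \<bullet> x)"
      by (rule integral_mult_left_zero)
    then show "complex_of_real (\<integral>y. f (x - r *\<^sub>R y) \<partial>M) * cis (\<xi> \<bullet> x) = (\<integral>y. ?h x y \<partial>M)"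
      by simp
  qed
  also have "\<dots> = (\<integral>y. \<integral>x. ?h x y \<partial>lborel \<partial>M)"
    by (rule P.Fubini_integral[OF int, symmetric])
  also have "\<dots> = (\<integral>y. cis ((r *\<^sub>R \<xi>) \<bullet> y) * ft f \<xi> \<partial>M)"
  proof (rule Bochner_Integration.integral_cong[OF refl])
    fix y
    have m: "(\<lambda>x. ?h x y) \<in> borel_measurable borel" by measurable
    have "(\<integral>x. ?h x y \<partial>lborel) = (\<integral>x. ?h (r *\<^sub>R y + 1 *\<^sub>R x) y \<partial>lborel)"
      using integral_lborel_affine[OF m, of 1 "r *\<^sub>R y"] by simp
    also have "\<dots> = (\<integral>x. cis ((r *\<^sub>R \<xi>) \<bullet> y) * (complex_of_real (f x) * cis (\<xi> \<bullet> x)) \<partial>lborel)"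
      by (intro Bochner_Integration.integral_cong) (auto simp: inner_add_right mult_ac simp flip: cis_mult)
    also have "\<dots> = cis ((r *\<^sub>R \<xi>) \<bullet> y) * ft f \<xi>"
      unfolding ft_def by (rule integral_mult_right_zero)
    finally show "(\<integral>x. ?h x y \<partial>lborel) = cis ((r *\<^sub>R \<xi>) \<bullet> y) * ft f \<xi>" .
  qed
  also have "\<dots> = (\<integral>y. cis ((r *\<^sub>R \<xi>) \<bullet> y) \<partial>M) * ft f \<xi>" by (rule integral_mult_left_zero)
  finally show ?thesis .
qed

lemma Cc_diff_scale:
  assumes "Cc f" "Cc g" shows "Cc (\<lambda>x. f x - c * g x)"
proof -
  obtain R S where "\<forall>x. R < norm x \<longrightarrow> f x = 0" "\<forall>x. S < norm x \<longrightarrow> g x = 0"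
    using assms by (auto simp: Cc_def)
  then have "\<forall>x. max R S < norm x \<longrightarrow> f x - c * g x = 0" by simp
  then have "\<exists>R. \<forall>x. R < norm x \<longrightarrow> f x - c * g x = 0" by (rule exI)
  moreover have "continuous_on UNIV (\<lambda>x. f x - c * g x)"
    using assms by (auto simp: Cc_def intro!: continuous_intros)
  ultimately show ?thesis unfolding Cc_def by (rule conjI[rotated])
qed

lemma ft_diff_scale:
  assumes "Cc f" "Cc g"
  shows "ft (\<lambda>x. f x - c * g x) \<xi> = ft f \<xi> - complex_of_real c * ft g \<xi>"
proof -
  have "ft (\<lambda>x. f x - c * g x) \<xi> = (\<integral>x. complex_of_real (f x) * cis (\<xi> \<bullet> x) - complex_of_real c * (complex_of_real (g x) * cis (\<xi> \<bullet> x)) \<partial>lborel)"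
    unfolding ft_def by (intro Bochner_Integration.integral_cong) (auto simp: algebra_simps)
  also have "\<dots> = ft f \<xi> - (\<integral>x. complex_of_real c * (complex_of_real (g x) * cis (\<xi> \<bullet> x)) \<partial>lborel)"
    unfolding ft_def
    by (intro Bochner_Integration.integral_diff integrable_mult_right integrable_mult_cis Cc_integrable assms)
  also have "(\<integral>x. complex_of_real c * (complex_of_real (g x) * cis (\<xi> \<bullet> x)) \<partial>lborel) = complex_of_real c * ft g \<xi>"
    unfolding ft_def by (rule integral_mult_right_zero)
  finally show ?thesis .
qed

text \<open>Measurability gives continuous functions converging almost everywhere. Clipping them to
  the range of \<open>f\<close> and cutting them off outside its support provides a dominating
  function, so the convergence holds in L2.\<close>

lemma Cc_approximation:
  fixes f :: "'a::euclidean_space \<Rightarrow> real"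
  assumes [measurable]: "f \<in> borel_measurable borel"
    and B: "\<And>x. \<bar>f x\<bar> \<le> B" and R: "\<And>x. R < norm x \<Longrightarrow> f x = 0"
  obtains h where "\<And>n. Cc (h n)" "(\<lambda>n. \<integral>x. (h n x)\<^sup>2 \<partial>lborel) \<longlonglongrightarrow> (\<integral>x. (f x)\<^sup>2 \<partial>lborel)"
    "(\<lambda>n. \<integral>x. (f x - h n x)\<^sup>2 \<partial>lborel) \<longlonglongrightarrow> 0"
proof -
  have B0: "0 \<le> B" using B[of 0] by simp
  have "f measurable_on UNIV"
    by (intro lebesgue_measurable_imp_measurable_on measurable_completion) auto
  then obtain N g where N: "negligible N" and g: "\<And>n. continuous_on UNIV (g n)"
    and lim: "\<And>x. x \<notin> N \<Longrightarrow> (\<lambda>n. g n x) \<longlonglongrightarrow> f x"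
    unfolding measurable_on_def by auto
  \<comment> \<open>A continuous cutoff, equal to 1 where \<open>f\<close> may be nonzero and to 0
    beyond radius \<open>R + 1\<close>.\<close>
  define c where "c x = max 0 (1 - max 0 (norm x - R))" for x :: 'a
  define h where "h n x = c x * max (- B) (min B (g n x))" for n x
  have c: "0 \<le> c x" "c x \<le> 1" for x by (auto simp: c_def)
  have c0: "c x = 0" if "R + 1 < norm x" for x using that by (simp add: c_def)
  have c1: "c x = 1" if "norm x \<le> R" for x using that by (simp add: c_def)
  have hc: "continuous_on UNIV (h n)" for n
    unfolding h_def c_def by (intro continuous_intros g)
  have hCc: "Cc (h n)" for n
    unfolding Cc_def using hc by (auto intro!: exI[of _ "R + 1"] simp: h_def c0)
  have [measurable]: "h n \<in> borel_measurable borel" for n by (rule Cc_measurable[OF hCc])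
  have hB: "\<bar>h n x\<bar> \<le> B" for n x
  proof -
    have "\<bar>h n x\<bar> = c x * \<bar>max (- B) (min B (g n x))\<bar>" using c by (simp add: h_def abs_mult)
    also have "\<dots> \<le> 1 * B" using c B0 by (intro mult_mono) auto
    finally show ?thesis by simp
  qed
  have hlim: "AE x in lborel. (\<lambda>n. h n x) \<longlonglongrightarrow> f x"
  proof -
    have "AE x in lebesgue. x \<notin> N"
      using N by (intro AE_not_in) (simp add: negligible_iff_null_sets)
    then have "AE x in lebesgue. (\<lambda>n. h n x) \<longlonglongrightarrow> f x"
    proof eventually_elim
      case (elim x)
      have "(\<lambda>n. h n x) \<longlonglongrightarrow> c x * max (- B) (min B (f x))"
        unfolding h_def by (intro tendsto_intros tendsto_max tendsto_min lim elim)
      also have "max (- B) (min B (f x)) = f x" using B[of x] by auto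
      also have "c x * f x = f x" using R[of x] c1[of x] by (cases "norm x \<le> R") auto
      finally show ?case .
    qed
    then show ?thesis by (simp add: AE_completion_iff)
  qed
  have fin: "integrable lborel (\<lambda>x::'a. K * indicator (cball 0 (max R 0 + 1)) x)" for K :: real
    by (intro integrable_mult_right integrable_real_indicator)
       (use emeasure_bounded_finite[of "cball (0::'a) (max R 0 + 1)"] in auto)
  have out: "f x = 0" "h n x = 0" if "x \<notin> cball 0 (max R 0 + 1)" for x n
    using that R[of x] c0[of x] by (auto simp: h_def)
  show thesis
  proof (rule that[of h, OF hCc])
    show "(\<lambda>n. \<integral>x. (h n x)\<^sup>2 \<partial>lborel) \<longlonglongrightarrow> (\<integral>x. (f x)\<^sup>2 \<partial>lborel)"
    proof (rule integral_dominated_convergence[OF _ _ fin[of "B\<^sup>2"]])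
      show "AE x in lborel. (\<lambda>n. (h n x)\<^sup>2) \<longlonglongrightarrow> (f x)\<^sup>2"
        using hlim by eventually_elim (intro tendsto_intros)
      have "(h n x)\<^sup>2 \<le> B\<^sup>2" for n x using hB[of n x] B0 by (simp add: abs_le_square_iff[symmetric])
      then show "AE x in lborel. norm ((h n x)\<^sup>2) \<le> B\<^sup>2 * indicator (cball 0 (max R 0 + 1)) x" for n
        using out by (intro AE_I2) (simp add: indicator_def)
    qed measurable
    have "(\<lambda>n. \<integral>x. (f x - h n x)\<^sup>2 \<partial>lborel) \<longlonglongrightarrow> (\<integral>x. 0 \<partial>(lborel::'a measure))"
    proof (rule integral_dominated_convergence[OF _ _ fin[of "(2 * B)\<^sup>2"]])
      show "AE x in lborel. (\<lambda>n. (f x - h n x)\<^sup>2) \<longlonglongrightarrow> 0"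
        using hlim
      proof eventually_elim
        case (elim x)
        have "(\<lambda>n. (f x - h n x)\<^sup>2) \<longlonglongrightarrow> (f x - f x)\<^sup>2" by (intro tendsto_intros elim)
        then show ?case by simp
      qed
      have "(f x - h n x)\<^sup>2 \<le> (2 * B)\<^sup>2" for n x
      proof -
        have "\<bar>f x - h n x\<bar> \<le> \<bar>2 * B\<bar>" using hB[of n x] B[of x] by linarith
        then show ?thesis by (simp only: abs_le_square_iff)
      qed
      then show "AE x in lborel. norm ((f x - h n x)\<^sup>2) \<le> (2 * B)\<^sup>2 * indicator (cball 0 (max R 0 + 1)) x" for n
        using out by (intro AE_I2) (simp add: indicator_def)
    qed measurable
    then show "(\<lambda>n. \<integral>x. (f x - h n x)\<^sup>2 \<partial>lborel) \<longlonglongrightarrow> 0" by simp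
  qed
qed

section \<open>The multiplier of arclength minus the disc\<close>

context convex_domain
begin

abbreviation "mass \<equiv> measure \<sigma> UNIV"

definition nu_hat :: "real^2 \<Rightarrow> complex" where
  "nu_hat \<xi> = sigma_hat \<xi> - complex_of_real mass * ball_hat \<xi>"

lemma frontier_norm_bound: "\<exists>D\<ge>0. \<forall>p\<in>frontier \<Omega>. norm p \<le> D"
proof -
  obtain D where "\<forall>x\<in>closure \<Omega>. norm x \<le> D" using bounded_closure[OF bdd] by (auto simp: bounded_iff)
  then show ?thesis by (intro exI[of _ "max 0 D"]) (auto simp: frontier_eq le_max_iff_disj)
qed

text \<open>The multiplier is linear in \<open>norm \<xi>\<close> near 0 by cancellation of the
  masses, and beyond 1 it is bounded by the caps plus the decay of the disc. The first and last
  contributions sum by \<open>sum_min_square_dyadic\<close>. The caps have heights below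
  \<open>pi\<close>, so \<open>dyadic_sum_le_integral\<close> compares their squares with the
  integral up to \<open>2 * pi\<close>.\<close>

lemma multiplier_bound:
  assumes G: "\<And>v. norm v = 1 \<Longrightarrow> (\<integral>\<^sup>+d. ennreal ((Lambda \<Omega> v d)\<^sup>2 / d) * indicator {0<..<2 * pi} d \<partial>lborel) \<le> ennreal G"
    and G0: "0 \<le> G"
  shows "\<exists>C\<ge>0. \<forall>\<xi>. \<forall>F::int set. finite F \<longrightarrow> (\<Sum>k\<in>F. (cmod (nu_hat (2 powr k *\<^sub>R \<xi>)))\<^sup>2) \<le> C"
proof -
  obtain D where D: "0 \<le> D" "\<And>p. p \<in> frontier \<Omega> \<Longrightarrow> norm p \<le> D" using frontier_norm_bound by blast
  interpret B: prob_space unit_ball_measure by (rule prob_space_unit_ball_measure)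
  have m0: "0 \<le> mass" by simp
  have low: "cmod (nu_hat \<xi>) \<le> mass * (D + 1) * norm \<xi>" for \<xi>
  proof -
    have "AE p in \<sigma>. norm p \<le> D" using AE_frontier by eventually_elim (rule D)
    then have 1: "cmod (sigma_hat \<xi> - complex_of_real mass) \<le> mass * (D * norm \<xi>)"
      using fourier_near_zero[OF finite_measure_arclength, of D \<xi>] by (simp add: sigma_hat_def)
    have 2: "cmod (ball_hat \<xi> - 1) \<le> norm \<xi>"
      using fourier_near_zero[OF B.finite_measure_axioms _ AE_unit_ball_measure, of \<xi>] B.prob_space
      by (simp add: ball_hat_def)
    have "nu_hat \<xi> = (sigma_hat \<xi> - complex_of_real mass) - complex_of_real mass * (ball_hat \<xi> - 1)"
      by (simp add: nu_hat_def algebra_simps)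
    also have "cmod \<dots> \<le> mass * (D * norm \<xi>) + mass * norm \<xi>"
      by (rule order_trans[OF norm_triangle_ineq4 add_mono[OF 1]])
         (use mult_left_mono[OF 2 m0] in \<open>simp add: norm_mult\<close>)
    finally show ?thesis by (simp add: algebra_simps)
  qed
  \<comment> \<open>The first summand serves \<open>norm \<xi> \<le> 1\<close>. The second is the
    disc term for larger frequencies, doubled when the square of a sum is split; the same doubling
    turns \<open>6\<^sup>2\<close> into the 72 below.\<close>
  define A where "A = (mass * (D + 1))\<^sup>2 + 2 * (2 * pi * mass)\<^sup>2"
  have A0: "0 \<le> A" by (simp add: A_def)
  have each: "(cmod (nu_hat \<xi>))\<^sup>2 \<le> A * (min (norm \<xi>) (1 / norm \<xi>))\<^sup>2
      + 72 * (if 1 < norm \<xi> then (Lambda \<Omega> (\<xi> /\<^sub>R norm \<xi>) (pi / norm \<xi>))\<^sup>2 else 0)" if \<xi>: "\<xi> \<noteq> 0" for \<xi>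
  proof (cases "norm \<xi> \<le> 1")
    case True
    then have "norm \<xi> \<le> 1 / norm \<xi>" using \<xi> mult_mono[OF True True] by (simp add: field_simps)
    then have mn: "min (norm \<xi>) (1 / norm \<xi>) = norm \<xi>" by simp
    have "(cmod (nu_hat \<xi>))\<^sup>2 \<le> (mass * (D + 1) * norm \<xi>)\<^sup>2" by (intro power_mono low) auto
    also have "\<dots> = (mass * (D + 1))\<^sup>2 * (norm \<xi>)\<^sup>2" by (simp only: power_mult_distrib)
    also have "\<dots> \<le> A * (norm \<xi>)\<^sup>2" by (intro mult_right_mono) (auto simp: A_def)
    finally show ?thesis using True mn by simp
  next
    case False
    let ?L = "Lambda \<Omega> (\<xi> /\<^sub>R norm \<xi>) (pi / norm \<xi>)"
    have "1 / norm \<xi> \<le> norm \<xi>" using False \<xi> mult_mono[of 1 "norm \<xi>" 1 "norm \<xi>"] by (simp add: field_simps)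
    then have mn: "min (norm \<xi>) (1 / norm \<xi>) = 1 / norm \<xi>" by simp
    have "cmod (nu_hat \<xi>) \<le> cmod (sigma_hat \<xi>) + mass * cmod (ball_hat \<xi>)"
      unfolding nu_hat_def by (rule order_trans[OF norm_triangle_ineq4]) (simp add: norm_mult)
    also have "\<dots> \<le> 6 * ?L + mass * (2 * pi / norm \<xi>)"
      using mult_left_mono[OF ball_hat_decay[OF \<xi>] m0] sigma_hat_decay[OF \<xi>] by (rule add_mono[rotated])
    finally have "(cmod (nu_hat \<xi>))\<^sup>2 \<le> (6 * ?L + mass * (2 * pi / norm \<xi>))\<^sup>2" by (intro power_mono) auto
    also have "\<dots> \<le> 2 * (6 * ?L)\<^sup>2 + 2 * (mass * (2 * pi / norm \<xi>))\<^sup>2"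
      using sum_squares_bound[of "6 * ?L" "mass * (2 * pi / norm \<xi>)"] unfolding power2_sum by linarith
    also have "2 * (mass * (2 * pi / norm \<xi>))\<^sup>2 = 2 * (2 * pi * mass)\<^sup>2 * (1 / norm \<xi>)\<^sup>2"
      by (simp add: power_mult_distrib power_divide)
    also have "\<dots> \<le> A * (1 / norm \<xi>)\<^sup>2" by (intro mult_right_mono) (auto simp: A_def)
    finally have "(cmod (nu_hat \<xi>))\<^sup>2 \<le> 2 * (6 * ?L)\<^sup>2 + A * (1 / norm \<xi>)\<^sup>2" by simp
    then show ?thesis using False mn by (simp add: power_mult_distrib)
  qed
  have "(\<Sum>k\<in>F. (cmod (nu_hat (2 powr k *\<^sub>R \<xi>)))\<^sup>2) \<le> 16 * A + 144 * G"
    if F: "finite F" for F :: "int set" and \<xi>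
  proof (cases "\<xi> = 0")
    case True
    have "nu_hat 0 = 0" using low[of 0] by simp
    then show ?thesis using True A0 G0 by simp
  next
    case False
    define v where "v = \<xi> /\<^sub>R norm \<xi>"
    have v: "norm v = 1" using False by (simp add: v_def)
    \<comment> \<open>The frequencies beyond 1, for which the height
      \<open>pi / (2 powr k * norm \<xi>)\<close> is less than \<open>pi\<close>.\<close>
    define F' where "F' = {k \<in> F. 1 < 2 powr k * norm \<xi>}"
    have F': "finite F'" using F by (simp add: F'_def)
    define H where "H d = (Lambda \<Omega> v d)\<^sup>2" for d
    have "mono H" unfolding H_def mono_def using Lambda_mono[OF v] Lambda_nonneg[OF v] by (auto intro: power_mono)
    then have "(\<Sum>k\<in>F'. ennreal (H ((pi / norm \<xi>) / 2 powr k)))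
       \<le> 2 * (\<integral>\<^sup>+t. ennreal (H t / t) * indicator {0<..<2 * pi} t \<partial>lborel)"
      using False by (intro dyadic_sum_le_integral F') (auto simp: F'_def field_simps, simp add: H_def)
    also have "\<dots> \<le> 2 * ennreal G" unfolding H_def by (intro mult_left_mono G v) auto
    finally have "ennreal (\<Sum>k\<in>F'. H ((pi / norm \<xi>) / 2 powr k)) \<le> ennreal (2 * G)"
      using G0 by (simp add: H_def sum_ennreal ennreal_mult)
    then have HG: "(\<Sum>k\<in>F'. H ((pi / norm \<xi>) / 2 powr k)) \<le> 2 * G"
      using G0 by (subst (asm) ennreal_le_iff) auto
    have "(\<Sum>k\<in>F. (cmod (nu_hat (2 powr k *\<^sub>R \<xi>)))\<^sup>2)
       \<le> (\<Sum>k\<in>F. A * (min (2 powr k * norm \<xi>) (1 / (2 powr k * norm \<xi>)))\<^sup>2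
          + 72 * (if 1 < 2 powr k * norm \<xi> then H ((pi / norm \<xi>) / 2 powr k) else 0))"
    proof (intro sum_mono)
      fix k
      have nz: "2 powr real_of_int k *\<^sub>R \<xi> \<noteq> 0" using False by simp
      have e1: "(2 powr real_of_int k *\<^sub>R \<xi>) /\<^sub>R norm (2 powr real_of_int k *\<^sub>R \<xi>) = v" by (simp add: v_def)
      have e2: "norm (2 powr real_of_int k *\<^sub>R \<xi>) = 2 powr real_of_int k * norm \<xi>" by simp
      have e3: "pi / (2 powr real_of_int k * norm \<xi>) = pi / norm \<xi> / 2 powr real_of_int k" by simp
      show "(cmod (nu_hat (2 powr k *\<^sub>R \<xi>)))\<^sup>2 \<le> A * (min (2 powr k * norm \<xi>) (1 / (2 powr k * norm \<xi>)))\<^sup>2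
          + 72 * (if 1 < 2 powr k * norm \<xi> then H ((pi / norm \<xi>) / 2 powr k) else 0)"
        using each[OF nz] unfolding e1 unfolding e2 e3 H_def .
    qed
    also have "\<dots> = A * (\<Sum>k\<in>F. (min (2 powr k * norm \<xi>) (1 / (2 powr k * norm \<xi>)))\<^sup>2)
        + 72 * (\<Sum>k\<in>F'. H ((pi / norm \<xi>) / 2 powr k))"
      using F by (simp add: sum.distrib sum_distrib_left[symmetric] F'_def sum.inter_filter del: divide_divide_eq_left)
    also have "\<dots> \<le> A * 16 + 72 * (2 * G)"
      using A0 HG False F by (intro add_mono mult_left_mono sum_min_square_dyadic) auto
    finally show ?thesis by simp
  qed
  then show ?thesis using A0 G0 by (intro exI[of _ "16 * A + 144 * G"]) auto
qed

end

section \<open>Sufficiency\<close>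

text \<open>The square is a double supremum, and monotonicity bounds each term
  \<open>S j * S i\<close> by the diagonal term at \<open>max i j\<close>.\<close>

lemma SUP_square_ennreal_le:
  fixes S :: "nat \<Rightarrow> ennreal"
  assumes "incseq S"
  shows "(SUP n. S n)\<^sup>2 \<le> (SUP n. (S n)\<^sup>2)"
proof -
  have "(SUP n. S n)\<^sup>2 = (SUP i. (SUP j. S j) * S i)"
    unfolding power2_eq_square by (rule SUP_mult_left_ennreal)
  also have "\<dots> = (SUP i. SUP j. S j * S i)"
    by (simp add: SUP_mult_right_ennreal)
  also have "\<dots> \<le> (SUP n. (S n)\<^sup>2)"
  proof (intro SUP_least)
    fix i j
    have "S j * S i \<le> S (max i j) * S (max i j)"
      using assms by (intro mult_mono) (auto simp: incseq_def)
    also have "\<dots> \<le> (SUP n. (S n)\<^sup>2)" unfolding power2_eq_square[symmetric] by (rule SUP_upper) simp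
    finally show "S j * S i \<le> (SUP n. (S n)\<^sup>2)" .
  qed
  finally show ?thesis .
qed

lemma SUP_finite_attained:
  fixes g :: "'i \<Rightarrow> 'b::complete_linorder"
  assumes "finite K" "K \<noteq> {}"
  shows "\<exists>k\<in>K. (SUP k\<in>K. g k) = g k"
proof -
  have "(SUP k\<in>K. g k) = Max (g ` K)" using assms by (simp add: Max_Sup)
  moreover have "Max (g ` K) \<in> g ` K" using assms by (intro Max_in) auto
  ultimately show ?thesis by auto
qed

section \<open>From test functions to all square integrable functions\<close>

context convex_domain
begin

text \<open>A single average with values in \<open>ennreal\<close>, defined without a question of
  integrability; it is applied to nonnegative functions.\<close>

definition arc_avg :: "int \<Rightarrow> (real^2 \<Rightarrow> real) \<Rightarrow> real^2 \<Rightarrow> ennreal" where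
  "arc_avg k f x = (\<integral>\<^sup>+y. ennreal (f (x - (2 powr real_of_int k) *\<^sub>R y)) \<partial>\<sigma>)"

lemma measurable_arc_avg [measurable]:
  assumes [measurable]: "f \<in> borel_measurable borel"
  shows "arc_avg k f \<in> borel_measurable borel"
proof -
  interpret pair_sigma_finite \<sigma> "lborel :: (real^2) measure" ..
  have "(\<lambda>x. \<integral>\<^sup>+y. ennreal (f (x - (2 powr real_of_int k) *\<^sub>R y)) \<partial>\<sigma>) \<in> borel_measurable borel"
    by measurable
  then show ?thesis by (simp add: arc_avg_def[abs_def])
qed

lemma emeasure_arclength_UNIV: "emeasure \<sigma> UNIV = ennreal mass"
  using arc.emeasure_eq_measure by simp

lemma arc_avg_square_le:
  assumes [measurable]: "f \<in> borel_measurable borel"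
  shows "(\<integral>\<^sup>+x. (arc_avg k f x)\<^sup>2 \<partial>lborel) \<le> (ennreal mass)\<^sup>2 * (\<integral>\<^sup>+x. (ennreal (f x))\<^sup>2 \<partial>lborel)"
  using nn_integral_average_square_le[OF finite_measure_arclength, of "\<lambda>x. ennreal (f x)" "2 powr real_of_int k"]
  by (simp add: arc_avg_def emeasure_arclength_UNIV)

text \<open>Convolution with the signed measure whose transform is \<open>nu_hat\<close>.\<close>

definition defect :: "int \<Rightarrow> (real^2 \<Rightarrow> real) \<Rightarrow> real^2 \<Rightarrow> real" where
  "defect k h x = conv_measure \<sigma> (2 powr real_of_int k) h x
     - mass * conv_measure unit_ball_measure (2 powr real_of_int k) h x"

lemma defect_Cc:
  assumes "Cc h" shows "Cc (defect k h)"
proof -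
  interpret B: prob_space unit_ball_measure by (rule prob_space_unit_ball_measure)
  obtain D where D: "\<And>p. p \<in> frontier \<Omega> \<Longrightarrow> norm p \<le> D" using frontier_norm_bound by blast
  have "AE p in \<sigma>. norm p \<le> D" using AE_frontier by eventually_elim (rule D)
  then show ?thesis
    unfolding defect_def[abs_def]
    by (intro Cc_diff_scale conv_measure_Cc[OF finite_measure_arclength]
        conv_measure_Cc[OF B.finite_measure_axioms _ AE_unit_ball_measure] assms) auto
qed

lemma defect_ft:
  assumes "Cc h"
  shows "ft (defect k h) \<xi> = nu_hat (2 powr real_of_int k *\<^sub>R \<xi>) * ft h \<xi>"
proof -
  interpret B: prob_space unit_ball_measure by (rule prob_space_unit_ball_measure)
  obtain D where D: "\<And>p. p \<in> frontier \<Omega> \<Longrightarrow> norm p \<le> D" using frontier_norm_bound by blast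
  have AE: "AE p in \<sigma>. norm p \<le> D" using AE_frontier by eventually_elim (rule D)
  have "ft (defect k h) \<xi> = ft (conv_measure \<sigma> (2 powr real_of_int k) h) \<xi>
      - complex_of_real mass * ft (conv_measure unit_ball_measure (2 powr real_of_int k) h) \<xi>"
    unfolding defect_def[abs_def]
    by (intro ft_diff_scale conv_measure_Cc[OF finite_measure_arclength _ AE]
        conv_measure_Cc[OF B.finite_measure_axioms _ AE_unit_ball_measure] assms) auto
  also have "\<dots> = nu_hat (2 powr real_of_int k *\<^sub>R \<xi>) * ft h \<xi>"
    using ft_conv_measure[OF finite_measure_arclength _ assms] ft_conv_measure[OF B.finite_measure_axioms _ assms]
    by (simp add: nu_hat_def sigma_hat_def ball_hat_def algebra_simps)
  finally show ?thesis .
qed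

lemma defect_square_sum:
  assumes C: "0 \<le> C" "\<And>\<xi> F. finite F \<Longrightarrow> (\<Sum>k\<in>F. (cmod (nu_hat (2 powr real_of_int k *\<^sub>R \<xi>)))\<^sup>2) \<le> C"
    and F: "finite F" and h: "Cc h"
  shows "(\<Sum>k\<in>F. \<integral>x. (defect k h x)\<^sup>2 \<partial>lborel) \<le> C * (\<integral>x. (h x)\<^sup>2 \<partial>lborel)"
proof (rule square_function_bound[OF F h defect_Cc[OF h] _ C(1)])
  fix \<xi>
  have "(\<Sum>k\<in>F. (cmod (ft (defect k h) \<xi>))\<^sup>2) = (\<Sum>k\<in>F. (cmod (nu_hat (2 powr real_of_int k *\<^sub>R \<xi>)))\<^sup>2) * (cmod (ft h \<xi>))\<^sup>2"
    by (simp add: defect_ft[OF h] norm_mult power_mult_distrib sum_distrib_right)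
  also have "\<dots> \<le> C * (cmod (ft h \<xi>))\<^sup>2" by (intro mult_right_mono C F) auto
  finally show "(\<Sum>k\<in>F. (cmod (ft (defect k h) \<xi>))\<^sup>2) \<le> C * (cmod (ft h \<xi>))\<^sup>2" .
qed

text \<open>Replacing \<open>f\<close> by a test function \<open>h\<close> leaves an error that need
  not be small at any given point, since the curve may lie in an exceptional null set. It is kept as
  an average over the curve, whose L2 norm is under control.\<close>

lemma arc_avg_pointwise:
  assumes [measurable]: "f \<in> borel_measurable borel" and f: "\<And>x. 0 \<le> f x" "\<And>x. f x \<le> B" and h: "Cc h"
  shows "arc_avg k f x \<le> ennreal mass * ball_avg (2 powr real_of_int k) (\<lambda>z. ennreal \<bar>h z\<bar>) x
     + (ennreal \<bar>defect k h x\<bar> + arc_avg k (\<lambda>z. \<bar>f z - h z\<bar>) x)"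
proof -
  interpret P: prob_space unit_ball_measure by (rule prob_space_unit_ball_measure)
  let ?r = "2 powr real_of_int k"
  have [measurable]: "h \<in> borel_measurable borel" by (rule Cc_measurable[OF h])
  obtain B' where B': "\<And>x. \<bar>h x\<bar> \<le> B'" using Cc_bound[OF h] by metis
  have fi: "integrable \<sigma> (\<lambda>y. f (x - ?r *\<^sub>R y))"
    using f by (intro arc.integrable_const_bound[of _ B]) auto
  have hi: "integrable \<sigma> (\<lambda>y. h (x - ?r *\<^sub>R y))"
    using B' by (intro arc.integrable_const_bound[of _ B']) auto
  have hP: "integrable unit_ball_measure (\<lambda>y. h (x - ?r *\<^sub>R y))"
    using B' by (intro P.integrable_const_bound[of _ B']) auto
  have "(\<integral>y. f (x - ?r *\<^sub>R y) \<partial>\<sigma>) = conv_measure \<sigma> ?r h x + (\<integral>y. f (x - ?r *\<^sub>R y) - h (x - ?r *\<^sub>R y) \<partial>\<sigma>)"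
    using fi hi by (simp add: conv_measure_def)
  also have "\<dots> \<le> \<bar>conv_measure \<sigma> ?r h x\<bar> + (\<integral>y. \<bar>f (x - ?r *\<^sub>R y) - h (x - ?r *\<^sub>R y)\<bar> \<partial>\<sigma>)"
    using fi hi by (intro add_mono integral_mono) auto
  also have "\<bar>conv_measure \<sigma> ?r h x\<bar> \<le> \<bar>defect k h x\<bar> + mass * \<bar>conv_measure unit_ball_measure ?r h x\<bar>"
  proof -
    have "conv_measure \<sigma> ?r h x = defect k h x + mass * conv_measure unit_ball_measure ?r h x"
      by (simp add: defect_def)
    then show ?thesis
      using abs_triangle_ineq[of "defect k h x" "mass * conv_measure unit_ball_measure ?r h x"]
      by (simp add: abs_mult)
  qed
  finally have le: "(\<integral>y. f (x - ?r *\<^sub>R y) \<partial>\<sigma>) \<le> mass * \<bar>conv_measure unit_ball_measure ?r h x\<bar>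
      + (\<bar>defect k h x\<bar> + (\<integral>y. \<bar>f (x - ?r *\<^sub>R y) - h (x - ?r *\<^sub>R y)\<bar> \<partial>\<sigma>))" by simp
  have "arc_avg k f x = ennreal (\<integral>y. f (x - ?r *\<^sub>R y) \<partial>\<sigma>)"
    unfolding arc_avg_def using f by (intro nn_integral_eq_integral fi) auto
  also have "\<dots> \<le> ennreal (mass * \<bar>conv_measure unit_ball_measure ?r h x\<bar>
      + (\<bar>defect k h x\<bar> + (\<integral>y. \<bar>f (x - ?r *\<^sub>R y) - h (x - ?r *\<^sub>R y)\<bar> \<partial>\<sigma>)))"
    by (intro ennreal_leI le)
  also have "\<dots> = ennreal mass * ennreal \<bar>conv_measure unit_ball_measure ?r h x\<bar>
      + (ennreal \<bar>defect k h x\<bar> + ennreal (\<integral>y. \<bar>f (x - ?r *\<^sub>R y) - h (x - ?r *\<^sub>R y)\<bar> \<partial>\<sigma>))"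
    by (simp add: ennreal_plus ennreal_mult)
  also have "ennreal (\<integral>y. \<bar>f (x - ?r *\<^sub>R y) - h (x - ?r *\<^sub>R y)\<bar> \<partial>\<sigma>) = arc_avg k (\<lambda>z. \<bar>f z - h z\<bar>) x"
    unfolding arc_avg_def using fi hi by (intro nn_integral_eq_integral[symmetric]) auto
  also have "ennreal \<bar>conv_measure unit_ball_measure ?r h x\<bar> \<le> ball_avg ?r (\<lambda>z. ennreal \<bar>h z\<bar>) x"
  proof -
    have "ennreal (norm (\<integral>y. h (x - ?r *\<^sub>R y) \<partial>unit_ball_measure)) \<le> (\<integral>\<^sup>+y. ennreal (norm (h (x - ?r *\<^sub>R y))) \<partial>unit_ball_measure)"
      by (rule integral_norm_bound_ennreal[OF hP])
    also have "\<dots> = ball_avg ?r (\<lambda>z. ennreal \<bar>h z\<bar>) x"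
      by (subst ball_avg_eq_uniform) (auto simp: unit_ball_measure_def)
    finally show ?thesis by (simp add: conv_measure_def)
  qed
  finally show ?thesis by (simp add: mult_left_mono add_right_mono)
qed

text \<open>Splitting the square of a sum once gives the factor 2 of the disc term, and splitting it
  again the factor 4 of the defects. The approximation error is summed over all scales and so
  carries their number, which is harmless: \<open>n\<close> is fixed while \<open>h\<close> tends to
  \<open>f\<close> in L2.\<close>

lemma truncated_maximal_bound:
  assumes C1: "0 \<le> C1" "\<And>n h. h \<in> borel_measurable borel \<Longrightarrow> (\<integral>\<^sup>+x. (h x)\<^sup>2 \<partial>lborel) < \<infinity> \<Longrightarrow>
     (\<integral>\<^sup>+x. (dyadic_max n h x)\<^sup>2 \<partial>lborel) \<le> ennreal C1 * (\<integral>\<^sup>+x. (h x)\<^sup>2 \<partial>(lborel::(real^2) measure))"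
    and C2: "0 \<le> C2" "\<And>\<xi> F. finite F \<Longrightarrow> (\<Sum>k\<in>F. (cmod (nu_hat (2 powr real_of_int k *\<^sub>R \<xi>)))\<^sup>2) \<le> C2"
    and f_meas[measurable]: "f \<in> borel_measurable borel" and f: "\<And>x. 0 \<le> f x" "\<And>x. f x \<le> B" "\<And>x. R < norm x \<Longrightarrow> f x = 0"
  shows "(\<integral>\<^sup>+x. (SUP k\<in>{- int n..int n}. arc_avg k f x)\<^sup>2 \<partial>lborel)
     \<le> ennreal (2 * mass\<^sup>2 * C1 + 4 * C2) * (\<integral>\<^sup>+x. ennreal ((f x)\<^sup>2) \<partial>lborel)"
proof -
  let ?K = "{- int n..int n}"
  have m0: "0 \<le> mass" by simp
  have step: "(\<integral>\<^sup>+x. (SUP k\<in>?K. arc_avg k f x)\<^sup>2 \<partial>lborel)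
     \<le> ennreal ((2 * mass\<^sup>2 * C1 + 4 * C2) * (\<integral>x. (h x)\<^sup>2 \<partial>lborel) + 4 * real (card ?K) * mass\<^sup>2 * (\<integral>x. (f x - h x)\<^sup>2 \<partial>lborel))"
    if h: "Cc h" for h
  proof -
    have [measurable]: "h \<in> borel_measurable borel" by (rule Cc_measurable[OF h])
    have [measurable]: "defect k h \<in> borel_measurable borel" for k by (rule Cc_measurable[OF defect_Cc[OF h]])
    obtain B' R' where B': "0 \<le> B'" "\<And>x. \<bar>h x\<bar> \<le> B'" and R': "\<And>x. R' < norm x \<Longrightarrow> h x = 0" using Cc_bound[OF h] by metis
    have h2: "integrable lborel (\<lambda>x. (h x)\<^sup>2)" by (rule Cc_square_integrable[OF h])
    have d2: "integrable lborel (\<lambda>x. (defect k h x)\<^sup>2)" for k by (rule Cc_square_integrable[OF defect_Cc[OF h]])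
    have fh2: "integrable lborel (\<lambda>x. (f x - h x)\<^sup>2)"
    proof (rule integrable_bounded_support)
      show "norm ((f x - h x)\<^sup>2) \<le> (B + B')\<^sup>2" for x
      proof -
        have "\<bar>f x - h x\<bar> \<le> B + B'" using f(1,2)[of x] B'(2)[of x] by linarith
        then have "\<bar>f x - h x\<bar>\<^sup>2 \<le> (B + B')\<^sup>2" by (intro power_mono) auto
        then show ?thesis by simp
      qed
      show "(f x - h x)\<^sup>2 = 0" if "max R R' < norm x" for x using that f(3)[of x] R'[of x] by simp
    qed measurable
    have hsq: "(\<integral>\<^sup>+x. (ennreal \<bar>h x\<bar>)\<^sup>2 \<partial>lborel) = ennreal (\<integral>x. (h x)\<^sup>2 \<partial>lborel)"
      using nn_integral_eq_integral[OF h2] by (simp add: ennreal_power)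
    have fhsq: "(\<integral>\<^sup>+x. (ennreal \<bar>f x - h x\<bar>)\<^sup>2 \<partial>lborel) = ennreal (\<integral>x. (f x - h x)\<^sup>2 \<partial>lborel)"
      using nn_integral_eq_integral[OF fh2] by (simp add: ennreal_power)
    let ?b = "dyadic_max n (\<lambda>z. ennreal \<bar>h z\<bar>)"
    let ?c = "\<lambda>k. arc_avg k (\<lambda>z. \<bar>f z - h z\<bar>)"
    have "(SUP k\<in>?K. arc_avg k f x)\<^sup>2 \<le> 2 * (ennreal mass * ?b x)\<^sup>2
        + ((\<Sum>k\<in>?K. 4 * ennreal ((defect k h x)\<^sup>2)) + (\<Sum>k\<in>?K. 4 * (?c k x)\<^sup>2))" for x
    proof -
      obtain k where k: "k \<in> ?K" "(SUP k\<in>?K. arc_avg k f x) = arc_avg k f x"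
        using SUP_finite_attained[of ?K "\<lambda>k. arc_avg k f x"] by auto
      have "arc_avg k f x \<le> ennreal mass * ball_avg (2 powr real_of_int k) (\<lambda>z. ennreal \<bar>h z\<bar>) x + (ennreal \<bar>defect k h x\<bar> + ?c k x)"
        by (rule arc_avg_pointwise[OF _ f(1,2) h]) simp
      also have "\<dots> \<le> ennreal mass * ?b x + (ennreal \<bar>defect k h x\<bar> + ?c k x)"
        unfolding dyadic_max_def using k(1) by (intro add_right_mono mult_left_mono SUP_upper) auto
      finally have "(arc_avg k f x)\<^sup>2 \<le> (ennreal mass * ?b x + (ennreal \<bar>defect k h x\<bar> + ?c k x))\<^sup>2"
        by (rule power_mono_ennreal)
      also have "\<dots> \<le> 2 * (ennreal mass * ?b x)\<^sup>2 + 2 * (ennreal \<bar>defect k h x\<bar> + ?c k x)\<^sup>2"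
        by (rule square_add_le_ennreal)
      also have "\<dots> \<le> 2 * (ennreal mass * ?b x)\<^sup>2 + 2 * (2 * (ennreal \<bar>defect k h x\<bar>)\<^sup>2 + 2 * (?c k x)\<^sup>2)"
        by (intro add_left_mono mult_left_mono square_add_le_ennreal) auto
      also have "2 * (2 * (ennreal \<bar>defect k h x\<bar>)\<^sup>2 + 2 * (?c k x)\<^sup>2) = 4 * ennreal ((defect k h x)\<^sup>2) + 4 * (?c k x)\<^sup>2"
        by (simp add: distrib_left ennreal_power mult.assoc[symmetric])
      also have "\<dots> \<le> (\<Sum>k\<in>?K. 4 * ennreal ((defect k h x)\<^sup>2)) + (\<Sum>k\<in>?K. 4 * (?c k x)\<^sup>2)"
        using member_le_sum[OF k(1), of "\<lambda>k. 4 * ennreal ((defect k h x)\<^sup>2)"] member_le_sum[OF k(1), of "\<lambda>k. 4 * (?c k x)\<^sup>2"]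
        by (intro add_mono) auto
      finally show ?thesis unfolding k(2) by (simp add: add_left_mono)
    qed
    then have "(\<integral>\<^sup>+x. (SUP k\<in>?K. arc_avg k f x)\<^sup>2 \<partial>lborel) \<le> (\<integral>\<^sup>+x. 2 * (ennreal mass * ?b x)\<^sup>2
        + ((\<Sum>k\<in>?K. 4 * ennreal ((defect k h x)\<^sup>2)) + (\<Sum>k\<in>?K. 4 * (?c k x)\<^sup>2)) \<partial>lborel)"
      by (rule nn_integral_mono)
    also have "\<dots> = 2 * (ennreal mass)\<^sup>2 * (\<integral>\<^sup>+x. (?b x)\<^sup>2 \<partial>lborel)
        + ((\<Sum>k\<in>?K. 4 * (\<integral>\<^sup>+x. ennreal ((defect k h x)\<^sup>2) \<partial>lborel)) + (\<Sum>k\<in>?K. 4 * (\<integral>\<^sup>+x. (?c k x)\<^sup>2 \<partial>lborel)))"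
      by (simp add: nn_integral_add nn_integral_sum nn_integral_cmult power_mult_distrib mult.assoc)
    also have "\<dots> \<le> 2 * (ennreal mass)\<^sup>2 * (ennreal C1 * ennreal (\<integral>x. (h x)\<^sup>2 \<partial>lborel))
        + (4 * ennreal (C2 * (\<integral>x. (h x)\<^sup>2 \<partial>lborel)) + (\<Sum>k\<in>?K. 4 * ((ennreal mass)\<^sup>2 * ennreal (\<integral>x. (f x - h x)\<^sup>2 \<partial>lborel))))"
    proof (intro add_mono mult_left_mono sum_mono)
      show "(\<integral>\<^sup>+x. (?b x)\<^sup>2 \<partial>lborel) \<le> ennreal C1 * ennreal (\<integral>x. (h x)\<^sup>2 \<partial>lborel)"
        using C1(2)[of "\<lambda>z. ennreal \<bar>h z\<bar>" n] by (simp add: hsq)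
      have "(\<Sum>k\<in>?K. 4 * (\<integral>\<^sup>+x. ennreal ((defect k h x)\<^sup>2) \<partial>lborel)) = 4 * ennreal (\<Sum>k\<in>?K. \<integral>x. (defect k h x)\<^sup>2 \<partial>lborel)"
        by (simp add: nn_integral_eq_integral[OF d2] sum_distrib_left[symmetric] sum_ennreal)
      also have "\<dots> \<le> 4 * ennreal (C2 * (\<integral>x. (h x)\<^sup>2 \<partial>lborel))"
        by (intro mult_left_mono ennreal_leI defect_square_sum C2 h) auto
      finally show "(\<Sum>k\<in>?K. 4 * (\<integral>\<^sup>+x. ennreal ((defect k h x)\<^sup>2) \<partial>lborel)) \<le> 4 * ennreal (C2 * (\<integral>x. (h x)\<^sup>2 \<partial>lborel))" .
      show "(\<integral>\<^sup>+x. (?c k x)\<^sup>2 \<partial>lborel) \<le> (ennreal mass)\<^sup>2 * ennreal (\<integral>x. (f x - h x)\<^sup>2 \<partial>lborel)" for k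
        using arc_avg_square_le[of "\<lambda>z. \<bar>f z - h z\<bar>" k] by (simp add: fhsq)
    qed auto
    also have "\<dots> = ennreal ((2 * mass\<^sup>2 * C1 + 4 * C2) * (\<integral>x. (h x)\<^sup>2 \<partial>lborel) + 4 * real (card ?K) * mass\<^sup>2 * (\<integral>x. (f x - h x)\<^sup>2 \<partial>lborel))"
    proof -
      define X where "X = (\<integral>x. (h x)\<^sup>2 \<partial>lborel)"
      define Y where "Y = (\<integral>x. (f x - h x)\<^sup>2 \<partial>lborel)"
      define N where "N = real (card ?K)"
      have X: "0 \<le> X" "0 \<le> Y" "0 \<le> N" by (auto simp: X_def Y_def N_def)
      have s: "(\<Sum>k\<in>?K. 4 * ((ennreal mass)\<^sup>2 * ennreal Y)) = ennreal (N * (4 * (mass\<^sup>2 * Y)))"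
        using X m0 by (simp only: sum_constant N_def ennreal_of_nat_eq_real_of_nat ennreal_power ennreal_mult mult_nonneg_nonneg zero_le_power ennreal_numeral[symmetric] zero_le_numeral of_nat_0_le_iff)
      have "2 * (ennreal mass)\<^sup>2 * (ennreal C1 * ennreal X) + (4 * ennreal (C2 * X) + (\<Sum>k\<in>?K. 4 * ((ennreal mass)\<^sup>2 * ennreal Y)))
        = ennreal (2 * mass\<^sup>2 * (C1 * X) + (4 * (C2 * X) + N * (4 * (mass\<^sup>2 * Y))))"
        unfolding s using X m0 C1(1) C2(1)
        by (simp only: ennreal_power ennreal_mult ennreal_plus mult_nonneg_nonneg add_nonneg_nonneg zero_le_power ennreal_numeral[symmetric] zero_le_numeral)
      also have "2 * mass\<^sup>2 * (C1 * X) + (4 * (C2 * X) + N * (4 * (mass\<^sup>2 * Y))) = (2 * mass\<^sup>2 * C1 + 4 * C2) * X + 4 * N * mass\<^sup>2 * Y"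
        by (simp add: algebra_simps)
      finally show ?thesis by (simp only: X_def Y_def N_def)
    qed
    finally show ?thesis .
  qed
  obtain h where h: "\<And>j. Cc (h j)" "(\<lambda>j. \<integral>x. (h j x)\<^sup>2 \<partial>lborel) \<longlonglongrightarrow> (\<integral>x. (f x)\<^sup>2 \<partial>lborel)"
      "(\<lambda>j. \<integral>x. (f x - h j x)\<^sup>2 \<partial>lborel) \<longlonglongrightarrow> 0"
    by (rule Cc_approximation[of f B R]) (use f in auto)
  \<comment> \<open>The error term with the factor \<open>card\<close> of the scales disappears in
    the limit, which leaves a constant independent of \<open>n\<close>.\<close>
  have lim: "(\<lambda>j. ennreal ((2 * mass\<^sup>2 * C1 + 4 * C2) * (\<integral>x. (h j x)\<^sup>2 \<partial>lborel) + 4 * real (card ?K) * mass\<^sup>2 * (\<integral>x. (f x - h j x)\<^sup>2 \<partial>lborel)))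
      \<longlonglongrightarrow> ennreal ((2 * mass\<^sup>2 * C1 + 4 * C2) * (\<integral>x. (f x)\<^sup>2 \<partial>lborel) + 4 * real (card ?K) * mass\<^sup>2 * 0)"
    by (intro tendsto_ennrealI tendsto_add tendsto_mult tendsto_const h)
  have "(\<integral>\<^sup>+x. (SUP k\<in>?K. arc_avg k f x)\<^sup>2 \<partial>lborel)
     \<le> ennreal ((2 * mass\<^sup>2 * C1 + 4 * C2) * (\<integral>x. (f x)\<^sup>2 \<partial>lborel) + 4 * real (card ?K) * mass\<^sup>2 * 0)"
    by (rule LIMSEQ_le_const[OF lim]) (use step[OF h(1)] in auto)
  also have "\<dots> = ennreal (2 * mass\<^sup>2 * C1 + 4 * C2) * ennreal (\<integral>x. (f x)\<^sup>2 \<partial>lborel)"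
    using C1(1) C2(1) by (simp add: ennreal_mult)
  also have "ennreal (\<integral>x. (f x)\<^sup>2 \<partial>lborel) = (\<integral>\<^sup>+x. ennreal ((f x)\<^sup>2) \<partial>lborel)"
  proof (rule nn_integral_eq_integral[symmetric])
    show "integrable lborel (\<lambda>x. (f x)\<^sup>2)"
    proof (rule integrable_bounded_support)
      show "norm ((f x)\<^sup>2) \<le> B\<^sup>2" for x using f(1,2)[of x] by (simp add: power_mono)
      show "(f x)\<^sup>2 = 0" if "R < norm x" for x using f(3)[OF that] by simp
    qed measurable
  qed simp
  finally show ?thesis .
qed

text \<open>A single index \<open>n\<close> governs the range of scales and the truncation of
  \<open>\<bar>f\<bar>\<close> in size and support. Everything increases with \<open>n\<close>, so
  monotone convergence passes the uniform bound to the full operator.\<close>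

lemma L2_bounded_of_integral_bound:
  assumes G: "\<And>v. norm v = 1 \<Longrightarrow> (\<integral>\<^sup>+d. ennreal ((Lambda \<Omega> v d)\<^sup>2 / d) * indicator {0<..<2 * pi} d \<partial>lborel) \<le> ennreal G"
    and G0: "0 \<le> G"
  shows "L2_bounded \<Omega>"
proof -
  obtain C1 where C1: "0 \<le> C1" "\<And>n h. h \<in> borel_measurable borel \<Longrightarrow> (\<integral>\<^sup>+x. (h x)\<^sup>2 \<partial>lborel) < \<infinity> \<Longrightarrow>
     (\<integral>\<^sup>+x. (dyadic_max n h x)\<^sup>2 \<partial>lborel) \<le> ennreal C1 * (\<integral>\<^sup>+x. (h x)\<^sup>2 \<partial>(lborel::(real^2) measure))"
    using dyadic_max_bound[where 'a="real^2"] by blast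
  obtain C2 where C2: "0 \<le> C2" "\<And>\<xi> F. finite F \<Longrightarrow> (\<Sum>k\<in>F. (cmod (nu_hat (2 powr real_of_int k *\<^sub>R \<xi>)))\<^sup>2) \<le> C2"
    using multiplier_bound[OF G G0] by blast
  define C where "C = 2 * mass\<^sup>2 * C1 + 4 * C2"
  have "(\<integral>\<^sup>+x. (maxop \<Omega> f x)\<^sup>2 \<partial>lborel) \<le> ennreal C * (\<integral>\<^sup>+x. ennreal ((f x)\<^sup>2) \<partial>lborel)"
    if "f \<in> borel_measurable lborel" for f
  proof -
    have [measurable]: "f \<in> borel_measurable borel" using that by simp
    define fn where "fn n x = (if \<bar>f x\<bar> \<le> real n \<and> norm x \<le> real n then \<bar>f x\<bar> else 0)" for n :: nat and x
    have [measurable]: "fn n \<in> borel_measurable borel" for n unfolding fn_def by measurable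
    have fn_mono: "m \<le> n \<Longrightarrow> fn m x \<le> fn n x" for m n x by (auto simp: fn_def)
    have fn_sup: "(SUP n. ennreal (fn n x)) = ennreal \<bar>f x\<bar>" for x
    proof (rule antisym)
      show "(SUP n. ennreal (fn n x)) \<le> ennreal \<bar>f x\<bar>" by (intro SUP_least ennreal_leI) (simp add: fn_def)
      obtain n :: nat where "max \<bar>f x\<bar> (norm x) \<le> real n" using real_arch_simple by blast
      then have "fn n x = \<bar>f x\<bar>" by (simp add: fn_def)
      then show "ennreal \<bar>f x\<bar> \<le> (SUP n. ennreal (fn n x))" by (metis SUP_upper UNIV_I)
    qed
    have avg_mono: "m \<le> n \<Longrightarrow> arc_avg k (fn m) x \<le> arc_avg k (fn n) x" for m n k x
      unfolding arc_avg_def by (intro nn_integral_mono ennreal_leI fn_mono)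
    define S where "S n x = (SUP k\<in>{- int n..int n}. arc_avg k (fn n) x)" for n x
    have [measurable]: "S n \<in> borel_measurable borel" for n
      unfolding S_def by (intro borel_measurable_SUP measurable_arc_avg) auto
    have S_mono: "m \<le> n \<Longrightarrow> S m x \<le> S n x" for m n x
      unfolding S_def by (intro SUP_mono) (auto intro!: avg_mono)
    have "maxop \<Omega> f x \<le> (SUP n. S n x)" for x
      unfolding maxop_def
    proof (rule SUP_least)
      fix k :: int
      let ?g = "\<lambda>y. f (x - (2 powr real_of_int k) *\<^sub>R y)"
      have "ennreal \<bar>integral\<^sup>L \<sigma> ?g\<bar> \<le> (\<integral>\<^sup>+y. ennreal \<bar>?g y\<bar> \<partial>\<sigma>)"
      \<comment> \<open>Where the average is not integrable, \<open>maxop\<close> takes the Bochner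
        integral 0, which satisfies the bound.\<close>
      proof (cases "integrable \<sigma> ?g")
        case True
        then show ?thesis using integral_norm_bound_ennreal[OF True] by simp
      next
        case False
        then show ?thesis by (simp add: not_integrable_integral_eq)
      qed
      also have "\<dots> = (\<integral>\<^sup>+y. (SUP n. ennreal (fn n (x - (2 powr real_of_int k) *\<^sub>R y))) \<partial>\<sigma>)"
        by (simp add: fn_sup)
      also have "\<dots> = (SUP n. arc_avg k (fn n) x)"
        unfolding arc_avg_def
        by (intro nn_integral_monotone_convergence_SUP) (auto simp: incseq_def le_fun_def intro!: ennreal_leI fn_mono)
      also have "\<dots> \<le> (SUP n. S n x)"
      proof (rule SUP_least)
        fix n :: nat
        have "arc_avg k (fn n) x \<le> arc_avg k (fn (max n (nat \<bar>k\<bar>))) x" by (intro avg_mono) simp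
        also have "\<dots> \<le> S (max n (nat \<bar>k\<bar>)) x" unfolding S_def by (intro SUP_upper) auto
        also have "\<dots> \<le> (SUP n. S n x)" by (rule SUP_upper) simp
        finally show "arc_avg k (fn n) x \<le> (SUP n. S n x)" .
      qed
      finally show "ennreal \<bar>integral\<^sup>L \<sigma> ?g\<bar> \<le> (SUP n. S n x)" .
    qed
    then have "(maxop \<Omega> f x)\<^sup>2 \<le> (SUP n. (S n x)\<^sup>2)" for x
      by (rule order_trans[OF power_mono_ennreal SUP_square_ennreal_le]) (auto simp: incseq_def S_mono)
    then have "(\<integral>\<^sup>+x. (maxop \<Omega> f x)\<^sup>2 \<partial>lborel) \<le> (\<integral>\<^sup>+x. (SUP n. (S n x)\<^sup>2) \<partial>lborel)"
      by (rule nn_integral_mono)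
    also have "\<dots> = (SUP n. \<integral>\<^sup>+x. (S n x)\<^sup>2 \<partial>lborel)"
      by (intro nn_integral_monotone_convergence_SUP) (auto simp: incseq_def le_fun_def intro!: power_mono_ennreal S_mono)
    also have "\<dots> \<le> ennreal C * (\<integral>\<^sup>+x. ennreal ((f x)\<^sup>2) \<partial>lborel)"
    proof (rule SUP_least)
      fix n
      have "(\<integral>\<^sup>+x. (S n x)\<^sup>2 \<partial>lborel) \<le> ennreal C * (\<integral>\<^sup>+x. ennreal ((fn n x)\<^sup>2) \<partial>lborel)"
        unfolding S_def C_def
        by (rule truncated_maximal_bound[OF C1 C2, where B="real n" and R="real n"]) (auto simp: fn_def[of n] intro: C1 C2)
      also have "\<dots> \<le> ennreal C * (\<integral>\<^sup>+x. ennreal ((f x)\<^sup>2) \<partial>lborel)"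
        by (intro mult_left_mono nn_integral_mono ennreal_leI) (auto simp: fn_def)
      finally show "(\<integral>\<^sup>+x. (S n x)\<^sup>2 \<partial>lborel) \<le> ennreal C * (\<integral>\<^sup>+x. ennreal ((f x)\<^sup>2) \<partial>lborel)" .
    qed
    finally show ?thesis .
  qed
  then show ?thesis unfolding L2_bounded_def by blast
qed

end

section \<open>Necessity\<close>

text \<open>An orthogonal transformation carries a coordinate box to the tilted rectangle and
  preserves its area.\<close>

lemma emeasure_rectangle:
  assumes uv: "onb u v" and ab: "a \<le> b" "c \<le> d"
  shows "emeasure lborel {x. a \<le> x \<bullet> v \<and> x \<bullet> v \<le> b \<and> c \<le> x \<bullet> u \<and> x \<bullet> u \<le> d} = ennreal ((b - a) * (d - c))"
proof -
  define T :: "real^2 \<Rightarrow> real^2" where "T y = (y $ 1) *\<^sub>R v + (y $ 2) *\<^sub>R u" for y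
  have e: "u \<bullet> u = 1" "v \<bullet> v = 1" "u \<bullet> v = 0" "v \<bullet> u = 0"
    using uv by (auto simp: onb_def norm_eq_1 inner_commute)
  have T_inner: "T x \<bullet> T y = x $ 1 * y $ 1 + x $ 2 * y $ 2" for x y
    by (simp add: T_def inner_add_left inner_add_right e)
  have T: "orthogonal_transformation T"
    unfolding orthogonal_transformation_def
  proof
    show "linear T" by (rule linearI) (auto simp: T_def algebra_simps)
    have "x \<bullet> y = x $ 1 * y $ 1 + x $ 2 * y $ 2" for x y :: "real^2" by (simp add: inner_vec_def sum_2)
    then show "\<forall>x y. T x \<bullet> T y = x \<bullet> y"
      by (metis (no_types, lifting) T_inner)
  qed
  let ?Q = "{x. a \<le> x \<bullet> v \<and> x \<bullet> v \<le> b \<and> c \<le> x \<bullet> u \<and> x \<bullet> u \<le> d}"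
  let ?C = "cbox (vector [a, c]) (vector [b, d]) :: (real^2) set"
  have "?Q = T ` ?C"
  proof (intro equalityI subsetI)
    fix x assume x: "x \<in> ?Q"
    have "x = T (vector [x \<bullet> v, x \<bullet> u])" using uv by (auto simp: T_def onb_def add.commute)
    moreover have "vector [x \<bullet> v, x \<bullet> u] \<in> ?C" using x by (simp add: mem_box_cart forall_2)
    ultimately show "x \<in> T ` ?C" by blast
  qed (auto simp: T_def inner_add_left e mem_box_cart forall_2)
  then have "measure lebesgue ?Q = measure lebesgue ?C"
    using measure_orthogonal_image[OF T, of ?C] by simp
  also have "\<dots> = (b - a) * (d - c)"
  proof -
    have "?C \<noteq> {}" using ab by (simp add: interval_ne_empty_cart forall_2)
    then show ?thesis by (simp add: content_cbox_cart UNIV_2)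
  qed
  finally have m: "measure lebesgue ?Q = (b - a) * (d - c)" .
  have eq: "?Q = {x. a \<le> v \<bullet> x} \<inter> {x. v \<bullet> x \<le> b} \<inter> {x. c \<le> u \<bullet> x} \<inter> {x. u \<bullet> x \<le> d}"
    by (auto simp: inner_commute)
  have Q: "closed ?Q" unfolding eq by (intro closed_Int closed_halfspace_le closed_halfspace_ge)
  have "bounded ?Q"
    unfolding \<open>?Q = T ` ?C\<close> using T
    by (intro bounded_linear_image bounded_cbox linear_conv_bounded_linear[THEN iffD1] orthogonal_transformation_linear)
  then have "emeasure lborel ?Q = ennreal (measure lborel ?Q)"
    using emeasure_bounded_finite by (intro emeasure_eq_ennreal_measure) (simp add: less_top)
  then show ?thesis using m Q by (simp add: borel_closed)
qed

text \<open>For \<open>t \<ge> e\<close> the integrand is at most \<open>M / e\<close>, so enlarging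
  the upper limit costs a bounded amount.\<close>

lemma nn_integral_log_extend:
  fixes H :: "real \<Rightarrow> real"
  assumes [measurable]: "H \<in> borel_measurable borel" and H: "\<And>t. 0 \<le> H t" "\<And>t. H t \<le> M" and e: "0 < e" and T: "0 \<le> T"
  shows "(\<integral>\<^sup>+t. ennreal (H t / t) * indicator {0<..<T} t \<partial>lborel)
      \<le> (\<integral>\<^sup>+t. ennreal (H t / t) * indicator {0<..<e} t \<partial>lborel) + ennreal (M * T / e)"
proof -
  have M0: "0 \<le> M" using H[of 0] by simp
  have "(\<integral>\<^sup>+t. ennreal (H t / t) * indicator {0<..<T} t \<partial>lborel)
      \<le> (\<integral>\<^sup>+t. ennreal (H t / t) * indicator {0<..<e} t + ennreal (M / e) * indicator {0..T} t \<partial>lborel)"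
  proof (intro nn_integral_mono)
    fix t
    show "ennreal (H t / t) * indicator {0<..<T} t \<le> ennreal (H t / t) * indicator {0<..<e} t + ennreal (M / e) * indicator {0..T} t"
    proof (cases "0 < t \<and> t < T")
      case True
      have "H t / t \<le> M / e" if "e \<le> t" using H M0 e that by (intro frac_le) auto
      then show ?thesis using True by (cases "t < e") (auto simp: ennreal_leI add_increasing2)
    qed auto
  qed
  also have "\<dots> = (\<integral>\<^sup>+t. ennreal (H t / t) * indicator {0<..<e} t \<partial>lborel) + ennreal (M / e) * ennreal T"
    using T by (simp add: nn_integral_add nn_integral_cmult)
  also have "ennreal (M / e) * ennreal T = ennreal (M * T / e)"
    using M0 e T by (simp flip: ennreal_mult)
  finally show ?thesis .
qed

text \<open>On the interval from \<open>e / 2 ^ Suc k\<close> to \<open>e / 2 ^ k\<close> the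
  integrand is at most \<open>H (e / 2 ^ k)\<close> divided by the left endpoint, which equals the
  length of the interval. The constant is therefore exactly 1.\<close>

lemma nn_integral_log_le_dyadic_sum:
  fixes H :: "real \<Rightarrow> real"
  assumes H: "mono H" "\<And>t. 0 \<le> H t" and e: "0 < e"
    and S: "\<And>K. (\<Sum>k\<le>K. H (e / 2 ^ k)) \<le> S"
  shows "(\<integral>\<^sup>+t. ennreal (H t / t) * indicator {0<..<e} t \<partial>lborel) \<le> ennreal S"
proof -
  have [measurable]: "H \<in> borel_measurable borel" by (rule borel_measurable_mono[OF H(1)])
  define I where "I k = {e / 2 ^ Suc k<..e / 2 ^ k}" for k :: nat
  define w where "w k = H (e / 2 ^ k) / (e / 2 ^ Suc k)" for k :: nat
  have ek: "0 < e / 2 ^ k" for k :: nat using e by simp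
  have w0: "0 \<le> w k" for k unfolding w_def using H(2) ek[of "Suc k"] by (intro divide_nonneg_pos) auto
  have "(\<integral>\<^sup>+t. ennreal (H t / t) * indicator {0<..<e} t \<partial>lborel) \<le> (\<integral>\<^sup>+t. (\<Sum>k. ennreal (w k) * indicator (I k) t) \<partial>lborel)"
  proof (intro nn_integral_mono)
    fix t
    show "ennreal (H t / t) * indicator {0<..<e} t \<le> (\<Sum>k. ennreal (w k) * indicator (I k) t)"
    proof (cases "0 < t \<and> t < e")
      case True
      obtain m where "e / t < 2 ^ m" using real_arch_pow[of 2 "e / t"] by auto
      then have ex: "e / 2 ^ m < t" using True by (simp add: field_simps)
      define p where "p = (LEAST m. e / 2 ^ m < t)"
      have p: "e / 2 ^ p < t" unfolding p_def using ex by (rule LeastI)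
      have "p \<noteq> 0" using p True by (intro notI) simp
      then obtain k where k: "p = Suc k" by (cases p) auto
      have "\<not> e / 2 ^ k < t" using not_less_Least[of k "\<lambda>m. e / 2 ^ m < t"] k by (auto simp: p_def)
      then have t: "t \<in> I k" using p k by (auto simp: I_def)
      have "H t / t \<le> w k"
        unfolding w_def using t ek[of "Suc k"] H by (intro frac_le monoD[OF H(1)]) (auto simp: I_def)
      then have "ennreal (H t / t) * indicator {0<..<e} t \<le> ennreal (w k) * indicator (I k) t"
        using True t by (simp add: ennreal_leI)
      also have "\<dots> \<le> (\<Sum>k. ennreal (w k) * indicator (I k) t)"
      proof -
        define F where "F i = ennreal (w i) * indicator (I i) t" for i
        have "F k \<le> (\<Sum>i. F i)" using sum_le_suminf[of F "{k}"] by simp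
        then show ?thesis by (simp only: F_def)
      qed
      finally show ?thesis .
    qed auto
  qed
  also have "\<dots> = (\<Sum>k. ennreal (w k) * emeasure lborel (I k))"
    by (subst nn_integral_suminf) (auto simp: I_def nn_integral_cmult)
  also have "\<dots> = (\<Sum>k. ennreal (H (e / 2 ^ k)))"
  proof -
    have "ennreal (w k) * emeasure lborel (I k) = ennreal (H (e / 2 ^ k))" for k
    proof -
      have "emeasure lborel (I k) = ennreal (e / 2 ^ Suc k)"
        using e by (simp add: I_def field_simps)
      then have "ennreal (w k) * emeasure lborel (I k) = ennreal (w k * (e / 2 ^ Suc k))"
        using ennreal_mult[OF w0[of k] less_imp_le[OF ek[of "Suc k"]]] by (simp only:)
      also have "w k * (e / 2 ^ Suc k) = H (e / 2 ^ k)" using e by (simp add: w_def)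
      finally show ?thesis .
    qed
    then show ?thesis by simp
  qed
  also have "\<dots> \<le> ennreal S"
  proof (rule suminf_le_const[OF summableI])
    fix n
    have "(\<Sum>k<n. ennreal (H (e / 2 ^ k))) \<le> (\<Sum>k\<le>n. ennreal (H (e / 2 ^ k)))" by (intro sum_mono2) auto
    also have "\<dots> = ennreal (\<Sum>k\<le>n. H (e / 2 ^ k))" using H(2) by simp
    also have "\<dots> \<le> ennreal S" by (intro ennreal_leI S)
    finally show "(\<Sum>k<n. ennreal (H (e / 2 ^ k))) \<le> ennreal S" .
  qed
  finally show ?thesis .
qed

section \<open>Testing the maximal operator on rectangles\<close>

context convex_domain
begin

text \<open>The strip is cut to a rectangle \<open>Q\<close> to be of finite measure. It is twice as
  wide in both directions as the sets \<open>E k\<close> on which the maximal function is estimated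
  from below, so the constant is the ratio 4 of the areas, whatever \<open>K\<close> is.\<close>

lemma cap_mass_dyadic_sum_le:
  assumes L2: "\<And>f. f \<in> borel_measurable lborel \<Longrightarrow> integrable lborel (\<lambda>x. (f x)\<^sup>2) \<Longrightarrow>
      (\<integral>\<^sup>+x. (maxop \<Omega> f x)\<^sup>2 \<partial>lborel) \<le> ennreal C * (\<integral>\<^sup>+x. ennreal ((f x)\<^sup>2) \<partial>lborel)"
    and C: "0 \<le> C" and v: "norm v = 1" and e: "0 < e" "e < supp v"
  shows "(\<Sum>k\<le>K. (cap_mass v (e / 2 ^ k))\<^sup>2) \<le> 4 * C"
proof -
  define u where "u = perp v"
  have uv: "onb u v" unfolding u_def by (rule onb_perp[OF v])
  obtain D where D: "0 \<le> D" "\<And>p. p \<in> frontier \<Omega> \<Longrightarrow> norm p \<le> D" using frontier_norm_bound by blast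
  \<comment> \<open>Dominates the displacement along \<open>u\<close> of every dilate
    \<open>2 ^ k\<close> of the boundary with \<open>k \<le> K\<close>. Points of
    \<open>E k\<close>, within \<open>R\<close> of the axis, are thus carried to points within
    \<open>2 * R\<close>.\<close>
  define R where "R = 2 ^ K * D + 1"
  have R: "0 < R" using D by (simp add: R_def add_nonneg_pos)
  define Q where "Q = {x. - e \<le> x \<bullet> v \<and> x \<bullet> v \<le> e \<and> - (2 * R) \<le> x \<bullet> u \<and> x \<bullet> u \<le> 2 * R}"
  define E where "E k = {x. 2 ^ k * supp v - e \<le> x \<bullet> v \<and> x \<bullet> v \<le> 2 ^ k * supp v \<and> - R \<le> x \<bullet> u \<and> x \<bullet> u \<le> R}" for k :: nat
  have [measurable]: "Q \<in> sets borel" "E k \<in> sets borel" for k unfolding Q_def E_def by measurable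
  have emQ: "emeasure lborel Q = ennreal (8 * e * R)"
    unfolding Q_def using e R by (subst emeasure_rectangle[OF uv]) (auto simp: algebra_simps)
  have emE: "emeasure lborel (E k) = ennreal (2 * e * R)" for k
    unfolding E_def using e R by (subst emeasure_rectangle[OF uv]) (auto simp: algebra_simps)
  define f :: "real^2 \<Rightarrow> real" where "f = indicator Q"
  have [measurable]: "f \<in> borel_measurable borel" unfolding f_def by measurable
  have f2: "(f x)\<^sup>2 = indicator Q x" for x by (simp add: f_def indicator_def)
  have lower: "ennreal (cap_mass v (e / 2 ^ k)) \<le> maxop \<Omega> f x" if k: "k \<le> K" and x: "x \<in> E k" for k x
  proof -
    let ?cap = "{y \<in> frontier \<Omega>. supp v - e / 2 ^ k \<le> y \<bullet> v}"
    have two: "2 powr real_of_int (int k) = 2 ^ k" by (simp add: powr_realpow)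
    have "indicator ?cap y \<le> f (x - (2 ^ k) *\<^sub>R y)" for y
    proof (cases "y \<in> ?cap")
      case True
      have yv: "y \<bullet> v \<le> supp v" using True by (intro supp_ge) (auto simp: frontier_eq)
      have 1: "2 ^ k * (y \<bullet> v) \<le> 2 ^ k * supp v" using yv by (intro mult_left_mono) auto
      have "2 ^ k * (supp v - e / 2 ^ k) \<le> 2 ^ k * (y \<bullet> v)" using True by (intro mult_left_mono) auto
      then have 2: "2 ^ k * supp v - e \<le> 2 ^ k * (y \<bullet> v)" by (simp add: algebra_simps)
      have "\<bar>y \<bullet> u\<bar> \<le> norm y * norm u" by (rule Cauchy_Schwarz_ineq2)
      also have "\<dots> \<le> D" using D(2)[of y] True uv by (simp add: onb_def)
      finally have "2 ^ k * \<bar>y \<bullet> u\<bar> \<le> 2 ^ K * D" using k D by (intro mult_mono) auto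
      then have 3: "\<bar>2 ^ k * (y \<bullet> u)\<bar> \<le> R" by (simp add: R_def abs_mult)
      have "x - (2 ^ k) *\<^sub>R y \<in> Q"
      proof -
        define s t where "s = 2 ^ k * (y \<bullet> v)" and "t = 2 ^ k * (y \<bullet> u)"
        have "(x - (2 ^ k) *\<^sub>R y) \<bullet> v = x \<bullet> v - s" "(x - (2 ^ k) *\<^sub>R y) \<bullet> u = x \<bullet> u - t"
          by (simp_all add: s_def t_def inner_diff_left)
        moreover have "2 ^ k * supp v - e \<le> x \<bullet> v" "x \<bullet> v \<le> 2 ^ k * supp v" "- R \<le> x \<bullet> u" "x \<bullet> u \<le> R"
          using x by (auto simp: E_def)
        ultimately show ?thesis
          unfolding Q_def using 1 2 3 unfolding s_def[symmetric] t_def[symmetric] by (simp add: abs_le_iff)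
      qed
      then show ?thesis by (simp add: f_def indicator_def)
    qed (simp add: f_def)
    then have "(\<integral>y. indicator ?cap y \<partial>\<sigma>) \<le> (\<integral>y. f (x - (2 ^ k) *\<^sub>R y) \<partial>\<sigma>)"
    proof (intro integral_mono)
      show "integrable \<sigma> (indicator ?cap :: _ \<Rightarrow> real)" by (intro arc.integrable_const_bound[of _ 1]) (auto simp: indicator_def)
      show "integrable \<sigma> (\<lambda>y. f (x - (2 ^ k) *\<^sub>R y))"
        by (intro arc.integrable_const_bound[of _ 1]) (auto simp: f_def indicator_def)
    qed
    then have "cap_mass v (e / 2 ^ k) \<le> (\<integral>y. f (x - (2 ^ k) *\<^sub>R y) \<partial>\<sigma>)" by (simp add: cap_mass_def)
    then have "ennreal (cap_mass v (e / 2 ^ k)) \<le> ennreal \<bar>\<integral>y. f (x - (2 powr real_of_int (int k)) *\<^sub>R y) \<partial>\<sigma>\<bar>"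
      unfolding two by (intro ennreal_leI) simp
    also have "\<dots> \<le> maxop \<Omega> f x" unfolding maxop_def by (rule SUP_upper) simp
    finally show ?thesis .
  qed
  \<comment> \<open>Consecutive dilates of the supporting line are at least \<open>supp v\<close>
    apart, and \<open>e < supp v\<close>.\<close>
  have disj: "E j \<inter> E k = {}" if "j < k" for j k
  proof -
    have "2 ^ Suc j * supp v \<le> 2 ^ k * supp v" using that e by (intro mult_right_mono power_increasing) auto
    moreover have "1 * supp v \<le> 2 ^ j * supp v" using e by (intro mult_right_mono) auto
    moreover have "2 ^ Suc j * supp v = 2 ^ j * supp v + 2 ^ j * supp v" by simp
    ultimately have "2 ^ j * supp v < 2 ^ k * supp v - e" using e by linarith
    then show ?thesis by (auto simp: E_def)
  qed
  have "(\<Sum>k\<le>K. ennreal ((cap_mass v (e / 2 ^ k))\<^sup>2) * indicator (E k) x) \<le> (maxop \<Omega> f x)\<^sup>2" for x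
  proof (cases "\<exists>j\<le>K. x \<in> E j")
    case True
    then obtain j where j: "j \<le> K" "x \<in> E j" by blast
    have "x \<notin> E k" if "k \<noteq> j" for k using disj[of j k] disj[of k j] j that by (cases "j < k") auto
    then have "(\<Sum>k\<le>K. ennreal ((cap_mass v (e / 2 ^ k))\<^sup>2) * indicator (E k) x)
        = (\<Sum>k\<in>{j}. ennreal ((cap_mass v (e / 2 ^ k))\<^sup>2) * indicator (E k) x)"
      using j by (intro sum.mono_neutral_right) auto
    also have "\<dots> = (ennreal (cap_mass v (e / 2 ^ j)))\<^sup>2" using j by (simp add: ennreal_power)
    also have "\<dots> \<le> (maxop \<Omega> f x)\<^sup>2" by (intro power_mono_ennreal lower j)
    finally show ?thesis .
  next
    case False
    then have "(\<Sum>k\<le>K. ennreal ((cap_mass v (e / 2 ^ k))\<^sup>2) * indicator (E k) x) = 0" by (intro sum.neutral) auto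
    then show ?thesis by simp
  qed
  then have "(\<integral>\<^sup>+x. (\<Sum>k\<le>K. ennreal ((cap_mass v (e / 2 ^ k))\<^sup>2) * indicator (E k) x) \<partial>lborel) \<le> (\<integral>\<^sup>+x. (maxop \<Omega> f x)\<^sup>2 \<partial>lborel)"
    by (rule nn_integral_mono)
  also have "\<dots> \<le> ennreal C * (\<integral>\<^sup>+x. ennreal ((f x)\<^sup>2) \<partial>lborel)"
  proof (rule L2)
    show "integrable lborel (\<lambda>x. (f x)\<^sup>2)" unfolding f2 using emQ by (intro integrable_real_indicator) auto
  qed simp
  also have "(\<integral>\<^sup>+x. ennreal ((f x)\<^sup>2) \<partial>lborel) = ennreal (8 * e * R)"
    unfolding f2 ennreal_indicator by (simp add: emQ)
  also have "(\<integral>\<^sup>+x. (\<Sum>k\<le>K. ennreal ((cap_mass v (e / 2 ^ k))\<^sup>2) * indicator (E k) x) \<partial>lborel)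
      = (\<Sum>k\<le>K. ennreal ((cap_mass v (e / 2 ^ k))\<^sup>2) * ennreal (2 * e * R))"
    by (subst nn_integral_sum) (auto simp: nn_integral_cmult emE)
  also have "\<dots> = ennreal ((\<Sum>k\<le>K. (cap_mass v (e / 2 ^ k))\<^sup>2) * (2 * e * R))"
    using e R by (simp add: sum_distrib_right sum_ennreal flip: ennreal_mult)
  also have "ennreal C * ennreal (8 * e * R) = ennreal (C * (8 * e * R))"
    using C e R by (intro ennreal_mult[symmetric]) auto
  finally have "(\<Sum>k\<le>K. (cap_mass v (e / 2 ^ k))\<^sup>2) * (2 * e * R) \<le> (4 * C) * (2 * e * R)"
    using C e R by (subst (asm) ennreal_le_iff) (auto simp: algebra_simps)
  then show ?thesis using e R by (simp add: mult_le_cancel_right)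
qed

lemma integral_bound_of_L2_bounded:
  assumes "L2_bounded \<Omega>" and T: "0 < T"
  shows "\<exists>G. \<forall>v. norm v = 1 \<longrightarrow>
    (\<integral>\<^sup>+d. ennreal ((Lambda \<Omega> v d)\<^sup>2 / d) * indicator {0<..<T} d \<partial>lborel) \<le> ennreal G"
proof -
  obtain C0 where C0: "\<And>f. f \<in> borel_measurable lborel \<Longrightarrow> integrable lborel (\<lambda>x. (f x)\<^sup>2) \<Longrightarrow>
      (\<integral>\<^sup>+x. (maxop \<Omega> f x)\<^sup>2 \<partial>lborel) \<le> ennreal C0 * (\<integral>\<^sup>+x. ennreal ((f x)\<^sup>2) \<partial>lborel)"
    using assms(1) unfolding L2_bounded_def by blast
  \<comment> \<open>The constant in \<open>L2_bounded\<close> may be a negative real, which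
    \<open>ennreal\<close> sends to 0.\<close>
  define C where "C = max 0 C0"
  have C: "0 \<le> C" by (simp add: C_def)
  have L2: "(\<integral>\<^sup>+x. (maxop \<Omega> f x)\<^sup>2 \<partial>lborel) \<le> ennreal C * (\<integral>\<^sup>+x. ennreal ((f x)\<^sup>2) \<partial>lborel)"
    if "f \<in> borel_measurable lborel" "integrable lborel (\<lambda>x. (f x)\<^sup>2)" for f
    using C0[OF that] by (rule order_trans) (auto intro!: mult_right_mono ennreal_leI simp: C_def)
  \<comment> \<open>A disc around the origin inside the domain gives one starting height
    \<open>r\<close> below the support function in all directions, so the bound is uniform in
    \<open>v\<close>.\<close>
  obtain r where r: "0 < r" "cball 0 r \<subseteq> \<Omega>" using op zero by (meson open_contains_cball)
  have supp_r: "r < supp v" if v: "norm v = 1" for v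
  proof -
    have "r *\<^sub>R v \<in> \<Omega>" using r v by (intro subsetD[OF r(2)]) simp
    then have "(r *\<^sub>R v) \<bullet> v < supp v" using v by (intro supp_gt) auto
    then show ?thesis using v by (simp add: norm_eq_1)
  qed
  have half: "(\<integral>\<^sup>+d. ennreal ((cap_mass v d)\<^sup>2 / d) * indicator {0<..<T} d \<partial>lborel) \<le> ennreal (4 * C + mass\<^sup>2 * T / r)"
    if v: "norm v = 1" for v
  proof -
    define H where "H d = (cap_mass v d)\<^sup>2" for d
    have mono: "mono H" unfolding H_def mono_def by (auto intro!: power_mono cap_mass_mono)
    have H0: "0 \<le> H d" "H d \<le> mass\<^sup>2" for d unfolding H_def by (auto intro!: power_mono cap_mass_le)
    have "(\<integral>\<^sup>+d. ennreal (H d / d) * indicator {0<..<T} d \<partial>lborel)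
        \<le> (\<integral>\<^sup>+d. ennreal (H d / d) * indicator {0<..<r} d \<partial>lborel) + ennreal (mass\<^sup>2 * T / r)"
      using T by (intro nn_integral_log_extend H0 r borel_measurable_mono[OF mono]) auto
    also have "(\<integral>\<^sup>+d. ennreal (H d / d) * indicator {0<..<r} d \<partial>lborel) \<le> ennreal (4 * C)"
      by (intro nn_integral_log_le_dyadic_sum[OF mono H0(1) r(1)])
         (auto simp: H_def intro!: cap_mass_dyadic_sum_le[OF L2 C v r(1) supp_r[OF v]])
    also have "ennreal (4 * C) + ennreal (mass\<^sup>2 * T / r) = ennreal (4 * C + mass\<^sup>2 * T / r)"
      using C T r by (intro ennreal_plus[symmetric]) auto
    finally show ?thesis by (simp add: H_def add_right_mono)
  qed
  have meas: "(\<lambda>d. (cap_mass v d)\<^sup>2) \<in> borel_measurable borel" for v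
    by (intro borel_measurable_mono) (auto simp: mono_def intro!: power_mono cap_mass_mono)
  have "(\<integral>\<^sup>+d. ennreal ((Lambda \<Omega> v d)\<^sup>2 / d) * indicator {0<..<T} d \<partial>lborel)
      \<le> ennreal (2 * (4 * C + mass\<^sup>2 * T / r))" if v: "norm v = 1" for v
  proof -
    note meas[measurable]
    have "(\<integral>\<^sup>+d. ennreal ((Lambda \<Omega> v d)\<^sup>2 / d) * indicator {0<..<T} d \<partial>lborel)
      \<le> (\<integral>\<^sup>+d. ennreal ((cap_mass v d)\<^sup>2 / d) * indicator {0<..<T} d + ennreal ((cap_mass (- v) d)\<^sup>2 / d) * indicator {0<..<T} d \<partial>lborel)"
    proof (intro nn_integral_mono)
      fix d
      show "ennreal ((Lambda \<Omega> v d)\<^sup>2 / d) * indicator {0<..<T} d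
        \<le> ennreal ((cap_mass v d)\<^sup>2 / d) * indicator {0<..<T} d + ennreal ((cap_mass (- v) d)\<^sup>2 / d) * indicator {0<..<T} d"
        using v by (auto simp: Lambda_eq max_def indicator_def add_increasing add_increasing2)
    qed
    also have "\<dots> = (\<integral>\<^sup>+d. ennreal ((cap_mass v d)\<^sup>2 / d) * indicator {0<..<T} d \<partial>lborel)
        + (\<integral>\<^sup>+d. ennreal ((cap_mass (- v) d)\<^sup>2 / d) * indicator {0<..<T} d \<partial>lborel)"
      by (intro nn_integral_add) measurable
    also have "\<dots> \<le> ennreal (4 * C + mass\<^sup>2 * T / r) + ennreal (4 * C + mass\<^sup>2 * T / r)"
      using v by (intro add_mono half) auto
    also have "\<dots> = ennreal (2 * (4 * C + mass\<^sup>2 * T / r))"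
      using C T r by (subst ennreal_plus[symmetric]) (auto simp: algebra_simps)
    finally show ?thesis .
  qed
  then show ?thesis by blast
qed

end

theorem theorem1p2:
  fixes \<Omega> :: "(real^2) set" and \<delta>0 :: real
  assumes "convex \<Omega>" and "open \<Omega>" and "compact (closure \<Omega>)" and "0 \<in> \<Omega>"
    and "\<delta>0 > 0"
    and "\<forall>\<theta> \<in> sphere 0 1. \<forall>\<delta>. 0 < \<delta> \<and> \<delta> < \<delta>0 \<longrightarrow>
           cap_plus \<Omega> \<theta> \<delta> \<inter> cap_minus \<Omega> \<theta> \<delta> = {}"
  shows "L2_bounded \<Omega> \<longleftrightarrow>
    (SUP \<theta> \<in> sphere 0 1.
       \<integral>\<^sup>+ \<delta>. ennreal ((Lambda \<Omega> \<theta> \<delta>)\<^sup>2 / \<delta>) * indicator {0<..<\<delta>0} \<delta> \<partial>lborel) < \<infinity>"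
proof -
  interpret convex_domain \<Omega>
    using assms(1-4) by unfold_locales (auto intro: bounded_subset[OF compact_imp_bounded closure_subset])
  let ?I = "\<lambda>T v. \<integral>\<^sup>+d. ennreal ((Lambda \<Omega> v d)\<^sup>2 / d) * indicator {0<..<T} d \<partial>lborel"
  show ?thesis
  proof
    assume "L2_bounded \<Omega>"
    then obtain G where "\<And>v. norm v = 1 \<Longrightarrow> ?I \<delta>0 v \<le> ennreal G"
      using integral_bound_of_L2_bounded[OF _ \<open>\<delta>0 > 0\<close>] by blast
    then have "(SUP v\<in>sphere 0 1. ?I \<delta>0 v) \<le> ennreal G" by (intro SUP_least) simp
    then show "(SUP v\<in>sphere 0 1. ?I \<delta>0 v) < \<infinity>" by (simp add: le_less_trans)
  next
    assume fin: "(SUP v\<in>sphere 0 1. ?I \<delta>0 v) < \<infinity>"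
    define G where "G = enn2real (SUP v\<in>sphere 0 1. ?I \<delta>0 v)"
    have G: "?I \<delta>0 v \<le> ennreal G" if "norm v = 1" for v
      unfolding G_def using fin that by (auto intro!: SUP_upper)
    \<comment> \<open>The multiplier estimate uses heights up to \<open>2 * pi\<close>. The range
      beyond \<open>\<delta>0\<close> adds a bounded amount because \<open>Lambda\<close> is at most
      the total length.\<close>
    have "?I (2 * pi) v \<le> ennreal (G + mass\<^sup>2 * (2 * pi) / \<delta>0)" if v: "norm v = 1" for v
    proof -
      have "mono (\<lambda>d. (Lambda \<Omega> v d)\<^sup>2)"
        unfolding mono_def using v by (auto intro!: power_mono Lambda_mono Lambda_nonneg)
      then have "?I (2 * pi) v \<le> ?I \<delta>0 v + ennreal (mass\<^sup>2 * (2 * pi) / \<delta>0)"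
        using v \<open>\<delta>0 > 0\<close>
        by (intro nn_integral_log_extend borel_measurable_mono) (auto intro!: power_mono Lambda_le Lambda_nonneg)
      also have "\<dots> \<le> ennreal G + ennreal (mass\<^sup>2 * (2 * pi) / \<delta>0)" by (intro add_right_mono G v)
      also have "\<dots> = ennreal (G + mass\<^sup>2 * (2 * pi) / \<delta>0)"
        using \<open>\<delta>0 > 0\<close> by (intro ennreal_plus[symmetric]) (auto simp: G_def)
      finally show ?thesis .
    qed
    then show "L2_bounded \<Omega>"
      by (rule L2_bounded_of_integral_bound) (use \<open>\<delta>0 > 0\<close> in \<open>simp_all add: G_def\<close>)
  qed
qed

end
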